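(* Let $G=\mathbb Z_p^d$ with $p$ prime, where $p=p_N$, $d=d_N$, $k=k_N$ are sequences indexed by $N\in\mathbb N$ with $p^d\to\infty$ as $N\to\infty$. Assume $1\ll k\lesssim d\log p$. Let $Z_1,\dots,Z_k$ be i.i.d. uniform on $G$, and let $d^\pm_{G_k,N}(t)$ be the total variation distance to uniform at time $t$ of the random walk on the directed ($+$), respectively undirected ($-$), Cayley graph of $G$ generated by $[Z_1,\dots,Z_k]$. Let $t_\alpha$, $\alpha\in\mathbb R$, be the entropic times defined in the context. (i) Suppose that $(k-d)p\gg1$ (with $k>d$). Then the random walk on $G_k$ exhibits cutoff with high probability at $t_0$. More precisely, let $(\beta_N)_{N\in\mathbb N}$ be a sequence of positive reals with $\beta_N\to\infty$ (arbitrarily slowly, in particular slowly enough that $t_{\pm\beta_N}$ are defined) and let $c\in\{-1,+1\}$. Then $$d^\pm_{G_k,N}(t_{c\beta_N})\to\mathbf 1\{c=-1\}\quad\text{in probability as }N\to\infty.$$ Moreover, the implicit lower bound (case $c=-1$) holds deterministically, i.e. for all choices of generators $Z_1,\dots,Z_k\in G$. (ii) If instead $0\le(k-d)p\lesssim1$, then, conditional on the uniformly chosen multiset $[Z_1,\dots,Z_k]$ generating $G$, there is cutoff with high probability at time $\tfrac12 d\log d/(1-\cos(2\pi/p))$; i.e. for all fixed $\varepsilon\in(0,1)$, the total variation distance at $(1+\varepsilon)$ times this time converges in (conditional) probability to $0$ and at $(1-\varepsilon)$ times this time to $1$.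
   Context: Asymptotic notation is along the sequence: $a\ll b$ means $a/b\to0$; $a\lesssim b$ means $a/b$ is bounded. "With high probability" means with probability tending to 1. Random walk on a Cayley graph: the continuous-time, rate-1 random walk on the directed Cayley graph of the Abelian group $G$ generated by $Z=[Z_1,\dots,Z_k]$, started from the identity, jumps at rate 1; at each jump $i\in\{1,\dots,k\}$ is chosen uniformly and $Z_i$ is added to the current position. In the undirected case, $Z_i$ or $-Z_i$ is added, with probability $\frac12$ each. Total variation distance to uniform is that of the law of the walk conditional on $Z$; it is a function of $Z$. Entropic times: let $W$ be the rate-1 walk on $\mathbb Z_p^k$ started from $0$: at rate 1 a uniformly chosen coordinate is changed (mod $p$), by $+1$ in the directed case, and by $\pm1$ with probability $\frac12$ each in the undirected case. So $W_1(sk)$, $s\ge0$, is a rate-1 walk on $\mathbb Z_p$. Let $H(s)$ be the Shannon entropy (natural logarithm) of the law of $W_1(sk)$ and $R(s):=\log p-H(s)$ the relative entropy, a strictly decreasing bijection from $[0,\infty)$ to $(0,\log p]$. Set $$\zeta:=\tfrac1k(k-d)\log p,\qquad \zeta_\alpha:=\zeta\Bigl(1-\frac{2\alpha}{\sqrt{\zeta k(\zeta\vee1)}}\Bigr),\qquad s_\alpha:=R^{-1}(\zeta_\alpha),\qquad t_\alpha:=s_\alpha k,$$ whenever $\zeta_\alpha\in(0,\log p]$. In particular, $t_0$ is the time at which the entropy of $W$ equals $\log(p^d)$. When $k>d$, the condition $(k-d)p\gg1$ is equivalent to $\zeta k\gg1$. *)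

theory Defs
  imports "HOL-Probability.Probability" "HOL-Algebra.Product_Groups"
    "HOL-Computational_Algebra.Primes"
begin

text \<open>The group of vectors of length \<open>d\<close> over the integers modulo \<open>p\<close>.\<close>

definition Zpow :: "nat \<Rightarrow> nat \<Rightarrow> (nat \<Rightarrow> int) monoid" where
  "Zpow p d = product_group {..<d} (\<lambda>_. integer_mod_group p)"

datatype orientation = Directed | Undirected

subsection \<open>Random walk on a Cayley graph\<close>

text \<open>Generators are given as a list, so that repetitions (multisets) are allowed.\<close>

definition increment :: "orientation \<Rightarrow> ('a, 'b) monoid_scheme \<Rightarrow> 'a list \<Rightarrow> 'a pmf" where
  "increment dir G Z =
     do {i \<leftarrow> pmf_of_set {..<length Z};
         case dir of
           Directed \<Rightarrow> return_pmf (Z ! i)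
         | Undirected \<Rightarrow>
             map_pmf (\<lambda>b. if b then Z ! i else inv\<^bsub>G\<^esub> (Z ! i)) (bernoulli_pmf (1 / 2))}"

primrec jump_chain :: "orientation \<Rightarrow> ('a, 'b) monoid_scheme \<Rightarrow> 'a list \<Rightarrow> nat \<Rightarrow> 'a pmf" where
  "jump_chain dir G Z 0 = return_pmf \<one>\<^bsub>G\<^esub>"
| "jump_chain dir G Z (Suc n) =
     do {x \<leftarrow> jump_chain dir G Z n; z \<leftarrow> increment dir G Z; return_pmf (x \<otimes>\<^bsub>G\<^esub> z)}"

text \<open>Number of jumps by time \<open>t \<ge> 0\<close> of a rate-1 Poisson process; the constant
  \<^const>\<open>poisson_pmf\<close> is only specified for positive rates.\<close>

definition jump_count :: "real \<Rightarrow> nat pmf" where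
  "jump_count t = (if t = 0 then return_pmf 0 else poisson_pmf t)"

definition walk :: "orientation \<Rightarrow> ('a, 'b) monoid_scheme \<Rightarrow> 'a list \<Rightarrow> real \<Rightarrow> 'a pmf" where
  "walk dir G Z t = bind_pmf (jump_count t) (jump_chain dir G Z)"

definition tv_dist :: "'a pmf \<Rightarrow> 'a pmf \<Rightarrow> real" where
  "tv_dist P Q = (SUP A. \<bar>measure_pmf.prob P A - measure_pmf.prob Q A\<bar>)"

definition tv_to_uniform ::
  "orientation \<Rightarrow> ('a, 'b) monoid_scheme \<Rightarrow> 'a list \<Rightarrow> real \<Rightarrow> real" where
  "tv_to_uniform dir G Z t = tv_dist (walk dir G Z t) (pmf_of_set (carrier G))"

definition random_generators :: "('a, 'b) monoid_scheme \<Rightarrow> nat \<Rightarrow> 'a list pmf" where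
  "random_generators G k = replicate_pmf k (pmf_of_set (carrier G))"

definition generating :: "('a, 'b) monoid_scheme \<Rightarrow> 'a list set" where
  "generating G = {Z. generate G (set Z) = carrier G}"

subsection \<open>Entropic times\<close>

definition unit_vectors :: "nat \<Rightarrow> (nat \<Rightarrow> int) list" where
  "unit_vectors k = map (\<lambda>i. \<lambda>j\<in>{..<k}. if j = i then 1 else 0) [0..<k]"

text \<open>The walk \<open>W\<close> on the \<open>k\<close>-th power of the integers modulo \<open>p\<close>: changing a uniformly chosen
  coordinate means adding (or subtracting) a uniformly chosen unit vector.\<close>

definition coord_walk :: "orientation \<Rightarrow> nat \<Rightarrow> nat \<Rightarrow> real \<Rightarrow> (nat \<Rightarrow> int) pmf" where
  "coord_walk dir p k t = walk dir (Zpow p k) (unit_vectors k) t"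

text \<open>Entropy of the first coordinate \<open>W\<^sub>1\<close> (here at index 0) at time \<open>s * k\<close>; logarithms are
  natural (base \<open>exp 1\<close>).\<close>

definition coord_entropy :: "orientation \<Rightarrow> nat \<Rightarrow> nat \<Rightarrow> real \<Rightarrow> real" where
  "coord_entropy dir p k s =
     prob_space.entropy (measure_pmf (coord_walk dir p k (s * real k))) (exp 1)
       (count_space UNIV) (\<lambda>w. w 0)"

definition rel_entropy :: "orientation \<Rightarrow> nat \<Rightarrow> nat \<Rightarrow> real \<Rightarrow> real" where
  "rel_entropy dir p k s = ln (real p) - coord_entropy dir p k s"

definition zeta :: "nat \<Rightarrow> nat \<Rightarrow> nat \<Rightarrow> real" where
  "zeta p d k = 1 / real k * (real k - real d) * ln (real p)"

definition zeta_shift :: "nat \<Rightarrow> nat \<Rightarrow> nat \<Rightarrow> real \<Rightarrow> real" where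
  "zeta_shift p d k \<alpha> =
     zeta p d k * (1 - 2 * \<alpha> / sqrt (zeta p d k * real k * max (zeta p d k) 1))"

text \<open>Meaningful when \<open>zeta_shift p d k \<alpha>\<close> lies in \<open>{0<..ln p}\<close>.\<close>

definition entropic_time :: "orientation \<Rightarrow> nat \<Rightarrow> nat \<Rightarrow> nat \<Rightarrow> real \<Rightarrow> real" where
  "entropic_time dir p d k \<alpha> =
     the_inv_into {0..} (rel_entropy dir p k) (zeta_shift p d k \<alpha>) * real k"

definition entropic_time_defined :: "nat \<Rightarrow> nat \<Rightarrow> nat \<Rightarrow> real \<Rightarrow> bool" where
  "entropic_time_defined p d k \<alpha> \<longleftrightarrow> zeta_shift p d k \<alpha> \<in> {0<..ln (real p)}"

subsection \<open>Convergence in probability and cutoff\<close>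

definition tendsto_in_prob :: "(nat \<Rightarrow> 'a pmf) \<Rightarrow> (nat \<Rightarrow> 'a \<Rightarrow> real) \<Rightarrow> real \<Rightarrow> bool" where
  "tendsto_in_prob P X c \<longleftrightarrow>
     (\<forall>\<delta>>0. (\<lambda>N. measure_pmf.prob (P N) {\<omega>. \<bar>X N \<omega> - c\<bar> > \<delta>}) \<longlonglongrightarrow> 0)"

text \<open>\<open>D N \<omega> t\<close> is the distance to equilibrium at time \<open>t\<close> in the random environment \<open>\<omega>\<close>,
  which has law \<open>P N\<close>.\<close>

definition cutoff_whp ::
  "(nat \<Rightarrow> 'a pmf) \<Rightarrow> (nat \<Rightarrow> 'a \<Rightarrow> real \<Rightarrow> real) \<Rightarrow> (nat \<Rightarrow> real) \<Rightarrow> bool" where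
  "cutoff_whp P D T \<longleftrightarrow>
     (\<forall>\<epsilon>\<in>{0<..<1}.
        tendsto_in_prob P (\<lambda>N \<omega>. D N \<omega> ((1 + \<epsilon>) * T N)) 0 \<and>
        tendsto_in_prob P (\<lambda>N \<omega>. D N \<omega> ((1 - \<epsilon>) * T N)) 1)"

end

theory Submission
  imports Defs "HOL-Real_Asymp.Real_Asymp"
begin

text \<open>
  The walk on the Cayley graph is the image of the coordinate walk \<open>W\<close> under the linear map
  \<open>w \<mapsto> \<Sum> w\<^sub>i Z\<^sub>i\<close>, and the coordinates of \<open>W\<close> are independent. A typical value of \<open>W\<close> has
  probability \<open>exp (- h)\<close>, where \<open>h\<close> is the entropy of \<open>W\<close>. If \<open>h\<close> is smaller than \<open>log (p^d)\<close>, the walk is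
  confined to the image of a set much smaller than the group, for every choice of the generators. If
  \<open>h\<close> is larger, a second moment computation suffices: for distinct \<open>w\<close> and \<open>w'\<close> the images coincide with
  probability exactly \<open>p^(- d)\<close>, because \<open>p\<close> is prime. The fluctuations of the information content are
  controlled by bounding the varentropy of one coordinate by a constant times \<open>min 1 R\<close>, uniformly in
  \<open>p\<close> and in the time, and the window lies inside the cutoff scale because the entropy production of the
  heat kernel on the cycle dominates the square of its oscillation. When \<open>(k - d) p\<close> is bounded, the
  kernel of the linear map is bounded and the product chain \<open>W\<close> itself governs the mixing time: above by
  its chi-square distance, below by the sum of its first characters.
\<close>

subsection \<open>Characters and the random walk\<close>

text \<open>Nothing ties \<open>p\<close> to \<open>k\<close>: \<open>p\<close> may stay bounded or
  grow at any speed, and the entropic time per coordinate may lie far below or far above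
  \<open>p^2\<close>. No single limit law for one coordinate covers this, so every estimate on the
  cycle has to be uniform in \<open>p\<close> and in the time \<open>s\<close>. The tools are a sup
  bound by Fourier inversion, a second moment read off from the first character, and elementary
  inequalities for \<open>x * ln x\<close>. The scale \<open>spread p s\<close>, the reciprocal of 1
  / p + 1 / sqrt (s + 1), handles all regimes at once. The constants are not optimised: 700 bounds
  the second moment of the log density about the log of the spread, 701 and 702 add 1 each, and 1402
  = 2 * 701. Why a cutoff results: the information content fluctuates on the scale sqrt (k * min 1
  R), where R is the entropy deficit of one coordinate, whereas changing the time by a fixed factor
  moves the entropy of \<open>W\<close> by at least a constant times k * min 1 R. The latter wins as
  soon as k * min 1 R tends to infinity, which at the entropic time follows from (k - d) p tending
  to infinity.\<close>

lemma set_increment: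
  assumes "group G" "set Z \<subseteq> carrier G" "Z \<noteq> []"
  shows "set_pmf (increment dir G Z) \<subseteq> carrier G"
proof -
  have *: "{..<length Z} \<noteq> {}" using assms(3) by auto
  have "Z ! i \<in> carrier G" if "i < length Z" for i using assms(2) that by auto
  then show ?thesis
    by (cases dir) (auto simp: increment_def * set_pmf_of_set intro: group.inv_closed[OF assms(1)])
qed

lemma set_jump_chain:
  assumes "group G" "set Z \<subseteq> carrier G" "Z \<noteq> []"
  shows "set_pmf (jump_chain dir G Z n) \<subseteq> carrier G"
proof (induction n)
  case 0
  then show ?case using assms by (simp add: group.is_monoid)
next
  case (Suc n)
  then show ?case using set_increment[OF assms, of dir]
    by (auto intro!: monoid.m_closed[OF group.is_monoid[OF assms(1)]])
qed

lemma set_walk: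
  assumes "group G" "set Z \<subseteq> carrier G" "Z \<noteq> []"
  shows "set_pmf (walk dir G Z t) \<subseteq> carrier G"
  using set_jump_chain[OF assms] by (auto simp: walk_def)

text \<open>Replaces the Poisson mixture by a convergent series, so that characters can be summed
  termwise; at \<open>t = 0\<close> only the term \<open>n = 0\<close> survives.\<close>

lemma pmf_walk_sums:
  assumes "t \<ge> 0"
  shows "(\<lambda>n. exp (-t) * t ^ n / fact n * pmf (jump_chain dir G Z n) x) sums pmf (walk dir G Z t) x"
proof (cases "t = 0")
  case True
  have "(\<lambda>n. exp (-t) * t ^ n / fact n * pmf (jump_chain dir G Z n) x)
      = (\<lambda>n. if n = 0 then pmf (jump_chain dir G Z 0) x else 0)"
    using True by (auto simp: fun_eq_iff)
  moreover have "pmf (walk dir G Z t) x = pmf (jump_chain dir G Z 0) x"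
    using True by (simp add: walk_def jump_count_def bind_return_pmf)
  ultimately show ?thesis using sums_single[of 0 "\<lambda>n. pmf (jump_chain dir G Z 0) x"] by simp
next
  case False
  with assms have t: "t > 0" by simp
  let ?f = "\<lambda>n. pmf (jump_chain dir G Z n) x"
  have int: "integrable (measure_pmf (poisson_pmf t)) ?f"
    by (intro measure_pmf.integrable_const_bound[where B = 1]) (auto simp: pmf_le_1)
  have "integrable (count_space UNIV) (\<lambda>n. pmf (poisson_pmf t) n *\<^sub>R ?f n)"
    using int unfolding measure_pmf_eq_density by (subst (asm) integrable_density) auto
  from sums_integral_count_space_nat[OF this]
  have "(\<lambda>n. pmf (poisson_pmf t) n * ?f n) sums (\<integral>n. pmf (poisson_pmf t) n * ?f n \<partial>count_space UNIV)"
    by simp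
  also have "(\<integral>n. pmf (poisson_pmf t) n * ?f n \<partial>count_space UNIV) = pmf (walk dir G Z t) x"
    using t by (simp add: walk_def jump_count_def pmf_bind) 
      (subst measure_pmf_eq_density, subst integral_density, auto)
  finally show ?thesis using t by (simp add: mult_ac)
qed

text \<open>Characters diagonalise the walk: the jump count only enters through the Poisson
  generating function.\<close>

lemma expectation_jump_chain:
  fixes h :: "'a \<Rightarrow> complex"
  assumes G: "group G" "finite (carrier G)" "set Z \<subseteq> carrier G" "Z \<noteq> []"
    and one: "h \<one>\<^bsub>G\<^esub> = 1"
    and mult: "\<And>x y. x \<in> carrier G \<Longrightarrow> y \<in> carrier G \<Longrightarrow> h (x \<otimes>\<^bsub>G\<^esub> y) = h x * h y"
  shows "measure_pmf.expectation (jump_chain dir G Z n) h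
       = measure_pmf.expectation (increment dir G Z) h ^ n"
proof (induction n)
  case 0
  then show ?case using one by simp
next
  case (Suc n)
  let ?J = "jump_chain dir G Z n" and ?I = "increment dir G Z"
  have J: "set_pmf ?J \<subseteq> carrier G" and I: "set_pmf ?I \<subseteq> carrier G"
    using set_jump_chain set_increment G by blast+
  have fin: "finite (set_pmf ?I)" using I G(2) finite_subset by blast
  have bindI: "?I \<bind> (\<lambda>z. return_pmf (x \<otimes>\<^bsub>G\<^esub> z)) = map_pmf (\<lambda>z. x \<otimes>\<^bsub>G\<^esub> z) ?I" for x
    by (simp add: map_pmf_def)
  have "measure_pmf.expectation (jump_chain dir G Z (Suc n)) h
     = (\<Sum>x\<in>carrier G. pmf ?J x *\<^sub>R measure_pmf.expectation (map_pmf (\<lambda>z. x \<otimes>\<^bsub>G\<^esub> z) ?I) h)"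
    by (simp add: bindI, subst pmf_expectation_bind[OF G(2) _ J]) (auto simp: fin)
  also have "\<dots> = (\<Sum>x\<in>carrier G. pmf ?J x *\<^sub>R (h x * measure_pmf.expectation ?I h))"
  proof (intro sum.cong refl arg_cong2[where f = scaleR])
    fix x assume x: "x \<in> carrier G"
    have "measure_pmf.expectation (map_pmf (\<lambda>z. x \<otimes>\<^bsub>G\<^esub> z) ?I) h
        = measure_pmf.expectation ?I (\<lambda>z. h x * h z)"
      unfolding integral_map_pmf
      by (intro integral_cong_AE) (use x I mult in \<open>auto simp: AE_measure_pmf_iff\<close>)
    then show "measure_pmf.expectation (map_pmf (\<lambda>z. x \<otimes>\<^bsub>G\<^esub> z) ?I) h
        = h x * measure_pmf.expectation ?I h" by simp
  qed
  also have "\<dots> = (\<Sum>x\<in>carrier G. pmf ?J x *\<^sub>R h x) * measure_pmf.expectation ?I h"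
    by (simp add: sum_distrib_right)
  also have "(\<Sum>x\<in>carrier G. pmf ?J x *\<^sub>R h x) = measure_pmf.expectation ?J h"
    using J by (subst integral_measure_pmf[OF G(2)]) auto
  finally show ?case using Suc.IH by simp
qed

lemma expectation_walk:
  fixes h :: "'a \<Rightarrow> complex"
  assumes G: "group G" "finite (carrier G)" "set Z \<subseteq> carrier G" "Z \<noteq> []" and t: "t \<ge> 0"
    and one: "h \<one>\<^bsub>G\<^esub> = 1"
    and mult: "\<And>x y. x \<in> carrier G \<Longrightarrow> y \<in> carrier G \<Longrightarrow> h (x \<otimes>\<^bsub>G\<^esub> y) = h x * h y"
  shows "measure_pmf.expectation (walk dir G Z t) h
       = exp (of_real t * (measure_pmf.expectation (increment dir G Z) h - 1))"
proof -
  let ?w = "measure_pmf.expectation (increment dir G Z) h"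
  have "(\<lambda>n. \<Sum>x\<in>carrier G. of_real (exp (-t) * t ^ n / fact n * pmf (jump_chain dir G Z n) x) * h x)
     sums (\<Sum>x\<in>carrier G. of_real (pmf (walk dir G Z t) x) * h x)"
    by (intro sums_sum sums_mult2 sums_of_real pmf_walk_sums t)
  also have "(\<Sum>x\<in>carrier G. of_real (pmf (walk dir G Z t) x) * h x)
      = measure_pmf.expectation (walk dir G Z t) h"
    using set_walk[OF G(1,3,4)] by (subst integral_measure_pmf[OF G(2)]) (auto simp: scaleR_conv_of_real)
  also have "(\<lambda>n. \<Sum>x\<in>carrier G. of_real (exp (-t) * t ^ n / fact n * pmf (jump_chain dir G Z n) x) * h x)
      = (\<lambda>n. of_real (exp (-t)) * ((of_real t * ?w) ^ n /\<^sub>R fact n))"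
  proof
    fix n
    have "(\<Sum>x\<in>carrier G. of_real (exp (-t) * t ^ n / fact n * pmf (jump_chain dir G Z n) x) * h x)
       = of_real (exp (-t) * t ^ n / fact n) * (\<Sum>x\<in>carrier G. pmf (jump_chain dir G Z n) x *\<^sub>R h x)"
      by (simp add: sum_distrib_left scaleR_conv_of_real mult_ac)
    also have "(\<Sum>x\<in>carrier G. pmf (jump_chain dir G Z n) x *\<^sub>R h x)
       = measure_pmf.expectation (jump_chain dir G Z n) h"
      using set_jump_chain[OF G(1,3,4)] by (subst integral_measure_pmf[OF G(2)]) auto
    also have "\<dots> = ?w ^ n" by (rule expectation_jump_chain[where h = h, OF G one mult])
    finally show "(\<Sum>x\<in>carrier G. of_real (exp (-t) * t ^ n / fact n * pmf (jump_chain dir G Z n) x) * h x)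
        = of_real (exp (-t)) * ((of_real t * ?w) ^ n /\<^sub>R fact n)"
      by (simp add: scaleR_conv_of_real power_mult_distrib field_simps)
  qed
  finally have 1: "(\<lambda>n. of_real (exp (-t)) * ((of_real t * ?w) ^ n /\<^sub>R fact n))
     sums measure_pmf.expectation (walk dir G Z t) h" .
  have 2: "(\<lambda>n. of_real (exp (-t)) * ((of_real t * ?w) ^ n /\<^sub>R fact n))
     sums (of_real (exp (-t)) * exp (of_real t * ?w))"
    by (intro sums_mult exp_converges)
  have "of_real (exp (-t)) * exp (of_real t * ?w) = exp (of_real t * (?w - 1))"
    by (simp add: exp_of_real[symmetric] exp_add[symmetric] algebra_simps del: exp_of_real)
  with 1 2 show ?thesis using sums_unique2 by metis
qed

subsection \<open>Characters of the cyclic group\<close>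

text \<open>The additive character exp (2 pi i j x / p), defined on all integers; both arguments
  enter symmetrically and matter only modulo \<open>p\<close>.\<close>

definition cyc_char :: "nat \<Rightarrow> int \<Rightarrow> int \<Rightarrow> complex" where
  "cyc_char p j x = cis (2 * pi * of_int (j * x) / real p)"

lemma cyc_char_0 [simp]: "cyc_char p j 0 = 1" "cyc_char p 0 x = 1"
  by (simp_all add: cyc_char_def)

lemma norm_cyc_char [simp]: "norm (cyc_char p j x) = 1"
  by (simp add: cyc_char_def)

lemma cyc_char_add: "cyc_char p j (x + y) = cyc_char p j x * cyc_char p j y"
  by (simp add: cyc_char_def cis_mult algebra_simps add_divide_distrib)

lemma cyc_char_commute: "cyc_char p j x = cyc_char p x j"
  by (simp add: cyc_char_def mult.commute)

lemma cyc_char_power: "cyc_char p j x ^ n = cyc_char p j (int n * x)"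
  by (simp add: cyc_char_def Complex.DeMoivre algebra_simps)

lemma cyc_char_period: "p > 0 \<Longrightarrow> cyc_char p j (int p * m) = 1"
proof -
  assume "p > 0"
  then have "2 * pi * of_int (j * (int p * m)) / real p = 2 * pi * of_int (j * m)"
    by (simp add: field_simps)
  then show ?thesis unfolding cyc_char_def by (metis Ints_of_int cis_multiple_2pi)
qed

lemma cyc_char_mod: "p > 0 \<Longrightarrow> cyc_char p j (x mod int p) = cyc_char p j x"
  using cyc_char_add[of p j "int p * (x div int p)" "x mod int p"] cyc_char_period[of p j]
  by simp

lemma cyc_char_uminus: "cyc_char p j (- x) = cnj (cyc_char p j x)"
  by (simp add: cyc_char_def cis_cnj)

lemma sum_int_atLeastLessThan: "(\<Sum>j\<in>{0..<int p}. f j) = (\<Sum>j<p. f (int j))"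
  by (rule sum.reindex_bij_witness[where i = int and j = nat]) auto

lemma sum_cyc_char:
  assumes "p > 0"
  shows "(\<Sum>j\<in>{0..<int p}. cyc_char p j x) = (if int p dvd x then of_nat p else 0)"
proof -
  have eq: "(\<Sum>j\<in>{0..<int p}. cyc_char p j x) = (\<Sum>j<p. cyc_char p x 1 ^ j)"
    unfolding sum_int_atLeastLessThan
    by (intro sum.cong refl) (metis cyc_char_commute cyc_char_power mult.right_neutral)
  show ?thesis
  proof (cases "int p dvd x")
    case True
    then obtain m where "x = int p * m" by auto
    then have "cyc_char p x 1 = 1" using cyc_char_period[OF assms, of 1 m]
      by (simp add: cyc_char_commute[of p _ 1])
    with True eq show ?thesis by simp
  next
    case False
    have ne: "cyc_char p x 1 \<noteq> 1"
    proof
      assume "cyc_char p x 1 = 1"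
      then have "cos (2 * pi * of_int x / real p) = 1"
        by (simp add: cyc_char_def complex_eq_iff)
      then obtain n :: int where "2 * pi * of_int x / real p = of_int n * 2 * pi"
        using cos_one_2pi_int by blast
      then have "real_of_int x = of_int n * real p" using assms by (simp add: field_simps)
      then have "x = n * int p" by (metis of_int_eq_iff of_int_mult of_int_of_nat_eq)
      with False show False by simp
    qed
    have "cyc_char p x 1 ^ p = 1" using cyc_char_period[OF assms, of x 1]
      by (simp add: cyc_char_power)
    then have "(\<Sum>j<p. cyc_char p x 1 ^ j) = 0"
      using geometric_sum[OF ne, of p] by simp
    with False eq show ?thesis by simp
  qed
qed

subsection \<open>The walk on a power of the cyclic group\<close>

lemma carrier_Zpow: "p > 0 \<Longrightarrow> carrier (Zpow p k) = ({..<k} \<rightarrow>\<^sub>E {0..<int p})"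
  by (simp add: Zpow_def carrier_integer_mod_group)

lemma group_Zpow [simp]: "group (Zpow p k)"
  by (simp add: Zpow_def)

lemma finite_carrier_Zpow [simp]: "p > 0 \<Longrightarrow> finite (carrier (Zpow p k))"
  by (simp add: carrier_Zpow finite_PiE)

lemma card_carrier_Zpow: "p > 0 \<Longrightarrow> card (carrier (Zpow p k)) = p ^ k"
  by (simp add: carrier_Zpow card_PiE)

lemma mult_Zpow: "x \<otimes>\<^bsub>Zpow p k\<^esub> y = (\<lambda>i\<in>{..<k}. (x i + y i) mod int p)"
  by (simp add: Zpow_def)

lemma one_Zpow: "\<one>\<^bsub>Zpow p k\<^esub> = (\<lambda>i\<in>{..<k}. 0)"
  by (simp add: Zpow_def)

lemma inv_Zpow:
  "p > 0 \<Longrightarrow> x \<in> carrier (Zpow p k) \<Longrightarrow> inv\<^bsub>Zpow p k\<^esub> x = (\<lambda>i\<in>{..<k}. (- x i) mod int p)"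
  unfolding Zpow_def by (subst inv_product_group) (auto simp: PiE_iff)

lemma length_unit_vectors [simp]: "length (unit_vectors k) = k"
  by (simp add: unit_vectors_def)

lemma nth_unit_vectors:
  "i < k \<Longrightarrow> unit_vectors k ! i = (\<lambda>j\<in>{..<k}. if j = i then 1 else 0)"
  by (simp add: unit_vectors_def)

lemma set_unit_vectors: "p \<ge> 2 \<Longrightarrow> set (unit_vectors k) \<subseteq> carrier (Zpow p k)"
  by (auto simp: unit_vectors_def carrier_Zpow PiE_iff split: if_splits)

text \<open>Treats both orientations at once: a jump adds the generator times 1 or times
  \<open>turn dir\<close>, each with probability 1/2, and for the directed walk the two signs
  coincide.\<close>

definition turn :: "orientation \<Rightarrow> int" where
  "turn dir = (case dir of Directed \<Rightarrow> 1 | Undirected \<Rightarrow> - 1)"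

text \<open>Eigenvalue of one jump on the cycle at frequency \<open>j\<close>.\<close>

definition step_char :: "orientation \<Rightarrow> nat \<Rightarrow> int \<Rightarrow> complex" where
  "step_char dir p j = (cyc_char p j 1 + cyc_char p j (turn dir)) / 2"

definition circle_walk :: "orientation \<Rightarrow> nat \<Rightarrow> real \<Rightarrow> int pmf" where
  "circle_walk dir p s = walk dir (integer_mod_group p) [1] s"

lemma expectation_increment:
  fixes h :: "'a \<Rightarrow> complex"
  assumes "Z \<noteq> []"
    and h: "\<And>i. i < length Z \<Longrightarrow> h (Z ! i) = f i 1" "\<And>i. i < length Z \<Longrightarrow> h (inv\<^bsub>G\<^esub> (Z ! i)) = f i (-1)"
  shows "measure_pmf.expectation (increment dir G Z) h
       = (\<Sum>i<length Z. (f i 1 + f i (turn dir)) / 2) / of_nat (length Z)"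
proof -
  have ne: "{..<length Z} \<noteq> {}" using assms(1) by auto
  have "measure_pmf.expectation (increment dir G Z) h
      = (\<Sum>i<length Z. (f i 1 + f i (turn dir)) / 2 /\<^sub>R real (card {..<length Z}))"
    unfolding increment_def
  proof (subst pmf_expectation_bind_pmf_of_set[OF ne])
    show "(\<Sum>i<length Z. measure_pmf.expectation (case dir of Directed \<Rightarrow> return_pmf (Z ! i)
         | Undirected \<Rightarrow> map_pmf (\<lambda>b. if b then Z ! i else inv\<^bsub>G\<^esub> (Z ! i)) (bernoulli_pmf (1 / 2))) h
           /\<^sub>R real (card {..<length Z})) = (\<Sum>i<length Z. (f i 1 + f i (turn dir)) / 2 /\<^sub>R real (card {..<length Z}))"
      by (intro sum.cong refl)
        (cases dir, auto simp: h turn_def integral_measure_pmf[of UNIV] UNIV_bool scaleR_conv_of_real field_simps)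
  qed (auto split: orientation.split)
  also have "\<dots> = (\<Sum>i<length Z. (f i 1 + f i (turn dir)) / 2) / of_nat (length Z)"
    by (simp add: sum_divide_distrib scaleR_conv_of_real field_simps)
  finally show ?thesis .
qed

lemma set_circle_walk: "p \<ge> 2 \<Longrightarrow> set_pmf (circle_walk dir p s) \<subseteq> {0..<int p}"
  using set_walk[of "integer_mod_group p" "[1]" dir s]
  by (simp add: circle_walk_def carrier_integer_mod_group)

lemma expectation_circle_walk:
  assumes "p \<ge> 2" "s \<ge> 0"
  shows "measure_pmf.expectation (circle_walk dir p s) (cyc_char p j)
       = exp (of_real s * (step_char dir p j - 1))"
proof -
  have "measure_pmf.expectation (increment dir (integer_mod_group p) [1]) (cyc_char p j)
       = (\<Sum>i<length [1::int]. (cyc_char p j 1 + cyc_char p j (turn dir)) / 2) / of_nat (length [1::int])"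
    using assms cyc_char_mod[of p j "-1"] by (intro expectation_increment) (auto simp: carrier_integer_mod_group)
  also have "\<dots> = step_char dir p j" by (simp add: step_char_def)
  finally have E: "measure_pmf.expectation (increment dir (integer_mod_group p) [1]) (cyc_char p j)
    = step_char dir p j" .
  show ?thesis unfolding circle_walk_def E[symmetric]
    using assms by (intro expectation_walk)
      (auto simp: carrier_integer_mod_group cyc_char_mod cyc_char_add)
qed

lemma expectation_coord_walk:
  assumes "p \<ge> 2" "k > 0" "t \<ge> 0"
  shows "measure_pmf.expectation (coord_walk dir p k t) (\<lambda>w. \<Prod>i<k. cyc_char p (a i) (w i))
       = (\<Prod>i<k. exp (of_real (t / real k) * (step_char dir p (a i) - 1)))"
proof -
  let ?h = "\<lambda>w. \<Prod>i<k. cyc_char p (a i) (w i)"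
  have U: "set (unit_vectors k) \<subseteq> carrier (Zpow p k)" "unit_vectors k \<noteq> []"
    using set_unit_vectors assms length_unit_vectors[of k] by (auto simp del: length_unit_vectors)
  have ui: "unit_vectors k ! i \<in> carrier (Zpow p k)" if "i < k" for i
    using U(1) that by auto
  have prod_single: "(\<Prod>j<k. cyc_char p (a j) (if j = i then x else 0)) = cyc_char p (a i) x" if "i < k" for i x
  proof -
    have "(\<Prod>j<k. cyc_char p (a j) (if j = i then x else 0)) = (\<Prod>j<k. if j = i then cyc_char p (a j) x else 1)"
      by (intro prod.cong) auto
    then show ?thesis using that by simp
  qed
  have "?h (unit_vectors k ! i) = cyc_char p (a i) 1" if "i < k" for i
    using prod_single[OF that, of 1] that by (simp add: nth_unit_vectors)
  moreover have "?h (inv\<^bsub>Zpow p k\<^esub> (unit_vectors k ! i)) = cyc_char p (a i) (-1)" if "i < k" for i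
  proof -
    have "?h (inv\<^bsub>Zpow p k\<^esub> (unit_vectors k ! i)) = (\<Prod>j<k. cyc_char p (a j) (if j = i then - 1 else 0))"
      using that assms ui[OF that] by (intro prod.cong) (auto simp: inv_Zpow nth_unit_vectors cyc_char_mod)
    then show ?thesis using prod_single[OF that, of "-1"] by simp
  qed
  moreover have one: "?h \<one>\<^bsub>Zpow p k\<^esub> = 1"
    by (intro prod.neutral) (simp add: one_Zpow)
  moreover have mult: "?h (x \<otimes>\<^bsub>Zpow p k\<^esub> y) = ?h x * ?h y" for x y
    using assms unfolding prod.distrib[symmetric]
    by (intro prod.cong refl) (simp add: mult_Zpow cyc_char_mod cyc_char_add)
  ultimately have "measure_pmf.expectation (increment dir (Zpow p k) (unit_vectors k)) ?h
     = (\<Sum>i<k. step_char dir p (a i)) / of_nat k"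
    using expectation_increment[OF U(2), of ?h "\<lambda>i. cyc_char p (a i)" "Zpow p k" dir]
    by (simp add: step_char_def)
  then have "measure_pmf.expectation (coord_walk dir p k t) ?h
     = exp (of_real t * ((\<Sum>i<k. step_char dir p (a i)) / of_nat k - 1))"
    unfolding coord_walk_def using assms U one mult
    by (subst expectation_walk) auto
  also have "of_real t * ((\<Sum>i<k. step_char dir p (a i)) / of_nat k - 1)
     = of_real (t / real k) * ((\<Sum>i<k. step_char dir p (a i)) - of_nat k)"
    using assms by (simp add: field_simps)
  also have "\<dots> = (\<Sum>i<k. of_real (t / real k) * (step_char dir p (a i) - 1))"
    by (simp only: sum_distrib_left[symmetric] sum_subtractf) simp
  finally show ?thesis by (simp add: exp_sum)
qed

lemma dvd_diff_residues:
  assumes "x \<in> {0..<int p}" "y \<in> {0..<int p}"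
  shows "int p dvd y - x \<longleftrightarrow> y = x"
  using assms mod_eq_dvd_iff[of y "int p" x] by auto

lemma cyclic_inversion:
  assumes "p > 0" "set_pmf P \<subseteq> {0..<int p}" "x \<in> {0..<int p}"
  shows "of_nat p * of_real (pmf P x)
       = (\<Sum>j\<in>{0..<int p}. cyc_char p j (- x) * measure_pmf.expectation P (cyc_char p j))"
proof -
  have "(\<Sum>j\<in>{0..<int p}. cyc_char p j (- x) * measure_pmf.expectation P (cyc_char p j))
      = (\<Sum>j\<in>{0..<int p}. \<Sum>y\<in>{0..<int p}. of_real (pmf P y) * cyc_char p j (y - x))"
  proof (intro sum.cong refl)
    fix j
    have "measure_pmf.expectation P (cyc_char p j) = (\<Sum>y\<in>{0..<int p}. pmf P y *\<^sub>R cyc_char p j y)"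
      using assms by (intro integral_measure_pmf) auto
    then show "cyc_char p j (- x) * measure_pmf.expectation P (cyc_char p j)
       = (\<Sum>y\<in>{0..<int p}. of_real (pmf P y) * cyc_char p j (y - x))"
      by (simp add: sum_distrib_left scaleR_conv_of_real cyc_char_add[of p j _ "-x", simplified] mult_ac)
  qed
  also have "\<dots> = (\<Sum>y\<in>{0..<int p}. of_real (pmf P y) * (\<Sum>j\<in>{0..<int p}. cyc_char p j (y - x)))"
    by (subst sum.swap) (simp add: sum_distrib_left)
  also have "\<dots> = (\<Sum>y\<in>{0..<int p}. if y = x then of_nat p * of_real (pmf P x) else 0)"
    using assms by (intro sum.cong refl) (auto simp: sum_cyc_char dvd_diff_residues)
  also have "\<dots> = of_nat p * of_real (pmf P x)" using assms by simp
  finally show ?thesis by simp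
qed

text \<open>Orthogonality of characters factorises over the coordinates, so a law on the power is
  determined by its character expectations.\<close>

lemma Zpow_inversion:
  assumes "p > 0" "set_pmf P \<subseteq> carrier (Zpow p k)" "x \<in> carrier (Zpow p k)"
  shows "of_nat p ^ k * of_real (pmf P x)
       = (\<Sum>a\<in>carrier (Zpow p k). (\<Prod>i<k. cyc_char p (a i) (- x i)) *
            measure_pmf.expectation P (\<lambda>w. \<Prod>i<k. cyc_char p (a i) (w i)))"
proof -
  let ?C = "carrier (Zpow p k)"
  have "(\<Sum>a\<in>?C. (\<Prod>i<k. cyc_char p (a i) (- x i)) *
            measure_pmf.expectation P (\<lambda>w. \<Prod>i<k. cyc_char p (a i) (w i)))
      = (\<Sum>a\<in>?C. \<Sum>y\<in>?C. of_real (pmf P y) * (\<Prod>i<k. cyc_char p (a i) (y i - x i)))"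
  proof (intro sum.cong refl)
    fix a
    have "measure_pmf.expectation P (\<lambda>w. \<Prod>i<k. cyc_char p (a i) (w i))
        = (\<Sum>y\<in>?C. pmf P y *\<^sub>R (\<Prod>i<k. cyc_char p (a i) (y i)))"
      using assms by (intro integral_measure_pmf) auto
    then show "(\<Prod>i<k. cyc_char p (a i) (- x i)) *
         measure_pmf.expectation P (\<lambda>w. \<Prod>i<k. cyc_char p (a i) (w i))
       = (\<Sum>y\<in>?C. of_real (pmf P y) * (\<Prod>i<k. cyc_char p (a i) (y i - x i)))"
      by (simp add: sum_distrib_left scaleR_conv_of_real prod.distrib[symmetric] cyc_char_add[symmetric] mult_ac)
  qed
  also have "\<dots> = (\<Sum>y\<in>?C. of_real (pmf P y) * (\<Sum>a\<in>?C. \<Prod>i<k. cyc_char p (a i) (y i - x i)))"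
    by (subst sum.swap) (simp add: sum_distrib_left)
  also have "\<dots> = (\<Sum>y\<in>?C. if y = x then of_nat p ^ k * of_real (pmf P x) else 0)"
  proof (intro sum.cong refl)
    fix y assume y: "y \<in> ?C"
    have "(\<Sum>a\<in>?C. \<Prod>i<k. cyc_char p (a i) (y i - x i))
        = (\<Prod>i<k. \<Sum>j\<in>{0..<int p}. cyc_char p j (y i - x i))"
      using assms(1) by (subst prod_sum_PiE) (auto simp: carrier_Zpow)
    also have "\<dots> = (\<Prod>i<k. if y i = x i then of_nat p else 0)"
      using y assms by (intro prod.cong refl) (auto simp: sum_cyc_char carrier_Zpow PiE_iff dvd_diff_residues)
    also have "\<dots> = (if y = x then of_nat p ^ k else 0)"
    proof (cases "y = x")
      case False
      then obtain i where "i < k" "y i \<noteq> x i"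
        using y assms(1,3) PiE_ext unfolding carrier_Zpow[OF assms(1)] by blast
      then show ?thesis using False by auto
    qed auto
    finally show "of_real (pmf P y) * (\<Sum>a\<in>?C. \<Prod>i<k. cyc_char p (a i) (y i - x i))
        = (if y = x then of_nat p ^ k * of_real (pmf P x) else 0)" by auto
  qed
  also have "\<dots> = of_nat p ^ k * of_real (pmf P x)" using assms by simp
  finally show ?thesis by simp
qed

text \<open>Poisson thinning, read off from the characters of both sides.\<close>

lemma coord_walk_eq_Pi_pmf:
  assumes "p \<ge> 2" "k > 0" "t \<ge> 0"
  shows "coord_walk dir p k t = Pi_pmf {..<k} undefined (\<lambda>_. circle_walk dir p (t / real k))"
proof (rule pmf_eqI)
  fix x
  let ?C = "carrier (Zpow p k)" and ?q = "circle_walk dir p (t / real k)"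
  have set1: "set_pmf (coord_walk dir p k t) \<subseteq> ?C"
    unfolding coord_walk_def using set_unit_vectors[OF assms(1)] assms(2)
    by (intro set_walk) (auto simp: unit_vectors_def)
  have p0: "p > 0" using assms by simp
  show "pmf (coord_walk dir p k t) x = pmf (Pi_pmf {..<k} undefined (\<lambda>_. ?q)) x"
  proof (cases "x \<in> ?C")
    case False
    have "set_pmf (Pi_pmf {..<k} undefined (\<lambda>_. ?q)) \<subseteq> ?C"
      using set_circle_walk[OF assms(1), of dir "t / real k"]
      by (auto simp: carrier_Zpow[OF p0] set_Pi_pmf PiE_dflt_def PiE_iff extensional_def)
    then have "pmf (Pi_pmf {..<k} undefined (\<lambda>_. ?q)) x = 0" "pmf (coord_walk dir p k t) x = 0"
      using False set1 by (auto simp: set_pmf_iff)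
    then show ?thesis by simp
  next
    case True
    have "of_nat p ^ k * complex_of_real (pmf (coord_walk dir p k t) x)
       = (\<Sum>a\<in>?C. (\<Prod>i<k. cyc_char p (a i) (- x i)) * (\<Prod>i<k. exp (of_real (t / real k) * (step_char dir p (a i) - 1))))"
      unfolding Zpow_inversion[OF p0 set1 True] expectation_coord_walk[OF assms] ..
    also have "\<dots> = (\<Prod>i<k. \<Sum>j\<in>{0..<int p}. cyc_char p j (- x i) * exp (of_real (t / real k) * (step_char dir p j - 1)))"
      using p0 by (subst prod_sum_PiE) (auto simp: carrier_Zpow prod.distrib)
    also have "\<dots> = (\<Prod>i<k. of_nat p * of_real (pmf ?q (x i)))"
    proof (intro prod.cong refl)
      fix i assume "i \<in> {..<k}"
      then have xi: "x i \<in> {0..<int p}" using True p0 by (auto simp: carrier_Zpow PiE_iff)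
      show "(\<Sum>j\<in>{0..<int p}. cyc_char p j (- x i) * exp (of_real (t / real k) * (step_char dir p j - 1)))
          = of_nat p * of_real (pmf ?q (x i))"
        using assms by (subst cyclic_inversion[OF p0 set_circle_walk[OF assms(1)] xi])
          (simp add: expectation_circle_walk)
    qed
    also have "\<dots> = of_nat p ^ k * complex_of_real (\<Prod>i<k. pmf ?q (x i))"
      by (simp add: prod.distrib)
    finally have "pmf (coord_walk dir p k t) x = (\<Prod>i<k. pmf ?q (x i))"
      using p0 by (simp del: of_real_prod)
    moreover have "x i = undefined" if "i \<notin> {..<k}" for i
      using True p0 that by (auto simp: carrier_Zpow PiE_iff extensional_def)
    ultimately show ?thesis by (subst pmf_Pi') auto
  qed
qed

subsection \<open>Total variation\<close>

lemma bdd_above_tv: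
  "bdd_above (range (\<lambda>A. \<bar>measure_pmf.prob P A - measure_pmf.prob Q A\<bar>))"
  by (rule bdd_aboveI2[of _ _ 1]) (smt (verit) measure_nonneg measure_pmf.prob_le_1)

lemma tv_dist_ge: "\<bar>measure_pmf.prob P A - measure_pmf.prob Q A\<bar> \<le> tv_dist P Q"
  unfolding tv_dist_def by (rule cSUP_upper[OF _ bdd_above_tv]) simp

lemma tv_dist_le:
  "(\<And>A. \<bar>measure_pmf.prob P A - measure_pmf.prob Q A\<bar> \<le> c) \<Longrightarrow> tv_dist P Q \<le> c"
  unfolding tv_dist_def by (rule cSUP_least) auto

lemma tv_dist_nonneg: "0 \<le> tv_dist P Q"
  using tv_dist_ge[of P "{}" Q] by simp

lemma tv_dist_le_1: "tv_dist P Q \<le> 1"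
  by (rule tv_dist_le) (smt (verit) measure_nonneg measure_pmf.prob_le_1)

lemma tv_dist_map_pmf: "tv_dist (map_pmf f P) (map_pmf f Q) \<le> tv_dist P Q"
  by (rule tv_dist_le) (simp add: tv_dist_ge)

text \<open>All fibres of a surjective homomorphism are translates of the kernel, hence equally
  large.\<close>

lemma map_pmf_uniform_hom:
  assumes G: "group G" "finite (carrier G)" and H: "group H"
    and f: "f \<in> hom G H" and surj: "f ` carrier G = carrier H"
  shows "map_pmf f (pmf_of_set (carrier G)) = pmf_of_set (carrier H)"
proof (rule pmf_eqI)
  fix y
  interpret G: group G by (rule G)
  interpret H: group H by (rule H)
  have finH: "finite (carrier H)" using G(2) surj finite_imageI by metis
  let ?M = "map_pmf f (pmf_of_set (carrier G))"
  have neG: "carrier G \<noteq> {}" and neH: "carrier H \<noteq> {}" by blast+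
  have fone: "f \<one>\<^bsub>G\<^esub> = \<one>\<^bsub>H\<^esub>" using f G(1) H by (simp add: hom_one)
  have fibre: "pmf ?M z = card (carrier G \<inter> f -` {\<one>\<^bsub>H\<^esub>}) / card (carrier G)" if "z \<in> carrier H" for z
  proof -
    obtain g where g: "g \<in> carrier G" "z = f g" using \<open>z \<in> carrier H\<close> surj by auto
    have "bij_betw (\<lambda>x. g \<otimes>\<^bsub>G\<^esub> x) (carrier G \<inter> f -` {\<one>\<^bsub>H\<^esub>}) (carrier G \<inter> f -` {z})"
    proof (rule bij_betw_byWitness[where f' = "\<lambda>x. inv\<^bsub>G\<^esub> g \<otimes>\<^bsub>G\<^esub> x"])
      show "(\<lambda>x. inv\<^bsub>G\<^esub> g \<otimes>\<^bsub>G\<^esub> x) ` (carrier G \<inter> f -` {z}) \<subseteq> carrier G \<inter> f -` {\<one>\<^bsub>H\<^esub>}"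
      proof -
        have "f (inv\<^bsub>G\<^esub> g \<otimes>\<^bsub>G\<^esub> x) = \<one>\<^bsub>H\<^esub>" if x: "x \<in> carrier G" "f x = z" for x
        proof -
          have "f (inv\<^bsub>G\<^esub> g \<otimes>\<^bsub>G\<^esub> x) = f (inv\<^bsub>G\<^esub> g) \<otimes>\<^bsub>H\<^esub> f g"
            using hom_mult[OF f] x g by simp
          also have "\<dots> = f (inv\<^bsub>G\<^esub> g \<otimes>\<^bsub>G\<^esub> g)" using hom_mult[OF f, of "inv\<^bsub>G\<^esub> g" g] g by simp
          finally show ?thesis using g fone by simp
        qed
        then show ?thesis using g by auto
      qed
    next
      show "(\<lambda>x. g \<otimes>\<^bsub>G\<^esub> x) ` (carrier G \<inter> f -` {\<one>\<^bsub>H\<^esub>}) \<subseteq> carrier G \<inter> f -` {z}"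
        using g that hom_mult[OF f] by auto
    qed (use g in \<open>auto simp: G.m_assoc[symmetric]\<close>)
    then have "card (carrier G \<inter> f -` {z}) = card (carrier G \<inter> f -` {\<one>\<^bsub>H\<^esub>})"
      by (simp add: bij_betw_same_card)
    then show ?thesis by (simp add: pmf_map measure_pmf_of_set[OF neG G(2)])
  qed
  have "set_pmf ?M = carrier H" using surj neG G(2) by (simp add: set_pmf_of_set)
  then have "1 = (\<Sum>z\<in>carrier H. pmf ?M z)" using finH by (simp add: sum_pmf_eq_1)
  also have "\<dots> = card (carrier H) * (card (carrier G \<inter> f -` {\<one>\<^bsub>H\<^esub>}) / card (carrier G))"
    using fibre by simp
  finally have c: "card (carrier G \<inter> f -` {\<one>\<^bsub>H\<^esub>}) / card (carrier G) = 1 / card (carrier H)"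
    using finH neH by (metis (no_types, lifting) card_0_eq eq_divide_imp mult.commute of_nat_eq_0_iff)
  show "pmf ?M y = pmf (pmf_of_set (carrier H)) y"
  proof (cases "y \<in> carrier H")
    case True
    then show ?thesis using fibre[OF True] c neH finH by simp
  next
    case False
    then have "pmf ?M y = 0" using \<open>set_pmf ?M = carrier H\<close> set_pmf_iff by metis
    then show ?thesis using False neH finH by simp
  qed
qed

subsection \<open>The walk as a linear image of the coordinate walk\<close>

text \<open>Takes arbitrary integer vectors and reduces only at the end, so the difference of two
  points can be inserted without reducing it first.\<close>

definition lin_image :: "nat \<Rightarrow> nat \<Rightarrow> (nat \<Rightarrow> int) list \<Rightarrow> (nat \<Rightarrow> int) \<Rightarrow> nat \<Rightarrow> int" where
  "lin_image p d Z w = (\<lambda>j\<in>{..<d}. (\<Sum>i<length Z. w i * (Z ! i) j) mod int p)"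

lemma lin_image_carrier: "p > 0 \<Longrightarrow> lin_image p d Z w \<in> carrier (Zpow p d)"
  by (auto simp: carrier_Zpow lin_image_def)

lemma mod_sum_mult_eq:
  "(\<Sum>i\<in>I. (x i mod a) * c i) mod a = (\<Sum>i\<in>I. x i * c i) mod (a :: int)"
proof -
  have "(\<Sum>i\<in>I. (x i mod a) * c i) mod a = (\<Sum>i\<in>I. ((x i mod a) * c i) mod a) mod a"
    by (simp add: mod_sum_eq)
  also have "\<dots> = (\<Sum>i\<in>I. (x i * c i) mod a) mod a" by (simp add: mod_mult_left_eq)
  finally show ?thesis by (simp add: mod_sum_eq)
qed

lemma lin_image_mod: 
  assumes "\<And>i. i < length Z \<Longrightarrow> v i = w i mod int p"
  shows "lin_image p d Z v = lin_image p d Z w"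
proof -
  have "(\<Sum>i<length Z. v i * (Z ! i) j) = (\<Sum>i<length Z. (w i mod int p) * (Z ! i) j)" for j
    using assms by (intro sum.cong) auto
  then show ?thesis by (simp add: lin_image_def mod_sum_mult_eq)
qed

lemma lin_image_mult:
  "lin_image p d Z (x \<otimes>\<^bsub>Zpow p (length Z)\<^esub> y) = lin_image p d Z x \<otimes>\<^bsub>Zpow p d\<^esub> lin_image p d Z y"
proof -
  have "lin_image p d Z (x \<otimes>\<^bsub>Zpow p (length Z)\<^esub> y) = lin_image p d Z (\<lambda>i. x i + y i)"
    by (rule lin_image_mod) (simp add: mult_Zpow)
  also have "\<dots> = lin_image p d Z x \<otimes>\<^bsub>Zpow p d\<^esub> lin_image p d Z y"
    by (auto simp: lin_image_def mult_Zpow mod_simps distrib_right sum.distrib intro!: restrict_ext)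
  finally show ?thesis .
qed

lemma lin_image_hom: "p > 0 \<Longrightarrow> lin_image p d Z \<in> hom (Zpow p (length Z)) (Zpow p d)"
  by (auto simp: hom_def lin_image_carrier lin_image_mult)

lemma lin_image_unit_vector:
  assumes "i < length Z" "Z ! i \<in> carrier (Zpow p d)" "p > 0"
  shows "lin_image p d Z (unit_vectors (length Z) ! i) = Z ! i"
proof
  fix j
  have "(\<Sum>l<length Z. (unit_vectors (length Z) ! i) l * (Z ! l) j)
      = (\<Sum>l<length Z. if l = i then (Z ! l) j else 0)"
    using assms by (intro sum.cong) (auto simp: nth_unit_vectors)
  also have "\<dots> = (Z ! i) j" using assms by simp
  finally show "lin_image p d Z (unit_vectors (length Z) ! i) j = (Z ! i) j"
    using assms by (cases "j < d") (auto simp: lin_image_def carrier_Zpow PiE_iff extensional_def)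
qed

text \<open>A homomorphism sending the unit vectors to the generators carries jumps to jumps,
  inverses included, while the jump count is the same on both sides.\<close>

lemma walk_eq_map_lin_image:
  assumes p: "p \<ge> 2" and k: "k > 0" and Z: "length Z = k" "set Z \<subseteq> carrier (Zpow p d)"
  shows "walk dir (Zpow p d) Z t = map_pmf (lin_image p d Z) (coord_walk dir p k t)"
proof -
  have p0: "p > 0" using p by simp
  let ?f = "lin_image p d Z" and ?G = "Zpow p d" and ?K = "Zpow p k" and ?U = "unit_vectors k"
  have ne: "{..<k} \<noteq> {}" using k by auto
  have Zi: "Z ! i \<in> carrier ?G" if "i < k" for i using that Z by auto
  have Ui: "?U ! i \<in> carrier ?K" if "i < k" for i using that set_unit_vectors[OF p, of k] by auto
  interpret f: group_hom ?K ?G ?f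
    using lin_image_hom[OF p0, of d Z] Z by (auto intro!: group_hom.intro simp: group_hom_axioms_def)
  have inc: "increment dir ?G Z = map_pmf ?f (increment dir ?K ?U)"
    unfolding increment_def map_bind_pmf length_unit_vectors Z(1)
  proof (intro bind_pmf_cong refl)
    fix i assume "i \<in> set_pmf (pmf_of_set {..<k})"
    then have i: "i < k" using ne by (simp add: set_pmf_of_set)
    have 1: "?f (?U ! i) = Z ! i"
      using lin_image_unit_vector[of i Z p d] i Z Zi[OF i] p0 by simp
    then have "?f (inv\<^bsub>?K\<^esub> (?U ! i)) = inv\<^bsub>?G\<^esub> (Z ! i)" using f.hom_inv[OF Ui[OF i]] by simp
    with 1 show "(case dir of Directed \<Rightarrow> return_pmf (Z ! i)
         | Undirected \<Rightarrow> map_pmf (\<lambda>b. if b then Z ! i else inv\<^bsub>?G\<^esub> (Z ! i)) (bernoulli_pmf (1 / 2)))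
        = map_pmf ?f (case dir of Directed \<Rightarrow> return_pmf (?U ! i)
         | Undirected \<Rightarrow> map_pmf (\<lambda>b. if b then ?U ! i else inv\<^bsub>?K\<^esub> (?U ! i)) (bernoulli_pmf (1 / 2)))"
      by (cases dir) (auto simp: map_pmf_comp intro!: map_pmf_cong)
  qed
  have "jump_chain dir ?G Z n = map_pmf ?f (jump_chain dir ?K ?U n)" for n
  proof (induction n)
    case 0
    then show ?case using f.hom_one by simp
  next
    case (Suc n)
    then show ?case using Z lin_image_mult[of p d Z]
      by (simp add: inc map_bind_pmf bind_map_pmf)
  qed
  then have "jump_chain dir ?G Z = (\<lambda>n. map_pmf ?f (jump_chain dir ?K ?U n))" by blast
  then show ?thesis by (simp add: walk_def coord_walk_def map_bind_pmf)
qed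

text \<open>Passing from \<open>A\<close> to its image can only lose points and gain probability.
  This holds for every list of generators, whence the deterministic lower bound.\<close>

lemma prob_le_tv_to_uniform:
  assumes p: "p \<ge> 2" and k: "k > 0" and Z: "length Z = k" "set Z \<subseteq> carrier (Zpow p d)" and A: "finite A"
  shows "measure_pmf.prob (coord_walk dir p k t) A - real (card A) / real p ^ d
       \<le> tv_to_uniform dir (Zpow p d) Z t"
proof -
  let ?C = "carrier (Zpow p d)" and ?B = "lin_image p d Z ` A"
  have fin: "finite ?C" and ne: "?C \<noteq> {}" using p by (auto simp: carrier_Zpow PiE_eq_empty_iff finite_PiE)
  have "measure_pmf.prob (coord_walk dir p k t) A \<le> measure_pmf.prob (walk dir (Zpow p d) Z t) ?B"
    unfolding walk_eq_map_lin_image[OF p k Z] measure_map_pmf by (intro measure_pmf.finite_measure_mono) auto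
  moreover have "measure_pmf.prob (pmf_of_set ?C) ?B \<le> real (card A) / real p ^ d"
  proof -
    have "card (?C \<inter> ?B) \<le> card ?B" using A by (intro card_mono) auto
    also have "\<dots> \<le> card A" by (rule card_image_le[OF A])
    finally show ?thesis using p
      by (simp add: measure_pmf_of_set[OF ne fin] card_carrier_Zpow divide_right_mono)
  qed
  ultimately show ?thesis
    using tv_dist_ge[of "walk dir (Zpow p d) Z t" ?B "pmf_of_set ?C"] unfolding tv_to_uniform_def by linarith
qed

text \<open>Generating lists make the linear map surjective, so it sends uniform to uniform, and
  total variation decreases under maps.\<close>

lemma tv_to_uniform_le_coord_walk:
  assumes p: "p \<ge> 2" and k: "k > 0" and Z: "length Z = k" "set Z \<subseteq> carrier (Zpow p d)" and gen: "Z \<in> generating (Zpow p d)"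
  shows "tv_to_uniform dir (Zpow p d) Z t \<le> tv_dist (coord_walk dir p k t) (pmf_of_set (carrier (Zpow p k)))"
proof -
  let ?f = "lin_image p d Z" and ?G = "Zpow p d" and ?K = "Zpow p k"
  have p0: "p > 0" using p by simp
  interpret f: group_hom ?K ?G ?f
    using lin_image_hom[OF p0, of d Z] Z by (auto intro!: group_hom.intro simp: group_hom_axioms_def)
  have "set Z \<subseteq> ?f ` carrier ?K"
  proof
    fix z assume z: "z \<in> set Z"
    then obtain i where i: "i < k" "z = Z ! i" using Z by (metis in_set_conv_nth)
    then have "?f (unit_vectors k ! i) = z" "unit_vectors k ! i \<in> carrier ?K"
      using lin_image_unit_vector[of i Z p d] z Z p0 set_unit_vectors[OF p, of k]
      by (auto simp del: set_unit_vectors simp: subset_iff)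
    then show "z \<in> ?f ` carrier ?K" by blast
  qed
  then have "generate ?G (set Z) \<subseteq> ?f ` carrier ?K"
    using f.img_is_subgroup group.generate_subgroup_incl[OF group_Zpow] by blast
  then have "?f ` carrier ?K = carrier ?G"
    using gen f.hom_closed by (auto simp: generating_def)
  then have "map_pmf ?f (pmf_of_set (carrier ?K)) = pmf_of_set (carrier ?G)"
    using p0 f.homh by (intro map_pmf_uniform_hom) auto
  then show ?thesis
    unfolding tv_to_uniform_def walk_eq_map_lin_image[OF p k Z]
    by (metis tv_dist_map_pmf)
qed

subsection \<open>Random generators\<close>

lemma map_pmf_of_set_inj_self:
  assumes "finite C" "C \<noteq> {}" "inj_on f C" "f ` C \<subseteq> C"
  shows "map_pmf f (pmf_of_set C) = pmf_of_set C"
proof -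
  have "f ` C = C" using assms endo_inj_surj by blast
  then show ?thesis using map_pmf_of_set_inj[OF assms(3,2,1)] by metis
qed

text \<open>Multiplication by \<open>a\<close> is injective modulo the prime \<open>p\<close>, so
  the affine map permutes the group.\<close>

lemma affine_image_uniform:
  fixes c :: "nat \<Rightarrow> int"
  assumes p: "prime p" and a: "\<not> int p dvd a"
  shows "map_pmf (\<lambda>x. \<lambda>j\<in>{..<d}. (a * x j + c j) mod int p) (pmf_of_set (carrier (Zpow p d)))
    = pmf_of_set (carrier (Zpow p d))"
proof (rule map_pmf_of_set_inj_self)
  have p0: "p > 0" using p prime_gt_0_nat by blast
  show "finite (carrier (Zpow p d))" using p0 by simp
  show "carrier (Zpow p d) \<noteq> {}" using p0 by (simp add: carrier_Zpow PiE_eq_empty_iff)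
  let ?g = "\<lambda>x. \<lambda>j\<in>{..<d}. (a * x j + c j) mod int p"
  show "?g ` carrier (Zpow p d) \<subseteq> carrier (Zpow p d)" using p0 by (intro image_subsetI) (simp add: carrier_Zpow)
  show "inj_on ?g (carrier (Zpow p d))"
  proof (rule inj_onI)
    fix x y assume x: "x \<in> carrier (Zpow p d)" and y: "y \<in> carrier (Zpow p d)" and e: "?g x = ?g y"
    show "x = y"
    proof (rule PiE_ext)
      show "x \<in> {..<d} \<rightarrow>\<^sub>E {0..<int p}" "y \<in> {..<d} \<rightarrow>\<^sub>E {0..<int p}"
        using x y unfolding carrier_Zpow[OF p0] by simp_all
      fix j assume j: "j \<in> {..<d}"
      then have "(a * x j + c j) mod int p = (a * y j + c j) mod int p"
        using fun_cong[OF e, of j] by simp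
      then have "int p dvd (a * x j + c j) - (a * y j + c j)"
        by (rule mod_eq_dvd_iff[THEN iffD1])
      also have "(a * x j + c j) - (a * y j + c j) = a * (x j - y j)" by (simp add: algebra_simps)
      finally have "int p dvd a * (x j - y j)" .
      then have "int p dvd x j - y j" using a p prime_dvd_multD[of "int p" a "x j - y j"] by simp
      moreover have "x j \<in> {0..<int p}" "y j \<in> {0..<int p}"
        using x y j unfolding carrier_Zpow[OF p0] by blast+
      ultimately show "x j = y j" using dvd_diff_residues[of "y j" p "x j"] by simp
    qed
  qed
qed

lemma lin_image_Cons:
  "lin_image p d (z # Z) w = (\<lambda>j\<in>{..<d}. (w 0 * z j + lin_image p d Z (\<lambda>i. w (Suc i)) j) mod int p)"
  unfolding lin_image_def length_Cons sum.lessThan_Suc_shift by (auto intro!: restrict_ext simp: mod_simps)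

text \<open>The only place where the upper bound uses that \<open>p\<close> is prime.\<close>

lemma lin_image_uniform:
  assumes p: "prime p" and w: "\<exists>i<k. \<not> int p dvd w i"
  shows "map_pmf (\<lambda>Z. lin_image p d Z w) (random_generators (Zpow p d) k) = pmf_of_set (carrier (Zpow p d))"
  using w
proof (induction k arbitrary: w)
  case 0
  then show ?case by simp
next
  case (Suc k)
  have p0: "p > 0" using p prime_gt_0_nat by blast
  let ?U = "pmf_of_set (carrier (Zpow p d))" and ?R = "random_generators (Zpow p d) k"
  let ?w = "\<lambda>i. w (Suc i)"
  have eq: "map_pmf (\<lambda>Z. lin_image p d Z w) (random_generators (Zpow p d) (Suc k))
     = do {x \<leftarrow> ?U; Z \<leftarrow> ?R; return_pmf (lin_image p d (x # Z) w)}"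
    by (simp add: random_generators_def map_bind_pmf)
  show ?case
  proof (cases "int p dvd w 0")
    \<comment> \<open>The first coefficient is a unit: with the other generators fixed, the first
      one alone makes the sum uniform.\<close>
    case False
    have "map_pmf (\<lambda>Z. lin_image p d Z w) (random_generators (Zpow p d) (Suc k))
      = do {Z \<leftarrow> ?R; map_pmf (\<lambda>x. lin_image p d (x # Z) w) ?U}"
      unfolding eq by (subst bind_commute_pmf) (simp add: map_pmf_def)
    also have "\<dots> = ?U" unfolding lin_image_Cons affine_image_uniform[OF p False] by simp
    finally show ?thesis .
  next
    case True
    then obtain i where "i < k" "\<not> int p dvd w (Suc i)"
      using Suc.prems by (metis gr0_implies_Suc less_Suc_eq_0_disj not_less_eq)
    then have IH: "map_pmf (\<lambda>Z. lin_image p d Z ?w) ?R = ?U" using Suc.IH[of ?w] by blast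
    \<comment> \<open>With the first generator fixed the rest is uniform by induction, and adding
      \<open>w 0\<close> times that generator is a translation.\<close>
    have "map_pmf (\<lambda>Z. lin_image p d (x # Z) w) ?R = ?U" for x
    proof -
      have "map_pmf (\<lambda>Z. lin_image p d (x # Z) w) ?R
        = map_pmf (\<lambda>y. \<lambda>j\<in>{..<d}. (1 * y j + w 0 * x j) mod int p) (map_pmf (\<lambda>Z. lin_image p d Z ?w) ?R)"
        by (simp add: map_pmf_comp lin_image_Cons add.commute)
      also have "\<dots> = ?U" unfolding IH using p not_prime_1
        by (intro affine_image_uniform) (auto simp: prime_nat_iff)
      finally show ?thesis .
    qed
    then show ?thesis unfolding eq by (simp add: map_pmf_def)
  qed
qed

text \<open>The difference of \<open>v\<close> and \<open>w\<close> is nonzero modulo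
  \<open>p\<close>, so its image is uniform and vanishes with the probability of a single
  point.\<close>

lemma prob_lin_image_eq:
  assumes p: "prime p" and w: "v \<in> carrier (Zpow p k)" "w \<in> carrier (Zpow p k)" "v \<noteq> w"
  shows "measure_pmf.prob (random_generators (Zpow p d) k) {Z. lin_image p d Z v = lin_image p d Z w}
       = 1 / real p ^ d"
proof -
  have p0: "p > 0" using p prime_gt_0_nat by blast
  let ?R = "random_generators (Zpow p d) k" and ?C = "carrier (Zpow p d)"
  have ne: "?C \<noteq> {}" using p0 by (simp add: carrier_Zpow PiE_eq_empty_iff)
  obtain i where i: "i < k" "v i \<noteq> w i"
    using w p0 PiE_ext unfolding carrier_Zpow[OF p0] by blast
  then have nd: "\<not> int p dvd v i - w i"
    using dvd_diff_residues[of "w i" p "v i"] w p0 by (auto simp: carrier_Zpow PiE_iff)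
  have "lin_image p d Z v = lin_image p d Z w \<longleftrightarrow> lin_image p d Z (\<lambda>i. v i - w i) = (\<lambda>j\<in>{..<d}. 0)" for Z
  proof -
    have *: "lin_image p d Z v = lin_image p d Z w \<longleftrightarrow> (\<forall>j<d. lin_image p d Z v j = lin_image p d Z w j)"
      by (auto simp: lin_image_def fun_eq_iff)
    have "(lin_image p d Z v j = lin_image p d Z w j) = (lin_image p d Z (\<lambda>i. v i - w i) j = 0)" if "j < d" for j
      using that by (simp add: lin_image_def mod_eq_dvd_iff mod_eq_0_iff_dvd left_diff_distrib sum_subtractf)
    then have "lin_image p d Z v = lin_image p d Z w \<longleftrightarrow> (\<forall>j<d. lin_image p d Z (\<lambda>i. v i - w i) j = 0)"
      unfolding * by blast
    also have "\<dots> \<longleftrightarrow> lin_image p d Z (\<lambda>i. v i - w i) = (\<lambda>j\<in>{..<d}. 0)"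
      by (auto simp: lin_image_def fun_eq_iff)
    finally show ?thesis .
  qed
  then have "{Z. lin_image p d Z v = lin_image p d Z w} = (\<lambda>Z. lin_image p d Z (\<lambda>i. v i - w i)) -` {\<lambda>j\<in>{..<d}. 0}"
    by auto
  then have "measure_pmf.prob ?R {Z. lin_image p d Z v = lin_image p d Z w}
      = pmf (map_pmf (\<lambda>Z. lin_image p d Z (\<lambda>i. v i - w i)) ?R) (\<lambda>j\<in>{..<d}. 0)"
    by (simp add: pmf_map)
  also have "\<dots> = pmf (pmf_of_set ?C) (\<lambda>j\<in>{..<d}. 0)"
    using lin_image_uniform[OF p, where k = k and d = d and w = "\<lambda>i. v i - w i"] i nd by metis
  also have "\<dots> = 1 / real p ^ d" using p0 ne by (simp add: card_carrier_Zpow) (simp add: carrier_Zpow PiE_iff)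
  finally show ?thesis .
qed


subsection \<open>Second moment bound over the generators\<close>

text \<open>Truncation before the second moment: \<open>f\<close> is the part of the law that comes
  from typical points. The discarded mass costs \<open>1 - a\<close>, and Cauchy-Schwarz bounds the
  L1 distance of \<open>f\<close> to the constant \<open>a / card C\<close>. With \<open>f\<close>
  the full law this is the chi-square bound.\<close>

lemma tv_dist_le_subprob:
  fixes f :: "_ \<Rightarrow> real"
  assumes C: "finite C" "C \<noteq> {}" and P: "set_pmf P \<subseteq> C"
    and f: "\<And>y. y \<in> C \<Longrightarrow> 0 \<le> f y" "\<And>y. y \<in> C \<Longrightarrow> f y \<le> pmf P y" and a: "a = sum f C"
  shows "tv_dist P (pmf_of_set C) \<le> 1 - a + sqrt (card C * (\<Sum>y\<in>C. (f y)\<^sup>2) - a\<^sup>2)"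
proof (rule tv_dist_le)
  fix B
  define n where "n = real (card C)"
  have n: "n > 0" using C by (simp add: n_def card_gt_0_iff)
  have sumP: "sum (pmf P) C = 1" using C(1) P by (simp add: sum_pmf_eq_1)
  have a1: "a \<le> 1" unfolding a sumP[symmetric] using f by (intro sum_mono) auto
  have PB: "measure_pmf.prob P B = sum (pmf P) (C \<inter> B)"
  proof -
    have "measure_pmf.prob P B = measure_pmf.prob P (C \<inter> B)"
      using P by (intro measure_prob_cong_0) (auto simp: set_pmf_iff)
    then show ?thesis using C(1) by (simp add: measure_measure_pmf_finite)
  qed
  have UB: "measure_pmf.prob (pmf_of_set C) B = card (C \<inter> B) / n"
    using C by (simp add: measure_pmf_of_set n_def)
  let ?r = "sum (\<lambda>y. pmf P y - f y) (C \<inter> B)" and ?S = "\<Sum>y\<in>C. \<bar>f y - a / n\<bar>"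
  have r: "0 \<le> ?r" "?r \<le> 1 - a"
  proof -
    show "0 \<le> ?r" using f by (intro sum_nonneg) auto
    have "?r \<le> sum (\<lambda>y. pmf P y - f y) C" using f C(1) by (intro sum_mono2) auto
    then show "?r \<le> 1 - a" by (simp add: sum_subtractf sumP a)
  qed
  have u: "0 \<le> card (C \<inter> B) / n" "card (C \<inter> B) / n \<le> 1"
    using n C(1) by (auto simp: n_def intro!: card_mono)
  have s: "\<bar>sum (\<lambda>y. f y - a / n) (C \<inter> B)\<bar> \<le> ?S"
    by (rule order.trans[OF sum_abs sum_mono2]) (use C(1) in auto)
  have ss: "?S\<^sup>2 \<le> n * (\<Sum>y\<in>C. (f y)\<^sup>2) - a\<^sup>2"
  proof -
    have "?S\<^sup>2 \<le> n * (\<Sum>y\<in>C. (f y - a / n)\<^sup>2)"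
      using Cauchy_Schwarz_ineq_sum[of "\<lambda>_. 1" "\<lambda>y. \<bar>f y - a / n\<bar>" C] by (simp add: n_def)
    also have "(\<Sum>y\<in>C. (f y - a / n)\<^sup>2) = (\<Sum>y\<in>C. (f y)\<^sup>2) - 2 * (a / n) * a + n * (a / n)\<^sup>2"
    proof -
      have "(\<Sum>y\<in>C. (f y - a / n)\<^sup>2) = (\<Sum>y\<in>C. (f y)\<^sup>2 - 2 * (a / n) * f y + (a / n)\<^sup>2)"
        by (intro sum.cong) (auto simp: power2_diff)
      also have "\<dots> = (\<Sum>y\<in>C. (f y)\<^sup>2) - 2 * (a / n) * a + n * (a / n)\<^sup>2"
        unfolding sum.distrib sum_subtractf sum_distrib_left[symmetric] a[symmetric] by (simp add: n_def)
      finally show ?thesis .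
    qed
    also have "n * ((\<Sum>y\<in>C. (f y)\<^sup>2) - 2 * (a / n) * a + n * (a / n)\<^sup>2) = n * (\<Sum>y\<in>C. (f y)\<^sup>2) - a\<^sup>2"
      using n by (simp add: field_simps power2_eq_square)
    finally show ?thesis .
  qed
  have S: "?S \<le> sqrt (n * (\<Sum>y\<in>C. (f y)\<^sup>2) - a\<^sup>2)"
    using ss by (rule real_le_rsqrt)
  \<comment> \<open>The discarded mass inside \<open>B\<close> and its uniform counterpart both lie
    between 0 and \<open>1 - a\<close>, so together they cost \<open>1 - a\<close> only
    once.\<close>
  have "measure_pmf.prob P B - measure_pmf.prob (pmf_of_set C) B
      = sum (\<lambda>y. f y - a / n) (C \<inter> B) + (?r - (1 - a) * (card (C \<inter> B) / n))"
    unfolding PB UB sum_subtractf using n by (simp add: field_simps)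
  moreover have "0 \<le> (1 - a) * (card (C \<inter> B) / n)" "(1 - a) * (card (C \<inter> B) / n) \<le> 1 - a"
    using u a1 mult_nonneg_nonneg[of "1 - a" "card (C \<inter> B) / n"] mult_left_le[of "card (C \<inter> B) / n" "1 - a"]
    by linarith+
  ultimately show "\<bar>measure_pmf.prob P B - measure_pmf.prob (pmf_of_set C) B\<bar>
      \<le> 1 - a + sqrt (card C * (\<Sum>y\<in>C. (f y)\<^sup>2) - a\<^sup>2)"
    using r s S unfolding n_def by linarith
qed

text \<open>The expected number of collisions splits into the diagonal, which is at most \<eta>
  because typical points are light, and pairs colliding with probability exactly 1 / n, which cancel
  against \<open>a^2\<close>. Markov's inequality for the excess \<open>X\<close> finishes.\<close>

lemma prob_tv_to_uniform_gt:
  assumes p: "prime p" and k: "k > 0" and t: "t \<ge> 0" and A: "A \<subseteq> carrier (Zpow p k)"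
    and mu: "\<And>w. w \<in> A \<Longrightarrow> real p ^ d * pmf (coord_walk dir p k t) w \<le> \<eta>" and \<eta>: "\<eta> \<ge> 0" and \<delta>: "\<delta> > 0"
  shows "measure_pmf.prob (random_generators (Zpow p d) k)
       {Z. tv_to_uniform dir (Zpow p d) Z t > 1 - measure_pmf.prob (coord_walk dir p k t) A + \<delta>} \<le> \<eta> / \<delta>\<^sup>2"
proof -
  have p2: "p \<ge> 2" and p0: "p > 0" using p prime_ge_2_nat prime_gt_0_nat by blast+
  let ?K = "carrier (Zpow p k)" and ?C = "carrier (Zpow p d)" and ?R = "random_generators (Zpow p d) k"
  define \<mu> where "\<mu> = pmf (coord_walk dir p k t)"
  define a where "a = measure_pmf.prob (coord_walk dir p k t) A"
  define n where "n = real p ^ d"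
  have n: "n > 0" using p0 by (simp add: n_def)
  have finA: "finite A" using A finite_carrier_Zpow[OF p0] finite_subset by blast
  have finC: "finite ?C" and neC: "?C \<noteq> {}" using p0 by (auto simp: carrier_Zpow PiE_eq_empty_iff finite_PiE)
  have a: "a = sum \<mu> A" using finA by (simp add: a_def \<mu>_def measure_measure_pmf_finite)
  define f where "f Z y = (\<Sum>w\<in>A. if lin_image p d Z w = y then \<mu> w else 0)" for Z y
  define X where "X Z = n * (\<Sum>y\<in>?C. (f Z y)\<^sup>2) - a\<^sup>2" for Z
  have R: "length Z = k \<and> set Z \<subseteq> ?C" if "Z \<in> set_pmf ?R" for Z
    using that neC finC by (auto simp: random_generators_def set_replicate_pmf set_pmf_of_set in_lists_conv_set)
  have finR: "finite (set_pmf ?R)"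
    by (rule finite_subset[OF _ finite_lists_length_eq[OF finC, of k]]) (use R in auto)
  have int: "integrable (measure_pmf ?R) g" for g :: "_ \<Rightarrow> real"
    by (rule integrable_measure_pmf_finite[OF finR])
  have sumf: "sum (f Z) ?C = a" for Z
  proof -
    have "sum (f Z) ?C = (\<Sum>w\<in>A. \<Sum>y\<in>?C. if lin_image p d Z w = y then \<mu> w else 0)"
      unfolding f_def by (rule sum.swap)
    also have "\<dots> = sum \<mu> A" using finC lin_image_carrier[OF p0] by (intro sum.cong refl) simp
    finally show ?thesis by (simp add: a)
  qed
  have sumf2: "(\<Sum>y\<in>?C. (f Z y)\<^sup>2) = (\<Sum>v\<in>A. \<Sum>w\<in>A. \<mu> v * \<mu> w * of_bool (lin_image p d Z v = lin_image p d Z w))" for Z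
  proof -
    have "(\<Sum>y\<in>?C. (f Z y)\<^sup>2) = (\<Sum>y\<in>?C. \<Sum>v\<in>A. \<Sum>w\<in>A. (if lin_image p d Z v = y then \<mu> v else 0) * (if lin_image p d Z w = y then \<mu> w else 0))"
      by (simp add: f_def power2_eq_square sum_product)
    also have "\<dots> = (\<Sum>v\<in>A. \<Sum>w\<in>A. \<Sum>y\<in>?C. (if lin_image p d Z v = y then \<mu> v * (if lin_image p d Z w = y then \<mu> w else 0) else 0))"
      by (subst sum.swap, subst (2) sum.swap) (intro sum.cong refl, simp)
    also have "\<dots> = (\<Sum>v\<in>A. \<Sum>w\<in>A. \<mu> v * \<mu> w * of_bool (lin_image p d Z v = lin_image p d Z w))"
      using finC lin_image_carrier[OF p0] by (intro sum.cong refl) simp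
    finally show ?thesis .
  qed
  have tv: "tv_to_uniform dir (Zpow p d) Z t \<le> 1 - a + sqrt (X Z)" if "Z \<in> set_pmf ?R" for Z
  proof -
    have Z: "length Z = k" "set Z \<subseteq> ?C" using R[OF that] by auto
    have f_le: "f Z y \<le> pmf (walk dir (Zpow p d) Z t) y" for y
    proof -
      have "f Z y = sum \<mu> {w \<in> A. lin_image p d Z w = y}" using finA by (simp add: f_def sum.inter_filter)
      also have "\<dots> = measure_pmf.prob (coord_walk dir p k t) {w \<in> A. lin_image p d Z w = y}"
        using finA by (simp add: \<mu>_def measure_measure_pmf_finite)
      also have "\<dots> \<le> pmf (walk dir (Zpow p d) Z t) y"
        unfolding walk_eq_map_lin_image[OF p2 k Z] pmf_map by (intro measure_pmf.finite_measure_mono) auto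
      finally show ?thesis .
    qed
    have f_nonneg: "0 \<le> f Z y" for y by (simp add: f_def \<mu>_def sum_nonneg)
    have "Z \<noteq> []" using Z k by auto
    then have "set_pmf (walk dir (Zpow p d) Z t) \<subseteq> ?C" using Z by (intro set_walk) auto
    then have "tv_dist (walk dir (Zpow p d) Z t) (pmf_of_set ?C) \<le> 1 - a + sqrt (card ?C * (\<Sum>y\<in>?C. (f Z y)\<^sup>2) - a\<^sup>2)"
      using finC neC f_le sumf[of Z] by (intro tv_dist_le_subprob) (auto simp: f_nonneg)
    then show ?thesis by (simp add: tv_to_uniform_def X_def n_def card_carrier_Zpow[OF p0])
  qed
  have X_nonneg: "0 \<le> X Z" for Z
  proof -
    have "(\<Sum>y\<in>?C. f Z y)\<^sup>2 \<le> n * (\<Sum>y\<in>?C. (f Z y)\<^sup>2)"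
      using Cauchy_Schwarz_ineq_sum[of "\<lambda>_. 1" "f Z" ?C] by (simp add: n_def card_carrier_Zpow[OF p0])
    then show ?thesis by (simp add: X_def sumf)
  qed
  have EX: "measure_pmf.expectation ?R X \<le> \<eta>"
  proof -
    have "measure_pmf.expectation ?R X
       = n * (\<Sum>v\<in>A. \<Sum>w\<in>A. \<mu> v * \<mu> w * measure_pmf.expectation ?R (\<lambda>Z. of_bool (lin_image p d Z v = lin_image p d Z w))) - a\<^sup>2"
      unfolding X_def sumf2 using int by simp
    \<comment> \<open>The term with 1 / n is added on the diagonal as well, so that it sums to
      exactly \<open>a^2 / n\<close>.\<close>
    also have "(\<Sum>v\<in>A. \<Sum>w\<in>A. \<mu> v * \<mu> w * measure_pmf.expectation ?R (\<lambda>Z. of_bool (lin_image p d Z v = lin_image p d Z w)))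
       \<le> (\<Sum>v\<in>A. \<Sum>w\<in>A. (if v = w then (\<mu> v)\<^sup>2 else 0) + \<mu> v * \<mu> w / n)"
    proof (intro sum_mono)
      fix v w assume vw: "v \<in> A" "w \<in> A"
      have "measure_pmf.expectation ?R (\<lambda>Z. of_bool (lin_image p d Z v = lin_image p d Z w))
         = measure_pmf.expectation ?R (indicator {Z. lin_image p d Z v = lin_image p d Z w})"
        by (intro Bochner_Integration.integral_cong) (auto simp: indicator_def)
      also have "\<dots> = measure_pmf.prob ?R {Z. lin_image p d Z v = lin_image p d Z w}" by simp
      finally have E: "measure_pmf.expectation ?R (\<lambda>Z. of_bool (lin_image p d Z v = lin_image p d Z w))
         = measure_pmf.prob ?R {Z. lin_image p d Z v = lin_image p d Z w}" .
      have pos: "0 \<le> \<mu> v" "0 \<le> \<mu> w" by (auto simp: \<mu>_def)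
      show "\<mu> v * \<mu> w * measure_pmf.expectation ?R (\<lambda>Z. of_bool (lin_image p d Z v = lin_image p d Z w))
         \<le> (if v = w then (\<mu> v)\<^sup>2 else 0) + \<mu> v * \<mu> w / n"
      proof (cases "v = w")
        case True
        then show ?thesis using n pos by (simp add: E power2_eq_square)
      next
        case False
        have "measure_pmf.prob ?R {Z. lin_image p d Z v = lin_image p d Z w} = 1 / n"
          unfolding n_def using prob_lin_image_eq[OF p _ _ False] vw A by blast
        then show ?thesis unfolding E using False by simp
      qed
    qed
    also have "\<dots> = (\<Sum>v\<in>A. (\<mu> v)\<^sup>2) + a\<^sup>2 / n"
      using finA by (simp add: sum.distrib sum_product[symmetric] power2_eq_square a sum_divide_distrib[symmetric])
    finally have "measure_pmf.expectation ?R X \<le> n * ((\<Sum>v\<in>A. (\<mu> v)\<^sup>2) + a\<^sup>2 / n) - a\<^sup>2"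
      using n by simp
    also have "\<dots> = (\<Sum>v\<in>A. (n * \<mu> v) * \<mu> v)"
      using n by (simp add: field_simps sum_distrib_left power2_eq_square)
    also have "\<dots> \<le> (\<Sum>v\<in>A. \<eta> * \<mu> v)"
      using mu by (intro sum_mono mult_right_mono) (auto simp: n_def \<mu>_def)
    also have "\<dots> = \<eta> * a" by (simp add: a sum_distrib_left)
    also have "\<dots> \<le> \<eta>"
      using \<eta> measure_pmf.prob_le_1[of _ A] by (simp add: a_def mult_left_le)
    finally show ?thesis .
  qed
  have "measure_pmf.prob ?R {Z. tv_to_uniform dir (Zpow p d) Z t > 1 - a + \<delta>}
      = measure_pmf.prob ?R ({Z. tv_to_uniform dir (Zpow p d) Z t > 1 - a + \<delta>} \<inter> set_pmf ?R)"
    by (simp add: measure_Int_set_pmf)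
  also have "\<dots> \<le> measure_pmf.prob ?R {Z \<in> space (measure_pmf ?R). X Z \<ge> \<delta>\<^sup>2}"
  proof (intro measure_pmf.finite_measure_mono)
    show "{Z. tv_to_uniform dir (Zpow p d) Z t > 1 - a + \<delta>} \<inter> set_pmf ?R \<subseteq> {Z \<in> space (measure_pmf ?R). X Z \<ge> \<delta>\<^sup>2}"
    proof
      fix Z assume Z: "Z \<in> {Z. tv_to_uniform dir (Zpow p d) Z t > 1 - a + \<delta>} \<inter> set_pmf ?R"
      then have "\<delta> < sqrt (X Z)" using tv[of Z] by auto
      then have "\<delta>\<^sup>2 < (sqrt (X Z))\<^sup>2" using \<delta> by (intro power_strict_mono) auto
      then have "\<delta>\<^sup>2 < X Z" using X_nonneg by simp
      then show "Z \<in> {Z \<in> space (measure_pmf ?R). X Z \<ge> \<delta>\<^sup>2}" by simp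
    qed
  qed simp
  also have "\<dots> \<le> measure_pmf.expectation ?R X / \<delta>\<^sup>2"
    using int \<delta> X_nonneg by (intro integral_Markov_inequality_measure[where A = "{}"]) auto
  also have "\<dots> \<le> \<eta> / \<delta>\<^sup>2" using EX by (simp add: divide_right_mono)
  finally show ?thesis by (simp add: a_def)
qed

subsection \<open>Heat kernel of the cycle\<close>

text \<open>Extended periodically to all integers, so that shifts need no wrap-around.\<close>

definition heat :: "orientation \<Rightarrow> nat \<Rightarrow> real \<Rightarrow> int \<Rightarrow> real" where
  "heat dir p s x = pmf (circle_walk dir p s) (x mod int p)"

text \<open>Decay rate of frequency \<open>j\<close>; read as a function of position it also serves
  as a squared distance to 0 on the cycle.\<close>

definition rate :: "nat \<Rightarrow> int \<Rightarrow> real" where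
  "rate p j = 1 - cos (2 * pi * of_int j / real p)"

text \<open>Sum of the moduli of the Fourier coefficients other than the constant one; the same for
  both orientations, since drift only affects phases.\<close>

definition nontrivial_sum :: "nat \<Rightarrow> real \<Rightarrow> real" where
  "nontrivial_sum p s = (\<Sum>j\<in>{1..<int p}. exp (- s * rate p j))"

lemma heat_nonneg [simp]: "0 \<le> heat dir p s x"
  by (simp add: heat_def)

lemma heat_mod [simp]: "heat dir p s (x mod int p) = heat dir p s x"
  by (simp add: heat_def)

lemma sum_heat: "p \<ge> 2 \<Longrightarrow> (\<Sum>x\<in>{0..<int p}. heat dir p s x) = 1"
  using set_circle_walk[of p dir s] by (simp add: heat_def sum_pmf_eq_1)

lemma sum_periodic_shift:
  fixes g :: "int \<Rightarrow> 'a :: comm_monoid_add"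
  assumes "p > 0" and g: "\<And>x. g (x mod int p) = g x"
  shows "(\<Sum>x\<in>{0..<int p}. g (x + c)) = (\<Sum>x\<in>{0..<int p}. g x)"
proof (rule sum.reindex_bij_witness[where i = "\<lambda>x. (x - c) mod int p" and j = "\<lambda>x. (x + c) mod int p"])
  fix x assume "x \<in> {0..<int p}"
  then show "((x + c) mod int p - c) mod int p = x" "((x - c) mod int p + c) mod int p = x"
    by (simp_all add: mod_simps)
qed (use assms in auto)

section \<open>Size of the decay rates and sums over frequencies\<close>

lemma rate_eq_sin: "rate p j = 2 * (sin (pi * of_int j / real p))\<^sup>2"
  using cos_double_sin[of "pi * of_int j / real p"] by (simp add: rate_def mult.assoc)

lemma rate_nonneg [simp]: "0 \<le> rate p j" and rate_le_2: "rate p j \<le> 2"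
  using cos_ge_minus_one[of "2 * pi * of_int j / real p"] by (auto simp: rate_def)

lemma rate_mod: "p > 0 \<Longrightarrow> rate p (x mod int p) = rate p x"
proof -
  assume "p > 0"
  from cyc_char_mod[OF this, of 1 x] have "Re (cyc_char p 1 (x mod int p)) = Re (cyc_char p 1 x)" by simp
  then show ?thesis by (simp add: cyc_char_def rate_def)
qed

lemma rate_reflect: "p > 0 \<Longrightarrow> rate p (int p - j) = rate p j"
proof -
  assume p: "p > 0"
  have "2 * pi * of_int (int p - j) / real p = 2 * pi - 2 * pi * of_int j / real p"
    using p by (simp add: field_simps)
  then show ?thesis by (simp add: rate_def cos_diff)
qed

lemma rate_le: "rate p j \<le> (2 * pi * of_int j / real p)\<^sup>2 / 2"
proof -
  have "(sin (pi * of_int j / real p))\<^sup>2 \<le> (pi * of_int j / real p)\<^sup>2"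
    using abs_sin_x_le_abs_x abs_le_square_iff by blast
  then show ?thesis by (simp add: rate_eq_sin power_divide power_mult_distrib)
qed

text \<open>Jordan's inequality, from concavity of the sine.\<close>

lemma sin_ge_two_div_pi:
  assumes "0 \<le> y" "y \<le> 1 / 2"
  shows "2 * y \<le> sin (pi * y)"
proof -
  have "convex_on {0..pi/2} (\<lambda>x. - sin x)"
    by (rule f''_ge0_imp_convex[where f' = "\<lambda>x. - cos x" and f'' = sin])
      (auto intro!: derivative_eq_intros sin_ge_zero)
  from convex_onD[OF this, of "2 * y" 0 "pi / 2"] assms show ?thesis by (simp add: mult.commute)
qed

lemma rate_ge:
  assumes "0 \<le> j" "2 * j \<le> int p"
  shows "8 * (of_int j / real p)\<^sup>2 \<le> rate p j"
proof (cases "p = 0")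
  case False
  have "2 * real_of_int j \<le> real p" using assms by linarith
  then have "2 * (of_int j / real p) \<le> sin (pi * (of_int j / real p))"
    using assms False by (intro sin_ge_two_div_pi) (auto simp: field_simps)
  then have "(2 * (of_int j / real p))\<^sup>2 \<le> (sin (pi * (of_int j / real p)))\<^sup>2"
    using assms by (intro power_mono) auto
  then show ?thesis by (simp add: rate_eq_sin power_mult_distrib power_divide)
qed auto

text \<open>The quadratic lower bound on \<open>rate\<close> holds for the nearer of
  \<open>j\<close> and \<open>p - j\<close>; adding the terms of both costs a factor 2 and avoids
  keeping track of which is nearer.\<close>

lemma sum_rate_le:
  fixes F :: "real \<Rightarrow> real"
  assumes "p > 0" and mono: "\<And>x y. 0 \<le> x \<Longrightarrow> x \<le> y \<Longrightarrow> F y \<le> F x" and nn: "\<And>x. x \<ge> 0 \<Longrightarrow> 0 \<le> F x"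
  shows "(\<Sum>j\<in>{1..<int p}. F (rate p j)) \<le> 2 * (\<Sum>n\<in>{1..p}. F (8 * (real n / real p)\<^sup>2))"
proof -
  define H where "H j = F (8 * (of_int j / real p)\<^sup>2)" for j :: int
  have H0: "H j \<ge> 0" for j by (simp add: H_def nn)
  have "(\<Sum>j\<in>{1..<int p}. F (rate p j)) \<le> (\<Sum>j\<in>{1..<int p}. H j + H (int p - j))"
  proof (rule sum_mono)
    fix j assume j: "j \<in> {1..<int p}"
    show "F (rate p j) \<le> H j + H (int p - j)"
    proof (cases "2 * j \<le> int p")
      case True
      then have "F (rate p j) \<le> H j" unfolding H_def using j rate_ge[of j p] by (intro mono) auto
      then show ?thesis using H0[of "int p - j"] by linarith
    next
      case False
      then have "F (rate p (int p - j)) \<le> H (int p - j)"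
        unfolding H_def using j rate_ge[of "int p - j" p] by (intro mono) auto
      then show ?thesis using H0[of j] rate_reflect[OF assms(1), of j] by simp
    qed
  qed
  also have "\<dots> = (\<Sum>j\<in>{1..<int p}. H j) + (\<Sum>j\<in>{1..<int p}. H (int p - j))" by (rule sum.distrib)
  also have "(\<Sum>j\<in>{1..<int p}. H (int p - j)) = (\<Sum>j\<in>{1..<int p}. H j)"
    by (rule sum.reindex_bij_witness[where i = "\<lambda>j. int p - j" and j = "\<lambda>j. int p - j"]) auto
  also have "(\<Sum>j\<in>{1..<int p}. H j) = (\<Sum>n\<in>{1..<p}. H (int n))"
    by (rule sum.reindex_bij_witness[where i = int and j = nat]) auto
  also have "\<dots> + (\<Sum>n\<in>{1..<p}. H (int n)) = 2 * (\<Sum>n\<in>{1..<p}. F (8 * (real n / real p)\<^sup>2))"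
    by (simp add: H_def)
  also have "\<dots> \<le> 2 * (\<Sum>n\<in>{1..p}. F (8 * (real n / real p)\<^sup>2))"
    by (intro mult_left_mono sum_mono2) (auto simp: nn)
  finally show ?thesis .
qed

text \<open>Comparison with the integral: the increments of arctan telescope and dominate the terms
  by the mean value theorem.\<close>

lemma sum_lorentz_le:
  assumes "L > 0"
  shows "(\<Sum>n\<in>{1..N}. 1 / (1 + (real n / L)\<^sup>2)) \<le> L * (pi / 2)"
proof -
  have "(\<Sum>n\<in>{1..N}. 1 / (1 + (real n / L)\<^sup>2)) \<le> L * arctan (real N / L)"
  proof (induction N)
    case (Suc N)
    have "1 / (1 + (real (Suc N) / L)\<^sup>2) \<le> L * (arctan (real (Suc N) / L) - arctan (real N / L))"
    proof -
      have lt: "real N / L < real (Suc N) / L" using assms by (simp add: divide_strict_right_mono)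
      obtain z where z: "real N / L < z" "z < real (Suc N) / L"
        "arctan (real (Suc N) / L) - arctan (real N / L) = (real (Suc N) / L - real N / L) * inverse (1 + z\<^sup>2)"
        using MVT2[OF lt, of arctan "\<lambda>z. inverse (1 + z\<^sup>2)"] DERIV_arctan by blast
      have z0: "z \<ge> 0" using z(1) assms by (smt (verit) divide_nonneg_pos of_nat_0_le_iff)
      have "L * (arctan (real (Suc N) / L) - arctan (real N / L)) = inverse (1 + z\<^sup>2)"
        unfolding z(3) diff_divide_distrib[symmetric] using assms by simp
      moreover have "1 / (1 + (real (Suc N) / L)\<^sup>2) \<le> inverse (1 + z\<^sup>2)"
        using z(2) z0 by (simp add: inverse_eq_divide) (intro divide_left_mono add_mono power_mono, auto intro!: mult_pos_pos add_pos_nonneg)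
      ultimately show ?thesis by linarith
    qed
    then show ?case using Suc.IH by (simp add: algebra_simps)
  qed simp
  also have "\<dots> \<le> L * (pi / 2)"
    using arctan_ubound[of "real N / L"] assms by (intro mult_left_mono) auto
  finally show ?thesis .
qed

text \<open>For \<open>s < 1\<close> each term is at most 1 and
  \<open>sqrt (s + 1) <= 2 < pi\<close>. For \<open>s >= 1\<close> the Gaussian sum is replaced by a
  Lorentz sum through 1 + y <= exp y. Using \<open>s + 1\<close> keeps the bound meaningful down to
  time 0.\<close>

lemma nontrivial_sum_le:
  assumes p: "p \<ge> 2" and s: "s \<ge> 0"
  shows "nontrivial_sum p s \<le> pi * real p / sqrt (s + 1)"
proof (cases "s \<ge> 1")
  case False
  have "nontrivial_sum p s \<le> (\<Sum>j\<in>{1..<int p}. 1)"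
    unfolding nontrivial_sum_def using s by (intro sum_mono) auto
  also have "\<dots> \<le> real p" by simp
  also have "\<dots> \<le> pi * real p / sqrt (s + 1)"
  proof -
    have "sqrt (s + 1) \<le> sqrt 4" using False by (intro real_sqrt_le_mono) auto
    then have "sqrt (s + 1) \<le> pi" using pi_gt3 by simp
    then show ?thesis using p s by (simp add: field_simps)
  qed
  finally show ?thesis .
next
  case True
  define L where "L = real p / sqrt (s + 1)"
  have L: "L > 0" using p s by (simp add: L_def)
  have "nontrivial_sum p s \<le> 2 * (\<Sum>n\<in>{1..p}. exp (- s * (8 * (real n / real p)\<^sup>2)))"
    unfolding nontrivial_sum_def using p s by (intro sum_rate_le) (auto intro: mult_left_mono)
  also have "(\<Sum>n\<in>{1..p}. exp (- s * (8 * (real n / real p)\<^sup>2))) \<le> (\<Sum>n\<in>{1..p}. 1 / (1 + (real n / L)\<^sup>2))"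
  proof (rule sum_mono)
    fix n
    have "1 + (real n / L)\<^sup>2 = 1 + (s + 1) * (real n / real p)\<^sup>2"
      using s by (simp add: L_def power_divide power_mult_distrib)
    also have "\<dots> \<le> 1 + (8 * s) * (real n / real p)\<^sup>2" using True by (intro add_left_mono mult_right_mono) auto
    also have "\<dots> \<le> exp (s * (8 * (real n / real p)\<^sup>2))"
      using exp_ge_add_one_self[of "s * (8 * (real n / real p)\<^sup>2)"] by (simp add: mult_ac)
    finally have "1 + (real n / L)\<^sup>2 \<le> exp (s * (8 * (real n / real p)\<^sup>2))" .
    then have "1 / exp (s * (8 * (real n / real p)\<^sup>2)) \<le> 1 / (1 + (real n / L)\<^sup>2)"
      by (intro divide_left_mono) (auto intro!: mult_pos_pos add_pos_nonneg)
    then show "exp (- s * (8 * (real n / real p)\<^sup>2)) \<le> 1 / (1 + (real n / L)\<^sup>2)"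
      by (simp add: exp_minus inverse_eq_divide)
  qed
  also have "\<dots> \<le> L * (pi / 2)" by (rule sum_lorentz_le[OF L])
  finally show ?thesis by (simp add: L_def mult_ac)
qed

section \<open>Bounds on the kernel at the scale \<open>spread\<close>\<close>

lemma step_char_Re: "Re (step_char dir p j) = cos (2 * pi * of_int j / real p)"
  by (cases dir) (auto simp: step_char_def cyc_char_def turn_def)

lemma norm_exp_step_char: "norm (exp (of_real s * (step_char dir p j - 1))) = exp (- s * rate p j)"
  by (simp add: step_char_Re rate_def norm_exp_eq_Re algebra_simps)

lemma heat_fourier:
  assumes "p \<ge> 2" "s \<ge> 0"
  shows "of_nat p * complex_of_real (heat dir p s x)
      = (\<Sum>j\<in>{0..<int p}. cyc_char p j (- x) * exp (of_real s * (step_char dir p j - 1)))"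
proof -
  have "cyc_char p j (- (x mod int p)) = cyc_char p j (- x)" for j
    using assms cyc_char_mod[of p j x] by (simp add: cyc_char_uminus)
  then show ?thesis unfolding heat_def
    using assms cyclic_inversion[of p "circle_walk dir p s" "x mod int p"] set_circle_walk[of p dir s]
    by (simp add: expectation_circle_walk)
qed

lemma step_char_0 [simp]: "step_char dir p 0 = 1"
  by (simp add: step_char_def)

lemma heat_deviation:
  assumes "p \<ge> 2" "s \<ge> 0"
  shows "\<bar>heat dir p s x - 1 / real p\<bar> \<le> nontrivial_sum p s / real p"
proof -
  let ?e = "\<lambda>j. cyc_char p j (- x) * exp (of_real s * (step_char dir p j - 1))"
  have "{0..<int p} = insert 0 {1..<int p}" using assms by auto
  then have "of_nat p * complex_of_real (heat dir p s x) = 1 + (\<Sum>j\<in>{1..<int p}. ?e j)"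
    unfolding heat_fourier[OF assms] by simp
  then have "complex_of_real (real p * heat dir p s x - 1) = (\<Sum>j\<in>{1..<int p}. ?e j)"
    by simp
  then have "\<bar>real p * heat dir p s x - 1\<bar> = norm (\<Sum>j\<in>{1..<int p}. ?e j)"
    by (metis norm_of_real)
  also have "\<dots> \<le> (\<Sum>j\<in>{1..<int p}. norm (?e j))" by (rule norm_sum)
  also have "\<dots> = nontrivial_sum p s" by (simp add: nontrivial_sum_def norm_mult norm_exp_step_char del: norm_exp_eq_Re)
  finally have "\<bar>real p * heat dir p s x - 1\<bar> / real p \<le> nontrivial_sum p s / real p"
    by (rule divide_right_mono) simp
  moreover have "heat dir p s x - 1 / real p = (real p * heat dir p s x - 1) / real p"
    using assms by (simp add: field_simps)
  ultimately show ?thesis by simp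
qed

text \<open>The size of the region on which the walk at time \<open>s\<close> is spread out, up to constants
  \<open>min p (sqrt (s + 1))\<close>.\<close>

definition spread :: "nat \<Rightarrow> real \<Rightarrow> real" where
  "spread p s = real p * sqrt (s + 1) / (real p + sqrt (s + 1))"

lemma spread_pos: "p > 0 \<Longrightarrow> s \<ge> 0 \<Longrightarrow> spread p s > 0"
  by (auto simp: spread_def intro!: divide_pos_pos mult_pos_pos add_pos_nonneg)

lemma spread_le_sqrt: "p > 0 \<Longrightarrow> s \<ge> 0 \<Longrightarrow> spread p s \<le> sqrt (s + 1)"
  by (simp add: spread_def divide_le_eq add_pos_nonneg distrib_right)

text \<open>The constant frequency contributes 1 / p and the others at most pi / sqrt (s + 1); the
  reciprocal of \<open>spread\<close> is the sum of 1 / p and 1 / sqrt (s + 1).\<close>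

lemma spread_heat_le:
  assumes "p \<ge> 2" "s \<ge> 0"
  shows "spread p s * heat dir p s x \<le> pi"
proof -
  define r where "r = sqrt (s + 1)"
  have r: "r > 0" using assms by (simp add: r_def)
  have "heat dir p s x \<le> 1 / real p + nontrivial_sum p s / real p"
    using heat_deviation[OF assms, of dir x] by linarith
  also have "\<dots> \<le> 1 / real p + (pi * real p / r) / real p"
    using nontrivial_sum_le[OF assms] assms by (intro add_left_mono divide_right_mono) (auto simp: r_def)
  also have "\<dots> \<le> pi * (real p + r) / (real p * r)"
    using pi_gt3 r assms by (simp add: field_simps)
  finally have "spread p s * heat dir p s x \<le> (real p * r / (real p + r)) * (pi * (real p + r) / (real p * r))"
    unfolding spread_def r_def[symmetric] using r by (intro mult_left_mono) auto
  also have "\<dots> = pi" using r assms by (simp add: field_simps add_nonneg_eq_0_iff)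
  finally show ?thesis .
qed

text \<open>The weights live at distance sqrt (s + 1) from \<open>c\<close> on the cycle. Their sum
  is at most 5 sqrt (s + 1) by the Lorentz bound and at most \<open>p\<close> trivially, and the
  smaller of the two is at most 10 times the spread.\<close>

lemma sum_weights_le:
  assumes "p \<ge> 2" "s \<ge> 0"
  shows "(\<Sum>x\<in>{0..<int p}. 1 / (1 + (real p)\<^sup>2 / (s + 1) * rate p (x - c))) \<le> 10 * spread p s"
proof -
  define r where "r = sqrt (s + 1)"
  have r: "r \<ge> 1" "r\<^sup>2 = s + 1" using assms by (simp_all add: r_def)
  define b where "b = (real p)\<^sup>2 / (s + 1)"
  have b: "b > 0" using assms by (simp add: b_def add_nonneg_pos)
  define F where "F y = 1 / (1 + b * y)" for y
  have F: "F y \<le> F x" if "0 \<le> x" "x \<le> y" for x y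
    using that b by (auto simp: F_def intro!: divide_left_mono mult_pos_pos add_pos_nonneg)
  have F0: "0 \<le> F y" if "y \<ge> 0" for y using that b by (simp add: F_def)
  have F1: "F y \<le> 1" if "y \<ge> 0" for y using that b by (simp add: F_def divide_le_eq add_pos_nonneg)
  have "(\<Sum>x\<in>{0..<int p}. F (rate p (x - c))) = (\<Sum>x\<in>{0..<int p}. F (rate p x))"
    using sum_periodic_shift[of p "\<lambda>x. F (rate p x)" "-c"] assms by (simp add: rate_mod)
  also have "\<dots> = F (rate p 0) + (\<Sum>x\<in>{1..<int p}. F (rate p x))"
  proof -
    have "{0..<int p} = insert 0 {1..<int p}" using assms by auto
    then show ?thesis by simp
  qed
  also have "(\<Sum>x\<in>{1..<int p}. F (rate p x)) \<le> 2 * (\<Sum>n\<in>{1..p}. F (8 * (real n / real p)\<^sup>2))"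
    using assms F F0 by (intro sum_rate_le) auto
  also have "(\<Sum>n\<in>{1..p}. F (8 * (real n / real p)\<^sup>2)) \<le> (\<Sum>n\<in>{1..p}. 1 / (1 + (real n / r)\<^sup>2))"
  proof (rule sum_mono)
    fix n
    have "b * (real n / real p)\<^sup>2 = (real n / r)\<^sup>2"
      using assms by (simp add: b_def power_divide r(2))
    moreover have "0 \<le> (real n / r)\<^sup>2" by simp
    ultimately have "(real n / r)\<^sup>2 \<le> b * (8 * (real n / real p)\<^sup>2)" by linarith
    then show "F (8 * (real n / real p)\<^sup>2) \<le> 1 / (1 + (real n / r)\<^sup>2)"
      using b by (auto simp: F_def intro!: divide_left_mono mult_pos_pos add_pos_nonneg)
  qed
  also have "\<dots> \<le> r * (pi / 2)" using r by (intro sum_lorentz_le) auto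
  finally have A: "(\<Sum>x\<in>{0..<int p}. F (rate p (x - c))) \<le> 1 + pi * r"
    using F1[OF rate_nonneg, of p 0] by (simp add: mult.commute)
  then have A: "(\<Sum>x\<in>{0..<int p}. F (rate p (x - c))) \<le> 5 * r"
    using r mult_right_mono[of pi 4 r] pi_less_4 by linarith
  have "(\<Sum>x\<in>{0..<int p}. F (rate p (x - c))) \<le> (\<Sum>x\<in>{0..<int p}. 1)"
    by (intro sum_mono F1) auto
  then have B: "(\<Sum>x\<in>{0..<int p}. F (rate p (x - c))) \<le> real p" by simp
  have "min (5 * r) (real p) \<le> 10 * spread p s"
  proof (cases "r \<le> real p")
    case True
    have "5 * r * (real p + r) \<le> 5 * r * (2 * real p)" using True r by (intro mult_left_mono) auto
    then have "5 * r \<le> 10 * spread p s" unfolding spread_def r_def[symmetric] using r assms by (simp add: field_simps)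
    then show ?thesis by simp
  next
    case False
    then have "real p * (real p + r) \<le> real p * (2 * r)" by (intro mult_left_mono) auto
    then have "real p \<le> 2 * spread p s" unfolding spread_def r_def[symmetric] using r assms by (simp add: field_simps)
    then show ?thesis using spread_pos[of p s] assms by simp
  qed
  then show ?thesis using A B unfolding F_def b_def by linarith
qed

section \<open>Second moments from the first character\<close>

lemma sum_heat_cyc_char:
  assumes "p \<ge> 2" "s \<ge> 0"
  shows "(\<Sum>x\<in>{0..<int p}. of_real (heat dir p s x) * cyc_char p j x) = exp (of_real s * (step_char dir p j - 1))"
proof -
  have "measure_pmf.expectation (circle_walk dir p s) (cyc_char p j)
      = (\<Sum>x\<in>{0..<int p}. pmf (circle_walk dir p s) x *\<^sub>R cyc_char p j x)"
    using set_circle_walk[OF assms(1), of dir s] by (intro integral_measure_pmf) auto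
  then show ?thesis using expectation_circle_walk[OF assms, of dir j] by (simp add: heat_def scaleR_conv_of_real)
qed

text \<open>The mean of \<open>rate\<close> is 1 minus the real part of the first Fourier
  coefficient rotated by \<open>c\<close>. Its modulus is \<open>exp (- s * rate p 1)\<close> and
  its phase is the drift minus the rotation; both errors are quadratic in 1 / p.\<close>

lemma expectation_rate_le:
  assumes "p \<ge> 2" "s \<ge> 0"
  defines "\<theta> \<equiv> 2 * pi / real p"
  shows "(\<Sum>x\<in>{0..<int p}. heat dir p s x * rate p (x - c))
      \<le> s * \<theta>\<^sup>2 / 2 + (s * Im (step_char dir p 1) - \<theta> * of_int c)\<^sup>2 / 2"
proof -
  \<comment> \<open>Half the phase, so that 1 - cos (2 y) = 2 (sin y)^2 applies.\<close>
  define y where "y = (s * Im (step_char dir p 1) - \<theta> * of_int c) / 2"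
  have y: "s * Im (step_char dir p 1) - \<theta> * of_int c = 2 * y" by (simp add: y_def)
  have "(\<Sum>x\<in>{0..<int p}. heat dir p s x * rate p (x - c))
      = (\<Sum>x\<in>{0..<int p}. heat dir p s x - Re (of_real (heat dir p s x) * (cyc_char p 1 x * cyc_char p 1 (- c))))"
    unfolding cyc_char_add[symmetric] by (intro sum.cong refl) (simp add: rate_def cyc_char_def algebra_simps)
  also have "\<dots> = 1 - Re ((\<Sum>x\<in>{0..<int p}. of_real (heat dir p s x) * cyc_char p 1 x) * cyc_char p 1 (- c))"
    by (simp add: sum_subtractf sum_heat[OF assms(1)] sum_distrib_right mult.assoc)
  also have "(\<Sum>x\<in>{0..<int p}. of_real (heat dir p s x) * cyc_char p 1 x) = exp (of_real s * (step_char dir p 1 - 1))"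
    by (rule sum_heat_cyc_char[OF assms(1,2)])
  also have "exp (of_real s * (step_char dir p 1 - 1)) * cyc_char p 1 (- c)
      = of_real (exp (- s * rate p 1)) * cis (2 * y)"
    unfolding y[symmetric]
    by (simp add: exp_eq_polar step_char_Re rate_def cyc_char_def \<theta>_def mult.assoc cis_mult algebra_simps)
  also have "Re \<dots> = exp (- s * rate p 1) * cos (2 * y)" by simp
  finally have eq: "(\<Sum>x\<in>{0..<int p}. heat dir p s x * rate p (x - c))
     = 1 - exp (- s * rate p 1) * cos (2 * y)" .
  have 1: "1 - s * rate p 1 \<le> exp (- s * rate p 1)"
    using exp_ge_add_one_self[of "- s * rate p 1"] by simp
  have 2: "1 - cos (2 * y) \<le> (2 * y)\<^sup>2 / 2"
  proof -
    have "(sin y)\<^sup>2 \<le> y\<^sup>2"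
      using abs_sin_x_le_abs_x abs_le_square_iff by blast
    then show ?thesis by (simp add: cos_double_sin)
  qed
  have "exp (- s * rate p 1) * (1 - cos (2 * y)) \<le> 1 * (1 - cos (2 * y))"
    using assms by (intro mult_right_mono) auto
  then have "1 - exp (- s * rate p 1) * cos (2 * y) \<le> s * rate p 1 + (2 * y)\<^sup>2 / 2"
    using 1 2 by (simp add: algebra_simps)
  also have "\<dots> \<le> s * (\<theta>\<^sup>2 / 2) + (2 * y)\<^sup>2 / 2"
    using rate_le[of p 1] assms by (intro add_right_mono mult_left_mono) (auto simp: \<theta>_def)
  finally show ?thesis unfolding eq y by simp
qed

text \<open>The second moment about a suitable centre \<open>c\<close>, with \<open>rate\<close> playing the role of the squared
  distance; for the directed walk \<open>c\<close> follows the drift.\<close>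

lemma expectation_rate_centred_le:
  assumes "p \<ge> 2" "s \<ge> 0"
  shows "\<exists>c. (\<Sum>x\<in>{0..<int p}. heat dir p s x * rate p (x - c)) \<le> (s + 1) * (2 * pi / real p)\<^sup>2 / 2"
proof -
  define \<theta> where "\<theta> = 2 * pi / real p"
  have \<theta>: "\<theta> > 0" using assms by (simp add: \<theta>_def)
  define \<phi> where "\<phi> = s * Im (step_char dir p 1)"
  define c where "c = \<lfloor>\<phi> / \<theta>\<rfloor>"
  have "of_int c \<le> \<phi> / \<theta>" "\<phi> / \<theta> \<le> of_int c + 1" unfolding c_def by linarith+
  then have "\<bar>\<phi> - \<theta> * of_int c\<bar> \<le> \<theta>" using \<theta> by (simp add: field_simps abs_le_iff)
  then have "(\<phi> - \<theta> * of_int c)\<^sup>2 \<le> \<theta>\<^sup>2" using \<theta> by (intro abs_le_square_iff[THEN iffD1]) auto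
  then show ?thesis
    using expectation_rate_le[OF assms, of dir c] unfolding \<theta>_def \<phi>_def
    by (intro exI[of _ c]) (simp add: algebra_simps)
qed

text \<open>For short times the distance to the starting point itself is required, and the drift
  costs only s^2. The constant is 2 pi^2 < 2 * 4^2.\<close>

lemma expectation_rate_uncentred_le:
  assumes "p \<ge> 2" "s \<ge> 0"
  shows "(real p)\<^sup>2 * (\<Sum>x\<in>{0..<int p}. heat dir p s x * rate p x) \<le> 32 * (s + s\<^sup>2)"
proof -
  define \<theta> where "\<theta> = 2 * pi / real p"
  have "(Im (step_char dir p 1))\<^sup>2 \<le> \<theta>\<^sup>2"
  proof -
    have "(sin \<theta>)\<^sup>2 \<le> \<theta>\<^sup>2" using abs_sin_x_le_abs_x abs_le_square_iff by blast
    then show ?thesis by (cases dir) (auto simp: step_char_def cyc_char_def turn_def \<theta>_def)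
  qed
  then have "s\<^sup>2 * (Im (step_char dir p 1))\<^sup>2 \<le> s\<^sup>2 * \<theta>\<^sup>2" by (intro mult_left_mono) auto
  then have "(\<Sum>x\<in>{0..<int p}. heat dir p s x * rate p x) \<le> (s + s\<^sup>2) * \<theta>\<^sup>2 / 2"
    using expectation_rate_le[OF assms, of dir 0] unfolding \<theta>_def by (simp add: power_mult_distrib algebra_simps)
  then have "(real p)\<^sup>2 * (\<Sum>x\<in>{0..<int p}. heat dir p s x * rate p x) \<le> (real p)\<^sup>2 * ((s + s\<^sup>2) * \<theta>\<^sup>2 / 2)"
    by (intro mult_left_mono) auto
  also have "\<dots> = (s + s\<^sup>2) * (2 * pi\<^sup>2)"
    using assms by (simp add: \<theta>_def power_divide power_mult_distrib)
  also have "\<dots> \<le> (s + s\<^sup>2) * (2 * 4\<^sup>2)"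
    using assms pi_less_4 by (intro mult_left_mono power_mono) auto
  finally show ?thesis by simp
qed

subsection \<open>Entropy and varentropy of the heat kernel\<close>

definition heat_entropy :: "orientation \<Rightarrow> nat \<Rightarrow> real \<Rightarrow> real" where
  "heat_entropy dir p s = - (\<Sum>x\<in>{0..<int p}. heat dir p s x * ln (heat dir p s x))"

text \<open>The relative entropy of one coordinate with respect to the uniform law, written without
  the parameter \<open>k\<close>.\<close>

definition deficit :: "orientation \<Rightarrow> nat \<Rightarrow> real \<Rightarrow> real" where
  "deficit dir p s = ln (real p) - heat_entropy dir p s"

lemma coord_entropy_eq:
  assumes p: "p \<ge> 2" and k: "k > 0" and s: "s \<ge> 0"
  shows "coord_entropy dir p k s = heat_entropy dir p s"
proof -
  let ?P = "coord_walk dir p k (s * real k)" and ?Q = "circle_walk dir p s"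
  interpret information_space "measure_pmf ?P" "exp 1" by unfold_locales simp
  have "map_pmf (\<lambda>w. w 0) ?P = ?Q"
    using assms coord_walk_eq_Pi_pmf[of p k "s * real k" dir] by (simp add: Pi_pmf_component)
  then have "distr (measure_pmf ?P) (count_space UNIV) (\<lambda>w. w 0) = measure_pmf ?Q"
    by (simp add: map_pmf_rep_eq[symmetric])
  then have D: "distributed (measure_pmf ?P) (count_space UNIV) (\<lambda>w. w 0) (pmf ?Q)"
    by (simp add: distributed_def measure_pmf_eq_density[symmetric])
  have "prob_space.entropy (measure_pmf ?P) (exp 1) (count_space UNIV) (\<lambda>w. w 0)
      = - (\<integral>x. pmf ?Q x * log (exp 1) (pmf ?Q x) \<partial>count_space UNIV)"
    by (rule entropy_distr[OF D]) simp
  also have "(\<integral>x. pmf ?Q x * log (exp 1) (pmf ?Q x) \<partial>count_space UNIV)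
      = measure_pmf.expectation ?Q (\<lambda>x. ln (pmf ?Q x))"
    by (subst measure_pmf_eq_density, subst integral_density) (auto simp: log_def)
  also have "\<dots> = (\<Sum>x\<in>{0..<int p}. pmf ?Q x *\<^sub>R ln (pmf ?Q x))"
    using set_circle_walk[OF p, of dir s] by (intro integral_measure_pmf) auto
  finally show ?thesis
    by (simp add: coord_entropy_def heat_entropy_def heat_def)
qed

lemma rel_entropy_eq:
  "p \<ge> 2 \<Longrightarrow> k > 0 \<Longrightarrow> s \<ge> 0 \<Longrightarrow> rel_entropy dir p k s = deficit dir p s"
  by (simp add: rel_entropy_def deficit_def coord_entropy_eq)

text \<open>From ln x <= x - 1 at x = sqrt (b / a): the pointwise form of the comparison of
  Hellinger distance and relative entropy. It yields nonnegativity of the deficit, the varentropy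
  bound near uniformity and the entropy production.\<close>

lemma sqrt_diff_le_entropy:
  fixes a b :: real
  assumes "0 \<le> a" "0 < b"
  shows "(sqrt a - sqrt b)\<^sup>2 \<le> a * ln (a / b) - a + b"
proof (cases "a = 0")
  case False
  with assms have a: "a > 0" by simp
  have "ln (sqrt (b / a)) \<le> sqrt (b / a) - 1" using a assms by (intro ln_le_minus_one) auto
  then have "- 2 * (sqrt (b / a) - 1) \<le> ln (a / b)"
    using a assms by (simp add: ln_sqrt ln_div)
  then have "a * (- 2 * (sqrt (b / a) - 1)) \<le> a * ln (a / b)"
    using a by (intro mult_left_mono) auto
  moreover have "a * sqrt (b / a) = sqrt a * sqrt b"
  proof -
    have "a * sqrt (b / a) = (a / sqrt a) * sqrt b" by (simp add: real_sqrt_divide)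
    then show ?thesis using a by (simp add: real_div_sqrt)
  qed
  ultimately show ?thesis using a assms
    by (simp add: power2_diff algebra_simps)
qed (use assms in auto)

lemma sum_heat_mult_const: "p \<ge> 2 \<Longrightarrow> (\<Sum>x\<in>{0..<int p}. heat dir p s x * c) = c"
  by (simp add: sum_distrib_right[symmetric] sum_heat)

lemma heat_mult_ln: "p > 0 \<Longrightarrow> K > 0 \<Longrightarrow>
    heat dir p s x * ln (K * heat dir p s x) = heat dir p s x * ln K + heat dir p s x * ln (heat dir p s x)"
  using heat_nonneg[of dir p s x] by (cases "heat dir p s x = 0") (auto simp: ln_mult algebra_simps)

lemma sum_heat_ln:
  "p \<ge> 2 \<Longrightarrow> K > 0 \<Longrightarrow>
    (\<Sum>x\<in>{0..<int p}. heat dir p s x * ln (K * heat dir p s x)) = ln K - heat_entropy dir p s"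
  by (simp add: heat_mult_ln sum.distrib sum_heat_mult_const heat_entropy_def)

lemma deficit_eq:
  "p \<ge> 2 \<Longrightarrow> deficit dir p s = (\<Sum>x\<in>{0..<int p}. heat dir p s x * ln (real p * heat dir p s x))"
  by (simp add: sum_heat_ln deficit_def)

text \<open>The added terms sum to 0, and each summand becomes nonnegative with a double zero at
  density 1.\<close>

lemma deficit_eq':
  "p \<ge> 2 \<Longrightarrow> deficit dir p s = (\<Sum>x\<in>{0..<int p}.
      (real p * heat dir p s x) * ln (real p * heat dir p s x) - real p * heat dir p s x + 1) / real p"
  by (simp add: sum.distrib sum_subtractf sum_distrib_left[symmetric] mult.assoc sum_heat deficit_eq)

lemma deficit_nonneg: "p \<ge> 2 \<Longrightarrow> deficit dir p s \<ge> 0"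
proof -
  assume p: "p \<ge> 2"
  have "0 \<le> (real p * heat dir p s x) * ln (real p * heat dir p s x) - real p * heat dir p s x + 1" for x
    using order.trans[OF zero_le_power2 sqrt_diff_le_entropy[of "real p * heat dir p s x" 1]] by simp
  then show ?thesis unfolding deficit_eq'[OF p] by (intro divide_nonneg_nonneg sum_nonneg) auto
qed

text \<open>A pointwise bound that avoids lower bounds on the heat kernel: where \<open>u\<close> is smaller than the
  square of the weight \<open>1 / (1 + Q)\<close>, the weight itself controls \<open>u * (ln u)^2\<close>.\<close>

lemma mult_ln_squared_le:
  fixes u Q :: real
  assumes "0 \<le> u" "u \<le> 4" "0 \<le> Q"
  shows "u * (ln u)\<^sup>2 \<le> (20 + 16 * Q) * u + 16 * (1 / (1 + Q))"
proof -
  consider "u = 0" | "u \<ge> 1" | "0 < u" "u < 1" "(1 / (1 + Q))\<^sup>2 \<le> u" | "0 < u" "u < 1" "u < (1 / (1 + Q))\<^sup>2"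
    using assms by linarith
  then show ?thesis
  proof cases
    case 1
    then show ?thesis using assms by simp
  next
    case 2
    have "ln u = 2 * ln (sqrt u)" using 2 by (simp add: ln_sqrt)
    also have "\<dots> \<le> 2 * (sqrt u - 1)" using 2 by (intro mult_left_mono ln_le_minus_one) auto
    also have "\<dots> \<le> 2 * (sqrt 4 - 1)" using assms by (intro mult_left_mono diff_right_mono real_sqrt_le_mono) auto
    also have "\<dots> \<le> 4" by simp
    finally have "(ln u)\<^sup>2 \<le> 4\<^sup>2" using 2 by (intro power_mono) auto
    then have "u * (ln u)\<^sup>2 \<le> u * (20 + 16 * Q)" using assms by (intro mult_left_mono) auto
    then show ?thesis using assms by (simp add: mult.commute) (smt (verit) divide_nonneg_nonneg)
  next
    case 3
    have "- ln u \<le> - ln ((1 / (1 + Q))\<^sup>2)" using 3 assms by (simp add: ln_mono)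
    also have "\<dots> = 4 * ln (sqrt (1 + Q))" using assms by (simp add: ln_sqrt power2_eq_square ln_mult ln_div)
    also have "\<dots> \<le> 4 * sqrt (1 + Q)" using assms ln_le_minus_one[of "sqrt (1 + Q)"] by simp
    finally have "(- ln u)\<^sup>2 \<le> (4 * sqrt (1 + Q))\<^sup>2" using 3 by (intro power_mono) auto
    then have "(ln u)\<^sup>2 \<le> 20 + 16 * Q" using assms by (simp add: power_mult_distrib)
    then have "u * (ln u)\<^sup>2 \<le> u * (20 + 16 * Q)" using assms by (intro mult_left_mono) auto
    then show ?thesis using assms by (simp add: mult.commute) (smt (verit) divide_nonneg_nonneg)
  next
    case 4
    \<comment> \<open>The fourth root: \<open>ln u = 4 * ln v\<close> and - ln v <= 1 / v give u (ln
      u)^2 <= 16 v^2 = 16 sqrt u, which in this case is below 16 times the weight.\<close>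
    define v where "v = sqrt (sqrt u)"
    have v: "v > 0" "v ^ 4 = u" "v\<^sup>2 = sqrt u"
    proof -
      show "v > 0" "v\<^sup>2 = sqrt u" using 4 by (simp_all add: v_def)
      then have "v ^ 4 = (sqrt u)\<^sup>2" using power_mult[of v 2 2] by simp
      then show "v ^ 4 = u" using 4 by simp
    qed
    have lu: "ln u = 4 * ln v" using v by (simp add: ln_realpow flip: v(2))
    then have lv: "ln v \<le> 0" using ln_less_zero[of u] 4 by simp
    note lu
    moreover have "- ln v \<le> 1 / v" using ln_le_minus_one[of "1 / v"] v by (simp add: ln_div)
    then have "(- ln v)\<^sup>2 \<le> (1 / v)\<^sup>2" using lv by (intro power_mono) auto
    ultimately have "(ln u)\<^sup>2 \<le> 16 * (1 / v)\<^sup>2" by (simp add: power_mult_distrib)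
    then have "u * (ln u)\<^sup>2 \<le> u * (16 * (1 / v)\<^sup>2)" using 4 by (intro mult_left_mono) auto
    also have "\<dots> = 16 * v\<^sup>2" using v(1) by (simp add: v(2)[symmetric] power_divide field_simps power4_eq_xxxx power2_eq_square)
    also have "v\<^sup>2 \<le> 1 / (1 + Q)" unfolding v(3) using 4 assms by (intro real_le_lsqrt) auto
    finally have "u * (ln u)\<^sup>2 \<le> 16 * (1 / (1 + Q))" by simp
    then show ?thesis using assms 4 by (smt (verit) mult_nonneg_nonneg)
  qed
qed

text \<open>Three inputs meet: the density relative to the spread is at most pi < 4, the second
  moment \<open>EQ\<close> is at most 32, and the weights sum to at most 10 \<open>K\<close>. The
  total is 20 + 16 * 32 + 160 = 692.\<close>

lemma expectation_ln_squared_le: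
  assumes p: "p \<ge> 2" and s: "s \<ge> 0"
  shows "(\<Sum>x\<in>{0..<int p}. heat dir p s x * (ln (spread p s * heat dir p s x))\<^sup>2) \<le> 700"
proof -
  define K where "K = spread p s"
  have K: "K > 0" using spread_pos p s by (simp add: K_def)
  obtain c where c: "(\<Sum>x\<in>{0..<int p}. heat dir p s x * rate p (x - c)) \<le> (s + 1) * (2 * pi / real p)\<^sup>2 / 2"
    using expectation_rate_centred_le[OF p s] by blast
  define Q where "Q x = (real p)\<^sup>2 / (s + 1) * rate p (x - c)" for x
  have Q0: "Q x \<ge> 0" for x using s by (simp add: Q_def)
  have EQ: "(\<Sum>x\<in>{0..<int p}. heat dir p s x * Q x) \<le> 32"
  proof -
    have "(\<Sum>x\<in>{0..<int p}. heat dir p s x * Q x)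
        = (real p)\<^sup>2 / (s + 1) * (\<Sum>x\<in>{0..<int p}. heat dir p s x * rate p (x - c))"
      by (simp add: Q_def sum_distrib_left mult_ac)
    also have "\<dots> \<le> (real p)\<^sup>2 / (s + 1) * ((s + 1) * (2 * pi / real p)\<^sup>2 / 2)"
      using c s by (intro mult_left_mono) auto
    also have "\<dots> = 2 * pi\<^sup>2"
    proof -
      have "s + 1 \<noteq> 0" using s by simp
      then show ?thesis using p by (simp add: power_divide power_mult_distrib)
    qed
    also have "\<dots> \<le> 2 * 4\<^sup>2" using pi_less_4 by (intro mult_left_mono power_mono) auto
    finally show ?thesis by simp
  qed
  have W: "(\<Sum>x\<in>{0..<int p}. 1 / (1 + Q x)) \<le> 10 * K"
    using sum_weights_le[OF p s, of c] by (simp add: Q_def K_def)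
  have "K * (\<Sum>x\<in>{0..<int p}. heat dir p s x * (ln (K * heat dir p s x))\<^sup>2)
      = (\<Sum>x\<in>{0..<int p}. (K * heat dir p s x) * (ln (K * heat dir p s x))\<^sup>2)"
    by (simp add: sum_distrib_left mult.assoc)
  also have "\<dots> \<le> (\<Sum>x\<in>{0..<int p}. (20 + 16 * Q x) * (K * heat dir p s x) + 16 * (1 / (1 + Q x)))"
  proof (intro sum_mono mult_ln_squared_le Q0)
    fix x
    show "K * heat dir p s x \<le> 4" using spread_heat_le[OF p s, of dir x] pi_less_4 by (simp add: K_def)
  qed (use K in auto)
  also have "\<dots> = K * (20 + 16 * (\<Sum>x\<in>{0..<int p}. heat dir p s x * Q x)) + 16 * (\<Sum>x\<in>{0..<int p}. 1 / (1 + Q x))"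
  proof -
    have "(\<Sum>x\<in>{0..<int p}. (20 + 16 * Q x) * (K * heat dir p s x))
        = (\<Sum>x\<in>{0..<int p}. (heat dir p s x) * (20 * K) + (16 * K) * (heat dir p s x * Q x))"
      by (intro sum.cong) (auto simp: algebra_simps)
    also have "\<dots> = K * (20 + 16 * (\<Sum>x\<in>{0..<int p}. heat dir p s x * Q x))"
      unfolding sum.distrib sum_heat_mult_const[OF p] sum_distrib_left[symmetric] by (simp add: algebra_simps)
    finally show ?thesis by (simp add: sum.distrib sum_distrib_left)
  qed
  also have "\<dots> \<le> K * (20 + 16 * 32) + 16 * (10 * K)"
    using EQ W K by (intro add_mono mult_left_mono) auto
  also have "\<dots> \<le> K * 700" using K by simp
  finally show ?thesis using K by (simp add: K_def)
qed

text \<open>Through - y <= 1 + y^2 the second moment of the log density controls its mean, at the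
  price 1 + 700.\<close>

lemma heat_entropy_le:
  assumes p: "p \<ge> 2" and s: "s \<ge> 0"
  shows "heat_entropy dir p s \<le> ln (spread p s) + 701"
proof -
  have K: "spread p s > 0" using spread_pos p s by simp
  have "heat_entropy dir p s - ln (spread p s) = (\<Sum>x\<in>{0..<int p}. heat dir p s x * (- ln (spread p s * heat dir p s x)))"
    using sum_heat_ln[OF p K, of dir s] by (simp add: sum_negf)
  also have "\<dots> \<le> (\<Sum>x\<in>{0..<int p}. heat dir p s x * 1 + heat dir p s x * (ln (spread p s * heat dir p s x))\<^sup>2)"
  proof (rule sum_mono)
    fix x
    have "- y \<le> 1 + y\<^sup>2" for y :: real
      using zero_le_power2[of "y + 1/2"] by (simp add: power2_eq_square algebra_simps)
    then have "heat dir p s x * (- ln (spread p s * heat dir p s x)) \<le> heat dir p s x * (1 + (ln (spread p s * heat dir p s x))\<^sup>2)"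
      by (intro mult_left_mono) auto
    then show "heat dir p s x * (- ln (spread p s * heat dir p s x))
       \<le> heat dir p s x * 1 + heat dir p s x * (ln (spread p s * heat dir p s x))\<^sup>2"
      by (simp add: algebra_simps)
  qed
  also have "\<dots> \<le> 1 + 700"
    unfolding sum.distrib sum_heat_mult_const[OF p] using expectation_ln_squared_le[OF p s, of dir] by simp
  finally show ?thesis by simp
qed

text \<open>A variance is smallest about the mean, so the entropy may be exchanged for ln
  \<open>K\<close>. Two choices are used: \<open>K\<close> the spread in general, and
  \<open>K = p\<close> for small deficit.\<close>

lemma varentropy_le_shift:
  assumes p: "p \<ge> 2" and K: "K > 0"
  shows "(\<Sum>x\<in>{0..<int p}. heat dir p s x * (ln (heat dir p s x) + heat_entropy dir p s)\<^sup>2)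
      \<le> (\<Sum>x\<in>{0..<int p}. heat dir p s x * (ln (K * heat dir p s x))\<^sup>2)"
proof -
  define H where "H = heat_entropy dir p s"
  define a where "a = ln K - H"
  have eq: "heat dir p s x * (ln (K * heat dir p s x))\<^sup>2 = heat dir p s x * (ln (heat dir p s x) + H)\<^sup>2
     + (2 * a) * (heat dir p s x * ln (heat dir p s x)) + heat dir p s x * (a\<^sup>2 + 2 * a * H)" for x
  proof (cases "heat dir p s x = 0")
    case False
    then have "heat dir p s x > 0" using heat_nonneg[of dir p s x] by linarith
    then have "ln (K * heat dir p s x) = (ln (heat dir p s x) + H) + a" using K by (simp add: ln_mult a_def)
    then show ?thesis by (simp add: power2_sum algebra_simps)
  qed auto
  have "(\<Sum>x\<in>{0..<int p}. heat dir p s x * (ln (K * heat dir p s x))\<^sup>2)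
     = (\<Sum>x\<in>{0..<int p}. heat dir p s x * (ln (heat dir p s x) + H)\<^sup>2) + (2 * a) * (- H) + (a\<^sup>2 + 2 * a * H)"
    unfolding eq sum.distrib sum_heat_mult_const[OF p] sum_distrib_left[symmetric] by (simp add: H_def heat_entropy_def)
  then show ?thesis unfolding H_def[symmetric] by simp
qed

text \<open>Both sides vanish to second order at \<open>f = 1\<close>, so a bounded density
  suffices. In terms of \<open>g = sqrt f\<close> both are compared with (g - 1)^2.\<close>

lemma mult_ln_squared_le_entropy:
  fixes f F :: real
  assumes "0 \<le> f" "f \<le> F" "1 \<le> F"
  shows "f * (ln f)\<^sup>2 \<le> 4 * F * (f * ln f - f + 1)"
proof (cases "f = 0")
  case False
  define g where "g = sqrt f"
  have g: "g > 0" "f = g\<^sup>2" using False assms by (auto simp: g_def)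
  have \<phi>: "(g - 1)\<^sup>2 \<le> f * ln f - f + 1"
    using sqrt_diff_le_entropy[of f 1] assms by (simp add: g_def)
  have l: "ln f = 2 * ln g" using g by (simp add: ln_realpow)
  have "g\<^sup>2 * (ln g)\<^sup>2 \<le> F * (g - 1)\<^sup>2"
  proof (cases "g \<ge> 1")
    case True
    have "(ln g)\<^sup>2 \<le> (g - 1)\<^sup>2" using True ln_le_minus_one[of g] by (intro power_mono) auto
    then show ?thesis using assms g by (intro mult_mono) auto
  next
    case False
    have "- ln g \<le> 1 / g - 1" using ln_le_minus_one[of "1 / g"] g by (simp add: ln_div)
    then have "g * (- ln g) \<le> g * (1 / g - 1)" using g by (intro mult_left_mono) auto
    then have "g * (- ln g) \<le> 1 - g" using g by (simp add: right_diff_distrib)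
    then have "(g * (- ln g))\<^sup>2 \<le> (1 - g)\<^sup>2"
      using False g by (intro power_mono) (auto simp: mult_nonneg_nonpos)
    then have "g\<^sup>2 * (ln g)\<^sup>2 \<le> 1 * (g - 1)\<^sup>2" by (simp add: power_mult_distrib power2_commute)
    also have "\<dots> \<le> F * (g - 1)\<^sup>2" using assms by (intro mult_right_mono) auto
    finally show ?thesis .
  qed
  then have "f * (ln f)\<^sup>2 \<le> 4 * F * (g - 1)\<^sup>2" unfolding l by (simp add: g(2)[symmetric] power_mult_distrib mult_ac)
  also have "\<dots> \<le> 4 * F * (f * ln f - f + 1)" using \<phi> assms by (intro mult_left_mono) auto
  finally show ?thesis .
qed (use assms in auto)

text \<open>If the deficit exceeds 1, the uniform bound 700 is enough. Otherwise the entropy is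
  within 1 of \<open>ln p\<close>, which forces the spread to be at least p exp (- 702); then the
  density with respect to uniform is bounded by \<open>F\<close> and the varentropy is of the order
  of the deficit itself.\<close>

lemma varentropy_le:
  "\<exists>C>0. \<forall>dir p s. p \<ge> 2 \<longrightarrow> s \<ge> 0 \<longrightarrow>
     (\<Sum>x\<in>{0..<int p}. heat dir p s x * (ln (heat dir p s x) + heat_entropy dir p s)\<^sup>2)
       \<le> C * min 1 (deficit dir p s)"
proof (intro exI conjI allI impI)
  define F :: real where "F = pi * exp 702"
  have F: "F \<ge> 1" using pi_gt3 mult_mono[of 1 pi 1 "exp 702 :: real"] by (simp add: F_def)
  show "700 + 4 * F > 0" using F by simp
  fix dir p s assume p: "(p::nat) \<ge> 2" and s: "(s::real) \<ge> 0"
  let ?V = "\<Sum>x\<in>{0..<int p}. heat dir p s x * (ln (heat dir p s x) + heat_entropy dir p s)\<^sup>2"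
  let ?R = "deficit dir p s"
  have K: "spread p s > 0" using spread_pos p s by simp
  have V1: "?V \<le> 700"
    using varentropy_le_shift[OF p K] expectation_ln_squared_le[OF p s] by (rule order.trans)
  show "?V \<le> (700 + 4 * F) * min 1 ?R"
  proof (cases "?R \<le> 1")
    case False
    then show ?thesis using V1 F by simp
  next
    case True
    have bound: "real p * heat dir p s x \<le> F" for x
    proof -
      have "ln (real p) \<le> ln (spread p s) + 702"
        using heat_entropy_le[OF p s, of dir] True by (simp add: deficit_def)
      then have "real p \<le> exp (ln (spread p s) + 702)" using p by (metis exp_le_cancel_iff exp_ln less_le_trans of_nat_0_less_iff zero_less_numeral)
      then have "real p \<le> spread p s * exp 702" using K by (simp add: exp_add)
      then have "real p * heat dir p s x \<le> (spread p s * heat dir p s x) * exp 702"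
        using mult_right_mono[of "real p" "spread p s * exp 702" "heat dir p s x"] by (simp add: mult_ac)
      also have "\<dots> \<le> pi * exp 702" by (intro mult_right_mono spread_heat_le p s) auto
      finally show ?thesis by (simp add: F_def)
    qed
    have "?V \<le> (\<Sum>x\<in>{0..<int p}. heat dir p s x * (ln (real p * heat dir p s x))\<^sup>2)"
      using p by (intro varentropy_le_shift) auto
    also have "\<dots> = (\<Sum>x\<in>{0..<int p}. (real p * heat dir p s x) * (ln (real p * heat dir p s x))\<^sup>2) / real p"
      using p by (simp add: sum_divide_distrib)
    also have "\<dots> \<le> (\<Sum>x\<in>{0..<int p}. 4 * F * ((real p * heat dir p s x) * ln (real p * heat dir p s x) - real p * heat dir p s x + 1)) / real p"
      using bound F by (intro divide_right_mono sum_mono mult_ln_squared_le_entropy) auto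
    also have "\<dots> = 4 * F * ?R" unfolding deficit_eq'[OF p] by (simp add: sum_distrib_left)
    also have "\<dots> \<le> (700 + 4 * F) * ?R" using deficit_nonneg[OF p, of dir s] by (simp add: distrib_right)
    finally show ?thesis using True by simp
  qed
qed

subsection \<open>Entropy production\<close>

text \<open>A run of \<open>n\<close> steps +1 has positive probability in both orientations. This
  makes the kernel positive at every positive time, so its logarithm can be differentiated.\<close>

lemma residue_in_jump_chain:
  assumes "p \<ge> 2"
  shows "int n mod int p \<in> set_pmf (jump_chain dir (integer_mod_group p) [1] n)"
proof (induction n)
  case (Suc n)
  have "1 \<in> set_pmf (increment dir (integer_mod_group p) [1])"
    by (cases dir) (auto simp: increment_def set_pmf_of_set lessThan_Suc intro!: bexI[of _ True])
  then have "(int n mod int p + 1) mod int p \<in> set_pmf (jump_chain dir (integer_mod_group p) [1] (Suc n))"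
    using Suc.IH by auto
  then show ?case by (simp add: mod_simps add.commute)
qed simp

lemma heat_pos:
  assumes "p \<ge> 2" "s > 0"
  shows "heat dir p s x > 0"
proof -
  have "int (nat (x mod int p)) mod int p = x mod int p" using assms by simp
  then have "x mod int p \<in> set_pmf (circle_walk dir p s)"
    using residue_in_jump_chain[OF assms(1), of "nat (x mod int p)" dir] assms(2)
    by (auto simp: circle_walk_def walk_def jump_count_def)
  then show ?thesis by (simp add: heat_def pmf_positive)
qed

text \<open>Right-hand side of the forward equation: the generator applied to the kernel.\<close>

definition heat_flow :: "orientation \<Rightarrow> nat \<Rightarrow> real \<Rightarrow> int \<Rightarrow> real" where
  "heat_flow dir p s x = (heat dir p s (x - 1) + heat dir p s (x - turn dir)) / 2 - heat dir p s x"

text \<open>The finite Fourier sum in a form in which each summand can be differentiated in the real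
  variable \<open>s\<close>.\<close>

lemma heat_eq_Re:
  assumes "p \<ge> 2" "s \<ge> 0"
  shows "heat dir p s x
      = (\<Sum>j\<in>{0..<int p}. Re (cyc_char p j (- x) * exp (s *\<^sub>R (step_char dir p j - 1)))) / real p"
proof -
  have "real p * heat dir p s x = Re (of_nat p * complex_of_real (heat dir p s x))" by simp
  also have "\<dots> = (\<Sum>j\<in>{0..<int p}. Re (cyc_char p j (- x) * exp (s *\<^sub>R (step_char dir p j - 1))))"
    unfolding heat_fourier[OF assms] by (simp only: Re_sum scaleR_conv_of_real)
  finally show ?thesis using assms by (simp add: field_simps)
qed

lemma continuous_on_heat:
  assumes "p \<ge> 2"
  shows "continuous_on {0..} (\<lambda>s. heat dir p s x)"
proof -
  have "continuous_on {0..} (\<lambda>s. (\<Sum>j\<in>{0..<int p}. Re (cyc_char p j (- x) * exp (s *\<^sub>R (step_char dir p j - 1)))) / real p)"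
    using assms by (intro continuous_intros) auto
  then show ?thesis
    by (rule continuous_on_cong[THEN iffD1, OF refl, rotated]) (simp add: heat_eq_Re[OF assms])
qed

text \<open>Differentiation multiplies each Fourier term by \<open>step_char dir p j - 1\<close>,
  which in position space is the average of two shifts minus the identity.\<close>

lemma heat_has_derivative:
  assumes "p \<ge> 2" "s > 0"
  shows "((\<lambda>s. heat dir p s x) has_real_derivative heat_flow dir p s x) (at s)"
proof -
  let ?e = "\<lambda>j s. exp (s *\<^sub>R (step_char dir p j - 1))"
  have "((\<lambda>s. (\<Sum>j\<in>{0..<int p}. Re (cyc_char p j (- x) * ?e j s)) / real p) has_real_derivative
      (\<Sum>j\<in>{0..<int p}. Re (cyc_char p j (- x) * (?e j s * (step_char dir p j - 1)))) / real p) (at s)"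
    unfolding has_real_derivative_iff_has_vector_derivative
    by (intro bounded_linear.has_vector_derivative[OF bounded_linear_divide] has_vector_derivative_sum
        bounded_linear.has_vector_derivative[OF bounded_linear_Re]
        bounded_linear.has_vector_derivative[OF bounded_linear_mult_right]
        exp_scaleR_has_vector_derivative_right)
  moreover have "(\<Sum>j\<in>{0..<int p}. Re (cyc_char p j (- x) * (?e j s * (step_char dir p j - 1)))) / real p
      = heat_flow dir p s x"
  proof -
    have s0: "s \<ge> 0" using assms by simp
    have "cyc_char p j (- x) * (?e j s * (step_char dir p j - 1))
        = (cyc_char p j (- (x - 1)) * ?e j s + cyc_char p j (- (x - turn dir)) * ?e j s) / 2 - cyc_char p j (- x) * ?e j s" for j
      using cyc_char_add[of p j "- x" 1] cyc_char_add[of p j "- x" "turn dir"]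
      by (simp add: step_char_def field_simps)
    then show ?thesis unfolding heat_flow_def heat_eq_Re[OF assms(1) s0]
      by (simp add: sum_subtractf sum.distrib diff_divide_distrib add_divide_distrib sum_divide_distrib[symmetric])
  qed
  ultimately have "((\<lambda>s. (\<Sum>j\<in>{0..<int p}. Re (cyc_char p j (- x) * ?e j s)) / real p) has_real_derivative
      heat_flow dir p s x) (at s)" by simp
  \<comment> \<open>The Fourier formula holds for nonnegative times only, so the derivative is
    transferred on the open half-line.\<close>
  then show ?thesis
    by (rule has_field_derivative_transform_within_open[where S = "{0<..}"])
      (use assms heat_eq_Re[OF assms(1)] in auto)
qed

lemma sum_heat_shift: "p \<ge> 2 \<Longrightarrow> (\<Sum>x\<in>{0..<int p}. heat dir p s (x + c)) = 1"
  using sum_periodic_shift[of p "heat dir p s" c] by (simp add: sum_heat)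

lemma entropy_has_derivative:
  assumes "p \<ge> 2" "s > 0"
  shows "(heat_entropy dir p has_real_derivative - (\<Sum>x\<in>{0..<int p}. heat_flow dir p s x * ln (heat dir p s x))) (at s)"
proof -
  let ?a = "heat dir p s"
  have "((\<lambda>s. - (\<Sum>x\<in>{0..<int p}. heat dir p s x * ln (heat dir p s x))) has_real_derivative
     - (\<Sum>x\<in>{0..<int p}. heat_flow dir p s x * ln (?a x) + ?a x * (inverse (?a x) * heat_flow dir p s x))) (at s)"
    using heat_pos[OF assms]
    by (intro DERIV_minus DERIV_sum) (auto intro!: derivative_eq_intros heat_has_derivative[OF assms])
  moreover have "(\<Sum>x\<in>{0..<int p}. heat_flow dir p s x) = 0"
    using sum_heat_shift[OF assms(1), of dir s "-1"] sum_heat_shift[OF assms(1), of dir s "- turn dir"] sum_heat[OF assms(1), of dir s]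
    by (simp add: heat_flow_def sum_subtractf sum.distrib sum_divide_distrib[symmetric])
  moreover have "?a x * (inverse (?a x) * heat_flow dir p s x) = heat_flow dir p s x" for x
    using heat_pos[OF assms, of dir x] by simp
  moreover have "heat_entropy dir p = (\<lambda>s. - (\<Sum>x\<in>{0..<int p}. heat dir p s x * ln (heat dir p s x)))"
    by (simp add: fun_eq_iff heat_entropy_def)
  ultimately show ?thesis by (simp add: sum.distrib)
qed

definition cyc_variation :: "orientation \<Rightarrow> nat \<Rightarrow> real \<Rightarrow> real" where
  "cyc_variation dir p s = (\<Sum>x\<in>{0..<int p}. \<bar>heat dir p s x - heat dir p s (x + 1)\<bar>)"

text \<open>After a change of variables the right-hand side is the relative entropy of the kernel
  with respect to its own shift by \<open>c\<close>. Entropy production is the average of two such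
  terms, which also covers the non-reversible directed walk.\<close>

lemma kl_shift_ge:
  assumes "p \<ge> 2" "s > 0"
  shows "(\<Sum>x\<in>{0..<int p}. (sqrt (heat dir p s x) - sqrt (heat dir p s (x + c)))\<^sup>2)
    \<le> (\<Sum>x\<in>{0..<int p}. heat dir p s x * ln (heat dir p s x)) - (\<Sum>x\<in>{0..<int p}. heat dir p s (x - c) * ln (heat dir p s x))"
proof -
  let ?a = "heat dir p s"
  have "(\<Sum>x\<in>{0..<int p}. (sqrt (?a x) - sqrt (?a (x + c)))\<^sup>2)
      \<le> (\<Sum>x\<in>{0..<int p}. ?a x * ln (?a x / ?a (x + c)) - ?a x + ?a (x + c))"
    using heat_pos[OF assms] by (intro sum_mono sqrt_diff_le_entropy) auto
  also have "\<dots> = (\<Sum>x\<in>{0..<int p}. ?a x * ln (?a x) - ?a x * ln (?a (x + c)))"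
  proof -
    have "?a x * ln (?a x / ?a (x + c)) = ?a x * ln (?a x) - ?a x * ln (?a (x + c))" for x
      using heat_pos[OF assms, of dir x] heat_pos[OF assms, of dir "x + c"] by (simp add: ln_div algebra_simps)
    then show ?thesis using sum_heat_shift[OF assms(1), of dir s c] sum_heat[OF assms(1), of dir s]
      by (simp add: sum.distrib sum_subtractf)
  qed
  also have "\<dots> = (\<Sum>x\<in>{0..<int p}. ?a x * ln (?a x)) - (\<Sum>x\<in>{0..<int p}. ?a x * ln (?a (x + c)))"
    by (rule sum_subtractf)
  also have "(\<Sum>x\<in>{0..<int p}. ?a x * ln (?a (x + c))) = (\<Sum>x\<in>{0..<int p}. ?a (x - c) * ln (?a x))"
  proof -
    have "heat dir p s (x mod int p - c) = heat dir p s (x - c)" for x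
      by (metis heat_mod mod_diff_left_eq)
    then show ?thesis
      using sum_periodic_shift[of p "\<lambda>x. ?a (x - c) * ln (?a x)" c] assms by simp
  qed
  finally show ?thesis .
qed

text \<open>A difference of values is the difference of the roots times their sum, so Cauchy-Schwarz
  bounds the squared variation by 4 times the Hellinger sum for the shift 1. That sum enters the
  production with factor 1/2, hence 1/8.\<close>

lemma entropy_production_ge:
  assumes "p \<ge> 2" "s > 0"
  shows "(cyc_variation dir p s)\<^sup>2 / 8 \<le> - (\<Sum>x\<in>{0..<int p}. heat_flow dir p s x * ln (heat dir p s x))"
proof -
  let ?a = "heat dir p s" and ?P = "{0..<int p}"
  let ?S = "\<lambda>c. \<Sum>x\<in>?P. (sqrt (?a x) - sqrt (?a (x + c)))\<^sup>2"
  have "- (\<Sum>x\<in>?P. heat_flow dir p s x * ln (?a x))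
     = ((\<Sum>x\<in>?P. ?a x * ln (?a x)) - (\<Sum>x\<in>?P. ?a (x - 1) * ln (?a x))) / 2
     + ((\<Sum>x\<in>?P. ?a x * ln (?a x)) - (\<Sum>x\<in>?P. ?a (x - turn dir) * ln (?a x))) / 2"
  proof -
    have "heat_flow dir p s x * ln (?a x) = (?a (x - 1) * ln (?a x)) / 2 + (?a (x - turn dir) * ln (?a x)) / 2 - ?a x * ln (?a x)" for x
      by (simp add: heat_flow_def field_simps)
    then have "(\<Sum>x\<in>?P. heat_flow dir p s x * ln (?a x))
       = (\<Sum>x\<in>?P. ?a (x - 1) * ln (?a x)) / 2 + (\<Sum>x\<in>?P. ?a (x - turn dir) * ln (?a x)) / 2 - (\<Sum>x\<in>?P. ?a x * ln (?a x))"
      by (simp only: sum_subtractf sum.distrib sum_divide_distrib)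
    then show ?thesis by (simp only: diff_divide_distrib)
  qed
  \<comment> \<open>The shift by \<open>turn dir\<close> is only used through its sign; the shift by
    1 is present in both orientations.\<close>
  moreover have "0 \<le> ?S (turn dir)" by (intro sum_nonneg) auto
  moreover have "S / 2 \<le> D" if "D = (A - B) / 2 + (A - C) / 2" "0 \<le> S'" "S \<le> A - B" "S' \<le> A - C" for A B C D S S' :: real
    using that by (simp add: field_simps)
  ultimately have "?S 1 / 2 \<le> - (\<Sum>x\<in>?P. heat_flow dir p s x * ln (?a x))"
    using kl_shift_ge[OF assms, of dir 1] kl_shift_ge[OF assms, of dir "turn dir"] by blast
  moreover have "(cyc_variation dir p s)\<^sup>2 \<le> ?S 1 * 4"
  proof -
    have "cyc_variation dir p s
       = (\<Sum>x\<in>?P. \<bar>sqrt (?a x) - sqrt (?a (x + 1))\<bar> * (sqrt (?a x) + sqrt (?a (x + 1))))"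
      unfolding cyc_variation_def
    proof (intro sum.cong refl)
      fix x
      have "?a x - ?a (x + 1) = (sqrt (?a x) - sqrt (?a (x + 1))) * (sqrt (?a x) + sqrt (?a (x + 1)))"
        by (simp add: algebra_simps)
      then show "\<bar>?a x - ?a (x + 1)\<bar> = \<bar>sqrt (?a x) - sqrt (?a (x + 1))\<bar> * (sqrt (?a x) + sqrt (?a (x + 1)))"
        by (simp add: abs_mult)
    qed
    then have "(cyc_variation dir p s)\<^sup>2 \<le> ?S 1 * (\<Sum>x\<in>?P. (sqrt (?a x) + sqrt (?a (x + 1)))\<^sup>2)"
      using Cauchy_Schwarz_ineq_sum[of "\<lambda>x. \<bar>sqrt (?a x) - sqrt (?a (x + 1))\<bar>" "\<lambda>x. sqrt (?a x) + sqrt (?a (x + 1))" ?P]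
      by simp
    also have "(\<Sum>x\<in>?P. (sqrt (?a x) + sqrt (?a (x + 1)))\<^sup>2) \<le> (\<Sum>x\<in>?P. 2 * ?a x + 2 * ?a (x + 1))"
    proof (rule sum_mono)
      fix x
      have "0 \<le> (sqrt (?a x) - sqrt (?a (x + 1)))\<^sup>2" by simp
      then show "(sqrt (?a x) + sqrt (?a (x + 1)))\<^sup>2 \<le> 2 * ?a x + 2 * ?a (x + 1)"
        by (simp add: power2_sum power2_diff)
    qed
    also have "\<dots> = 4"
      unfolding sum.distrib sum_distrib_left[symmetric]
      by (simp add: sum_heat[OF assms(1)] sum_heat_shift[OF assms(1)])
    finally show ?thesis by (simp add: mult_left_mono sum_nonneg)
  qed
  ultimately show ?thesis by linarith
qed

lemma heat_diff_le_variation: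
  assumes "x \<in> {0..<int p}" "y \<in> {0..<int p}"
  shows "\<bar>heat dir p s x - heat dir p s y\<bar> \<le> cyc_variation dir p s"
proof -
  let ?a = "heat dir p s"
  have le: "\<bar>?a (int m) - ?a (int n)\<bar> \<le> cyc_variation dir p s" if "m \<le> n" "n < p" for m n
  proof -
    have "?a (int n) - ?a (int m) = (\<Sum>i\<in>{m..<n}. ?a (int (Suc i)) - ?a (int i))"
      using sum_Suc_diff'[OF that(1), of "\<lambda>i. ?a (int i)"] by simp
    then have "\<bar>?a (int m) - ?a (int n)\<bar> \<le> (\<Sum>i\<in>{m..<n}. \<bar>?a (int (Suc i)) - ?a (int i)\<bar>)"
      using sum_abs[of "\<lambda>i. ?a (int (Suc i)) - ?a (int i)" "{m..<n}"] by linarith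
    also have "\<dots> \<le> (\<Sum>i<p. \<bar>?a (int (Suc i)) - ?a (int i)\<bar>)"
      using that by (intro sum_mono2) auto
    also have "\<dots> = cyc_variation dir p s"
      unfolding cyc_variation_def sum_int_atLeastLessThan by (simp add: abs_minus_commute add.commute)
    finally show ?thesis .
  qed
  have xy: "x = int (nat x)" "y = int (nat y)" "nat x < p" "nat y < p" using assms by auto
  show ?thesis
  proof (cases "nat x \<le> nat y")
    case True
    then show ?thesis using le[of "nat x" "nat y"] xy by simp
  next
    case False
    then show ?thesis using le[of "nat y" "nat x"] xy by (simp add: abs_minus_commute)
  qed
qed

lemma heat_deviation_le_variation:
  assumes "p \<ge> 2" "x \<in> {0..<int p}"
  shows "\<bar>heat dir p s x - 1 / real p\<bar> \<le> cyc_variation dir p s"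
proof -
  have "real p * heat dir p s x - 1 = (\<Sum>y\<in>{0..<int p}. heat dir p s x - heat dir p s y)"
    by (simp add: sum_subtractf sum_heat[OF assms(1)])
  also have "\<bar>\<dots>\<bar> \<le> (\<Sum>y\<in>{0..<int p}. \<bar>heat dir p s x - heat dir p s y\<bar>)" by (rule sum_abs)
  also have "\<dots> \<le> (\<Sum>y\<in>{0..<int p}. cyc_variation dir p s)"
    using assms by (intro sum_mono heat_diff_le_variation) auto
  finally have "\<bar>real p * heat dir p s x - 1\<bar> \<le> real p * cyc_variation dir p s" by simp
  moreover have "real p * heat dir p s x - 1 = real p * (heat dir p s x - 1 / real p)"
    using assms by (simp add: field_simps)
  ultimately show ?thesis using assms by (simp add: abs_mult)
qed

text \<open>The inequality ln y <= y - 1 bounds relative entropy by the chi-square distance, and the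
  latter by the largest deviation.\<close>

lemma deficit_le_chi_square:
  assumes "p \<ge> 2" and b: "\<And>x. x \<in> {0..<int p} \<Longrightarrow> \<bar>heat dir p s x - 1 / real p\<bar> \<le> b"
  shows "deficit dir p s \<le> (real p * b)\<^sup>2"
proof -
  let ?a = "heat dir p s"
  have p: "real p > 0" using assms by simp
  have "deficit dir p s \<le> (\<Sum>x\<in>{0..<int p}. ?a x * (real p * ?a x - 1))"
    unfolding deficit_eq[OF assms(1)]
  proof (rule sum_mono)
    fix x
    show "?a x * ln (real p * ?a x) \<le> ?a x * (real p * ?a x - 1)"
    proof (cases "?a x = 0")
      case False
      then have "?a x > 0" using heat_nonneg[of dir p s x] by linarith
      then show ?thesis using p by (intro mult_left_mono ln_le_minus_one) auto
    qed simp
  qed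
  also have "\<dots> = (\<Sum>x\<in>{0..<int p}. real p * (?a x - 1 / real p)\<^sup>2 + ?a x - 1 / real p)"
    using p by (intro sum.cong refl) (simp add: power2_diff field_simps power2_eq_square)
  also have "\<dots> = (\<Sum>x\<in>{0..<int p}. real p * (?a x - 1 / real p)\<^sup>2)"
    using p by (simp add: sum.distrib sum_subtractf sum_heat[OF assms(1)])
  also have "\<dots> \<le> (\<Sum>x\<in>{0..<int p}. real p * b\<^sup>2)"
    using b p by (intro sum_mono mult_left_mono power2_le_iff_abs_le[THEN iffD2]) (auto intro: order.trans[OF abs_ge_zero b])
  also have "\<dots> = (real p * b)\<^sup>2" by (simp add: power2_eq_square)
  finally show ?thesis .
qed

text \<open>The largest density is at least the exponential of the mean log density, and it exceeds
  1 by at most \<open>p\<close> times the variation. The exponential growth for large deficits is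
  what \<open>deficit_drop\<close> requires.\<close>

lemma exp_deficit_le_variation:
  assumes "p \<ge> 2"
  shows "exp (deficit dir p s) - 1 \<le> real p * cyc_variation dir p s"
proof -
  let ?a = "heat dir p s"
  have p: "real p > 0" and ne: "{0..<int p} \<noteq> {}" using assms by auto
  obtain x where x: "x \<in> {0..<int p}" "\<And>y. y \<in> {0..<int p} \<Longrightarrow> ?a y \<le> ?a x"
  proof -
    have "Max (?a ` {0..<int p}) \<in> ?a ` {0..<int p}" using ne by (intro Max_in) auto
    then obtain x where "x \<in> {0..<int p}" "?a x = Max (?a ` {0..<int p})" by auto
    then show ?thesis using that[of x] by auto
  qed
  have ax: "?a x > 0"
  proof (rule ccontr)
    assume "\<not> ?a x > 0"
    then have "?a y = 0" if "y \<in> {0..<int p}" for y using x(2)[OF that] heat_nonneg[of dir p s y] by linarith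
    then have "(\<Sum>y\<in>{0..<int p}. ?a y) = 0" by simp
    then show False using sum_heat[OF assms, of dir s] by simp
  qed
  have "deficit dir p s \<le> (\<Sum>y\<in>{0..<int p}. ?a y * ln (real p * ?a x))"
    unfolding deficit_eq[OF assms]
  proof (rule sum_mono)
    fix y assume y: "y \<in> {0..<int p}"
    show "?a y * ln (real p * ?a y) \<le> ?a y * ln (real p * ?a x)"
    proof (cases "?a y = 0")
      case False
      then have "?a y > 0" using heat_nonneg[of dir p s y] by linarith
      then show ?thesis using p x(2)[OF y] by (intro mult_left_mono ln_mono) auto
    qed simp
  qed
  also have "\<dots> = ln (real p * ?a x)" by (rule sum_heat_mult_const[OF assms])
  finally have "exp (deficit dir p s) \<le> real p * ?a x" using p ax by (simp add: ln_ge_iff)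
  moreover have "?a x - 1 / real p \<le> cyc_variation dir p s"
    using heat_deviation_le_variation[OF assms x(1), of dir s] by linarith
  then have "real p * (?a x - 1 / real p) \<le> real p * cyc_variation dir p s" using p by (intro mult_left_mono) auto
  ultimately show ?thesis using p by (simp add: right_diff_distrib)
qed

text \<open>Zero variation would make the law uniform and its first Fourier coefficient 0, but that
  coefficient is an exponential.\<close>

lemma cyc_variation_pos:
  assumes "p \<ge> 2" "s \<ge> 0"
  shows "cyc_variation dir p s > 0"
proof (rule ccontr)
  assume "\<not> cyc_variation dir p s > 0"
  then have a: "heat dir p s x = 1 / real p" if "x \<in> {0..<int p}" for x
    using heat_deviation_le_variation[OF assms(1) that, of dir s] by simp
  have "exp (of_real s * (step_char dir p 1 - 1)) = (\<Sum>x\<in>{0..<int p}. of_real (1 / real p) * cyc_char p 1 x)"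
    unfolding sum_heat_cyc_char[OF assms, symmetric] by (intro sum.cong refl) (simp add: a)
  also have "\<dots> = of_real (1 / real p) * (\<Sum>x\<in>{0..<int p}. cyc_char p x 1)"
    by (simp add: sum_distrib_left cyc_char_commute[of p 1])
  also have "\<dots> = 0" using assms by (simp add: sum_cyc_char)
  finally show False by simp
qed

section \<open>Continuity, strict monotonicity and inversion of the deficit\<close>

lemma mult_ln_le_sqrt:
  fixes a :: real
  assumes "0 \<le> a"
  shows "- (a * ln a) \<le> 2 * sqrt a"
proof (cases "a = 0")
  case False
  with assms have a: "a > 0" by simp
  have "- ln (sqrt a) \<le> 1 / sqrt a - 1" using ln_le_minus_one[of "1 / sqrt a"] a by (simp add: ln_div)
  then have "- ln a \<le> 2 * (1 / sqrt a)" using a by (simp add: ln_sqrt)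
  then have "a * (- ln a) \<le> a * (2 * (1 / sqrt a))" using a by (intro mult_left_mono) auto
  also have "\<dots> = 2 * (a / sqrt a)" by simp
  also have "\<dots> = 2 * sqrt a" using a by (simp only: real_div_sqrt)
  finally show ?thesis by simp
qed simp

text \<open>The point 0 matters: at time 0 the kernel vanishes away from its starting point, and the
  deficit has to be continuous there to take the value \<open>ln p\<close>.\<close>

lemma continuous_on_mult_ln: "continuous_on {0..} (\<lambda>x :: real. x * ln x)"
  unfolding continuous_on_eq_continuous_within
proof
  fix x :: real assume x: "x \<in> {0..}"
  show "continuous (at x within {0..}) (\<lambda>x. x * ln x)"
  proof (cases "x = 0")
    case False
    then show ?thesis using x by (intro continuous_intros) auto
  next
    case True
    have ev: "\<forall>\<^sub>F y :: real in at 0 within {0..}. 0 \<le> y \<and> y < 1"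
      unfolding eventually_at by (intro exI[of _ 1]) (auto simp: dist_real_def)
    have "((\<lambda>y :: real. y * ln y) \<longlongrightarrow> 0) (at 0 within {0..})"
    proof (rule tendsto_sandwich)
      show "\<forall>\<^sub>F y :: real in at 0 within {0..}. - (2 * sqrt y) \<le> y * ln y"
        using ev by eventually_elim (use mult_ln_le_sqrt in \<open>force\<close>)
      show "\<forall>\<^sub>F y :: real in at 0 within {0..}. y * ln y \<le> 0"
        using ev
      proof eventually_elim
        case (elim y)
        then show ?case by (cases "y = 0") (auto intro!: mult_nonneg_nonpos)
      qed
      show "((\<lambda>y. - (2 * sqrt y)) \<longlongrightarrow> 0) (at 0 within {0..})"
        by (rule tendsto_eq_intros refl)+ simp
    qed simp
    then show ?thesis using True by (simp add: continuous_within)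
  qed
qed

lemma continuous_on_deficit:
  assumes "p \<ge> 2"
  shows "continuous_on {0..} (deficit dir p)"
proof -
  have "continuous_on {0..} (\<lambda>s. heat dir p s x * ln (heat dir p s x))" for x
    by (rule continuous_on_compose2[OF continuous_on_mult_ln continuous_on_heat[OF assms]]) auto
  then have "continuous_on {0..} (\<lambda>s. ln (real p) - - (\<Sum>x\<in>{0..<int p}. heat dir p s x * ln (heat dir p s x)))"
    by (intro continuous_on_diff continuous_on_const continuous_on_minus continuous_on_sum)
  then show ?thesis by (simp add: deficit_def[abs_def] heat_entropy_def)
qed

lemma deficit_has_derivative:
  assumes "p \<ge> 2" "s > 0"
  shows "(deficit dir p has_real_derivative (\<Sum>x\<in>{0..<int p}. heat_flow dir p s x * ln (heat dir p s x))) (at s)"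
proof -
  have "((\<lambda>s. ln (real p) - heat_entropy dir p s) has_real_derivative
      0 - - (\<Sum>x\<in>{0..<int p}. heat_flow dir p s x * ln (heat dir p s x))) (at s)"
    by (intro DERIV_diff DERIV_const entropy_has_derivative[OF assms])
  then show ?thesis by (simp add: deficit_def[abs_def])
qed

lemma deficit_strict_antimono:
  assumes "p \<ge> 2" "0 \<le> s" "s < u"
  shows "deficit dir p u < deficit dir p s"
proof (rule DERIV_neg_imp_decreasing_open[OF assms(3)])
  fix x assume x: "s < x" "x < u"
  then have "x > 0" using assms by simp
  moreover have "(cyc_variation dir p x)\<^sup>2 / 8 > 0" using cyc_variation_pos[OF assms(1), of x dir] \<open>x > 0\<close> by simp
  ultimately show "\<exists>y. (deficit dir p has_real_derivative y) (at x) \<and> y < 0"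
    using deficit_has_derivative[OF assms(1) \<open>x > 0\<close>, of dir] entropy_production_ge[OF assms(1) \<open>x > 0\<close>, of dir]
    by (intro exI conjI) (assumption, linarith)
next
  show "continuous_on {s..u} (deficit dir p)"
    using assms by (intro continuous_on_subset[OF continuous_on_deficit]) auto
qed

lemma deficit_0: "p \<ge> 2 \<Longrightarrow> deficit dir p 0 = ln (real p)"
proof -
  assume p: "p \<ge> 2"
  have "heat dir p 0 x = (if x = 0 then 1 else 0)" if "x \<in> {0..<int p}" for x
    using that by (simp add: heat_def circle_walk_def walk_def jump_count_def bind_return_pmf)
  then have "heat dir p 0 x * ln (heat dir p 0 x) = 0" if "x \<in> {0..<int p}" for x
    using that by simp
  then have "(\<Sum>x\<in>{0..<int p}. heat dir p 0 x * ln (heat dir p 0 x)) = 0"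
    by (rule sum.neutral[OF ballI])
  then show ?thesis by (simp add: deficit_def heat_entropy_def)
qed

lemma deficit_le_nontrivial_sum:
  assumes "p \<ge> 2" "s \<ge> 0"
  shows "deficit dir p s \<le> (nontrivial_sum p s)\<^sup>2"
  using deficit_le_chi_square[OF assms(1), of dir s "nontrivial_sum p s / real p"] heat_deviation[OF assms, of dir] assms
  by simp

text \<open>Intermediate values: the deficit starts at \<open>ln p\<close> and is at most (pi p)^2 /
  (s + 1).\<close>

lemma deficit_bij:
  assumes "p \<ge> 2" "y \<in> {0<..ln (real p)}"
  shows "\<exists>s\<ge>0. deficit dir p s = y"
proof -
  have lim: "((\<lambda>s. (pi * real p)\<^sup>2 / (s + 1)) \<longlongrightarrow> 0) at_top" by real_asymp
  have "\<forall>\<^sub>F s in at_top. (pi * real p)\<^sup>2 / (s + 1) < y \<and> s \<ge> 0"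
    using assms by (intro eventually_conj order_tendstoD(2)[OF lim] eventually_ge_at_top) auto
  then obtain b where b: "(pi * real p)\<^sup>2 / (b + 1) < y" "b \<ge> 0"
    by (auto simp: eventually_at_top_linorder)
  have n0: "nontrivial_sum p b \<ge> 0" by (simp add: nontrivial_sum_def sum_nonneg)
  have "deficit dir p b \<le> (nontrivial_sum p b)\<^sup>2" by (rule deficit_le_nontrivial_sum) (use assms b in auto)
  also have "\<dots> \<le> (pi * real p / sqrt (b + 1))\<^sup>2"
    using nontrivial_sum_le[OF assms(1) b(2)] n0 by (intro power_mono) auto
  also have "\<dots> = (pi * real p)\<^sup>2 / (b + 1)" using b by (simp add: power_divide)
  finally have "deficit dir p b \<le> y" using b by simp
  moreover have "y \<le> deficit dir p 0" using assms by (simp add: deficit_0)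
  moreover have "continuous_on {0..b} (deficit dir p)"
    using assms by (intro continuous_on_subset[OF continuous_on_deficit]) auto
  ultimately show ?thesis using IVT2'[of "deficit dir p" b y 0] b by auto
qed

text \<open>Makes the formal inverse in \<open>entropic_time\<close> a genuine one wherever
  \<open>entropic_time_defined\<close> holds.\<close>

lemma the_inv_rel_entropy:
  fixes dir :: orientation
  assumes "p \<ge> 2" "k > 0" "y \<in> {0<..ln (real p)}"
  defines "s \<equiv> the_inv_into {0..} (rel_entropy dir p k) y"
  shows "s \<ge> 0" "deficit dir p s = y"
proof -
  have inj: "inj_on (rel_entropy dir p k) {0..}"
  proof (rule linorder_inj_onI)
    fix a b :: real assume "a < b" "a \<in> {0..}" "b \<in> {0..}"
    then show "rel_entropy dir p k a \<noteq> rel_entropy dir p k b"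
      using deficit_strict_antimono[OF assms(1), of a b dir] assms by (simp add: rel_entropy_eq)
  qed auto
  obtain u where u: "u \<ge> 0" "deficit dir p u = y" using deficit_bij[OF assms(1,3)] by blast
  then have "rel_entropy dir p k u = y" using assms by (simp add: rel_entropy_eq)
  then have "s = u" unfolding s_def using the_inv_into_f_f[OF inj, of u] u by simp
  then show "s \<ge> 0" "deficit dir p s = y" using u by auto
qed

subsection \<open>Decay of the entropy deficit\<close>

text \<open>By the mean value theorem the drop is at least \<epsilon> s times the production at an
  intermediate time. A large spread requires a large time, so s >= const p^2 exp (- 2 R), and the
  drop is at least a constant times exp (- 2 R) M, where \<open>M\<close> is the squared variation
  scaled by \<open>p\<close>. The loss exp (- 2 R) is recovered from the exponential lower bound on
  \<open>M\<close> when \<open>R\<close> is large.\<close>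

lemma deficit_drop:
  assumes eps: "\<epsilon> > 0" and c0: "c > 0"
  shows "\<exists>\<kappa>>0. \<forall>dir p s. p \<ge> 2 \<longrightarrow> s \<ge> c \<longrightarrow>
     \<kappa> * min 1 (deficit dir p s) \<le> deficit dir p s - deficit dir p ((1 + \<epsilon>) * s)"
proof -
  define \<kappa>1 where "\<kappa>1 = c / (1 + c) * exp (- 1402)"
  define \<delta> where "\<delta> = \<epsilon> * \<kappa>1 / 8"
  have \<kappa>1: "\<kappa>1 > 0" using c0 by (simp add: \<kappa>1_def)
  have \<delta>: "\<delta> > 0" using \<kappa>1 eps by (simp add: \<delta>_def)
  \<comment> \<open>The value 1/2 serves the case of a large drop; 9 is the square of the 3 in exp
    R1 - 1 >= exp R1 / 3, and exp (- 2) bounds exp (- 2 R) for R <= 1.\<close>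
  define \<kappa> where "\<kappa> = min (1 / 2) (\<delta> * exp (- 2) / 9)"
  have \<kappa>: "\<kappa> > 0" "\<kappa> \<le> 1 / 2" "\<kappa> \<le> \<delta> * exp (- 2) / 9" using \<delta> by (auto simp: \<kappa>_def)
  have "\<kappa> * min 1 (deficit dir p s) \<le> deficit dir p s - deficit dir p ((1 + \<epsilon>) * s)"
    if p: "p \<ge> 2" and s: "s \<ge> c" for dir p s
  proof -
    define u where "u = (1 + \<epsilon>) * s"
    define R where "R = deficit dir p s"
    define R1 where "R1 = deficit dir p u"
    have s0: "s > 0" using s c0 by linarith
    then have su: "s < u" using eps by (simp add: u_def)
    have R1: "R1 \<ge> 0" unfolding R1_def by (rule deficit_nonneg[OF p])
    have pp: "real p > 0" using p by simp
    obtain \<xi> where \<xi>: "s < \<xi>" "\<xi> < u"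
      "deficit dir p u - deficit dir p s = (u - s) * (\<Sum>x\<in>{0..<int p}. heat_flow dir p \<xi> x * ln (heat dir p \<xi> x))"
    proof -
      have D: "(deficit dir p has_real_derivative (\<Sum>x\<in>{0..<int p}. heat_flow dir p \<xi> x * ln (heat dir p \<xi> x))) (at \<xi>)"
        if "s \<le> \<xi>" "\<xi> \<le> u" for \<xi>
        using that s0 by (intro deficit_has_derivative[OF p]) simp
      show ?thesis using MVT2[OF su D] that by blast
    qed
    define M where "M = (real p * cyc_variation dir p \<xi>)\<^sup>2"
    have \<xi>0: "\<xi> > 0" using \<xi> s0 by linarith
    have RR1: "R - R1 \<ge> \<delta> * exp (- 2 * R) * M"
    proof -
      have "R - R1 \<ge> (u - s) * ((cyc_variation dir p \<xi>)\<^sup>2 / 8)"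
      proof -
        have "(u - s) * ((cyc_variation dir p \<xi>)\<^sup>2 / 8) \<le> (u - s) * - (\<Sum>x\<in>{0..<int p}. heat_flow dir p \<xi> x * ln (heat dir p \<xi> x))"
          using su by (intro mult_left_mono entropy_production_ge[OF p \<xi>0]) auto
        then show ?thesis using \<xi>(3) by (simp add: R_def R1_def)
      qed
      \<comment> \<open>Read \<open>heat_entropy_le\<close> backwards: a deficit \<open>R\<close> at
        time \<open>s\<close> means that sqrt (s + 1) is at least p exp (- R - 701). Since
        \<open>s >= c\<close>, the term \<open>s + 1\<close> is at most a multiple of
        \<open>s\<close>.\<close>
      moreover have "s / (real p)\<^sup>2 \<ge> \<kappa>1 * exp (- 2 * R)"
      proof -
        have "ln (spread p s) \<le> ln (sqrt (s + 1))"
          using spread_le_sqrt[of p s] spread_pos[of p s] s0 pp by (intro ln_mono) auto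
        then have "heat_entropy dir p s \<le> ln (sqrt (s + 1)) + 701"
          using heat_entropy_le[OF p, of s dir] s0 by simp
        then have "ln (real p) \<le> R + ln (sqrt (s + 1)) + 701" by (simp add: R_def deficit_def)
        then have "real p \<le> exp (R + ln (sqrt (s + 1)) + 701)" using pp by (metis exp_le_cancel_iff exp_ln)
        then have "real p \<le> sqrt (s + 1) * exp (R + 701)" using s0 by (simp add: exp_add mult_ac)
        then have "(real p)\<^sup>2 \<le> (sqrt (s + 1) * exp (R + 701))\<^sup>2" by (intro power_mono) auto
        also have "\<dots> = (s + 1) * exp (2 * R + 1402)"
          using s0 by (simp add: power_mult_distrib exp_double[symmetric] algebra_simps)
        also have "\<dots> \<le> (s * (1 + c) / c) * exp (2 * R + 1402)"
          using s c0 by (intro mult_right_mono) (auto simp: field_simps)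
        finally have "(real p)\<^sup>2 * (\<kappa>1 * exp (- 2 * R)) \<le> (s * (1 + c) / c) * exp (2 * R + 1402) * (\<kappa>1 * exp (- 2 * R))"
          using \<kappa>1 by (intro mult_right_mono) auto
        also have "\<dots> = s * ((1 + c) / c * (c / (1 + c))) * (exp (2 * R + 1402) * exp (- 1402) * exp (- 2 * R))"
          unfolding \<kappa>1_def by (simp only: divide_inverse mult_ac)
        also have "\<dots> = s" using c0 by (simp add: exp_add[symmetric])
        finally show ?thesis using pp by (simp add: field_simps)
      qed
      then have "\<epsilon> / 8 * M * (s / (real p)\<^sup>2) \<ge> \<epsilon> / 8 * M * (\<kappa>1 * exp (- 2 * R))"
        using eps by (intro mult_left_mono) (auto simp: M_def)
      moreover have "(u - s) * ((cyc_variation dir p \<xi>)\<^sup>2 / 8) = \<epsilon> / 8 * M * (s / (real p)\<^sup>2)"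
        using pp by (simp add: u_def M_def power_mult_distrib field_simps)
      ultimately show ?thesis by (simp add: \<delta>_def mult_ac)
    qed
    have \<xi>R: "R1 \<le> deficit dir p \<xi>"
      unfolding R1_def using deficit_strict_antimono[OF p, of \<xi> u dir] \<xi> \<xi>0 by simp
    have M1: "R1 \<le> M"
      using \<xi>R deficit_le_chi_square[OF p heat_deviation_le_variation[OF p], of dir \<xi>] by (simp add: M_def)
    have M2: "(exp R1 - 1)\<^sup>2 \<le> M"
    proof -
      have "exp R1 \<le> exp (deficit dir p \<xi>)" using \<xi>R by simp
      then have "exp R1 - 1 \<le> real p * cyc_variation dir p \<xi>"
        using exp_deficit_le_variation[OF p, of dir \<xi>] by linarith
      then show ?thesis unfolding M_def using R1 by (intro power_mono) auto
    qed
    have R: "R \<ge> 0" unfolding R_def by (rule deficit_nonneg[OF p])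
    have "\<kappa> * min 1 R \<le> R - R1"
    proof -
      \<comment> \<open>Either the deficit has already dropped enough, or \<open>R1\<close> is still
        comparable with \<open>R\<close> and forces \<open>M\<close> to be large: by
        \<open>M1\<close> if \<open>R <= 1\<close>, by \<open>M2\<close> if
        \<open>R > 1\<close>.\<close>
      consider "R1 \<le> R - min 1 R / 2" | "R1 > R - min 1 R / 2" "R \<le> 1" | "R1 > R - min 1 R / 2" "R > 1" by linarith
      then show ?thesis
      proof cases
        case 1
        have "\<kappa> * min 1 R \<le> 1 / 2 * min 1 R" using \<kappa> R by (intro mult_right_mono) auto
        then show ?thesis using 1 by linarith
      next
        case 2
        then have "R / 2 \<le> M" using M1 by simp
        moreover have "exp (- 2) \<le> exp (- 2 * R)" using 2 by simp
        ultimately have e1: "\<delta> * exp (- 2) * (R / 2) \<le> \<delta> * exp (- 2 * R) * M"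
          using \<delta> R by (intro mult_mono) auto
        have "\<kappa> * R \<le> \<delta> * exp (- 2) / 9 * R" using \<kappa> R by (intro mult_right_mono) auto
        also have "\<dots> \<le> \<delta> * exp (- 2) * (R / 2)" using \<delta> R by (simp add: field_simps)
        also note e1
        also note RR1
        finally have "\<kappa> * R \<le> R - R1" .
        then show ?thesis using 2 by simp
      next
        case 3
        then have "R1 \<ge> R - 1 / 2" by simp
        have "3 / 2 \<le> 1 + R1" using \<open>R1 \<ge> R - 1 / 2\<close> 3(2) by argo
        then have "exp R1 \<ge> 3 / 2" using exp_ge_add_one_self[of R1] by (rule order.trans)
        then have "exp R1 / 3 \<le> exp R1 - 1" by simp
        then have "(exp R1 / 3)\<^sup>2 \<le> (exp R1 - 1)\<^sup>2" by (intro power_mono) auto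
        then have "exp (2 * R1) / 9 \<le> M" using M2 by (simp add: power_divide exp_double)
        moreover have "exp (2 * R - 1) \<le> exp (2 * R1)" using \<open>R1 \<ge> R - 1 / 2\<close> by simp
        ultimately have "exp (2 * R - 1) / 9 \<le> M" by linarith
        then have "\<delta> * exp (- 2 * R) * (exp (2 * R - 1) / 9) \<le> \<delta> * exp (- 2 * R) * M"
          using \<delta> by (intro mult_left_mono) auto
        then have "\<delta> * exp (- 2 * R) * (exp (2 * R - 1) / 9) \<le> R - R1"
          using RR1 by (rule order.trans)
        note le = this
        have "\<kappa> \<le> \<delta> * exp (- 1) / 9" by (rule order.trans[OF \<kappa>(3)]) (use \<delta> in simp)
        also have "\<dots> = \<delta> * exp (- 2 * R) * (exp (2 * R - 1) / 9)"
          by (simp add: exp_add[symmetric] mult.assoc)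
        also note le
        finally have "\<kappa> \<le> R - R1" .
        then show ?thesis using 3(2) by simp
      qed
    qed
    then show ?thesis by (simp add: R_def R1_def u_def)
  qed
  then show ?thesis using \<kappa>(1) by blast
qed

text \<open>Cauchy--Schwarz against the weights \<open>1 + p^2 * rate\<close>, whose inverses are summable uniformly in
  \<open>p\<close>.\<close>

lemma heat_entropy_le_sqrt:
  assumes p: "p \<ge> 2" and s: "0 \<le> s" "s \<le> 1"
  shows "heat_entropy dir p s \<le> 200 * sqrt s"
proof -
  let ?a = "heat dir p s"
  have pp: "real p > 0" using p by simp
  have ss: "s + s\<^sup>2 \<le> 2 * s" using s by (simp add: power2_eq_square mult_left_le)
  define T where "T = (\<Sum>x\<in>{0..<int p}. ?a x * ((real p)\<^sup>2 * rate p x))"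
  have T: "T \<le> 64 * s"
  proof -
    have "T = (real p)\<^sup>2 * (\<Sum>x\<in>{0..<int p}. ?a x * rate p x)" by (simp add: T_def sum_distrib_left mult_ac)
    then show ?thesis using expectation_rate_uncentred_le[OF p s(1), of dir] ss by argo
  qed
  have split: "{0..<int p} = insert 0 {1..<int p}" using p by auto
  have T': "T = (\<Sum>x\<in>{1..<int p}. ?a x * ((real p)\<^sup>2 * rate p x))"
    unfolding T_def split by (simp add: rate_def)
  \<comment> \<open>Away from 0 the weight is at least 8, so \<open>T\<close> controls the
    probability of having left 0.\<close>
  have big: "8 \<le> (real p)\<^sup>2 * rate p x" if x: "x \<in> {1..<int p}" for x
  proof -
    have *: "8 \<le> (real p)\<^sup>2 * rate p y" if "1 \<le> y" "2 * y \<le> int p" for y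
    proof -
      have "8 \<le> 8 * (real_of_int y)\<^sup>2" using that(1) by (simp add: power2_eq_square) (metis mult_mono' mult_1 of_int_1_le_iff zero_le_one)
      also have "\<dots> = (real p)\<^sup>2 * (8 * (of_int y / real p)\<^sup>2)" using pp by (simp add: power_divide)
      also have "\<dots> \<le> (real p)\<^sup>2 * rate p y" using that by (intro mult_left_mono rate_ge) auto
      finally show ?thesis .
    qed
    show ?thesis
    proof (cases "2 * x \<le> int p")
      case True
      then show ?thesis using *[of x] x by simp
    next
      case False
      then show ?thesis using *[of "int p - x"] x rate_reflect[of p x] p by simp
    qed
  qed
  have a0: "1 - ?a 0 \<le> 8 * s"
  proof -
    have "1 - ?a 0 = (\<Sum>x\<in>{1..<int p}. ?a x)"
      using sum_heat[OF p, of dir s] unfolding split by simp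
    also have "8 * \<dots> = (\<Sum>x\<in>{1..<int p}. ?a x * 8)" by (simp add: sum_distrib_left mult.commute)
    also have "\<dots> \<le> T" unfolding T' by (intro sum_mono mult_left_mono big) auto
    finally have "8 * (1 - ?a 0) \<le> T" .
    also have "T \<le> 8 * (8 * s)" using T by simp
    finally show ?thesis by simp
  qed
  \<comment> \<open>The mass at 0 is close to 1, and - a ln a <= 1 - a makes its entropy linear in
    \<open>s\<close>; the order sqrt s comes from the other points.\<close>
  have zero: "- (?a 0 * ln (?a 0)) \<le> 8 * s"
  proof (cases "?a 0 = 0")
    case True
    then show ?thesis using s by simp
  next
    case False
    then have a: "?a 0 > 0" using heat_nonneg[of dir p s 0] by linarith
    have "- ln (?a 0) \<le> 1 / ?a 0 - 1" using ln_le_minus_one[of "1 / ?a 0"] a by (simp add: ln_div)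
    then have "?a 0 * (- ln (?a 0)) \<le> ?a 0 * (1 / ?a 0 - 1)" using a by (intro mult_left_mono) auto
    also have "\<dots> = 1 - ?a 0" using a by (simp add: right_diff_distrib)
    finally show ?thesis using a0 by simp
  qed
  have rest: "(\<Sum>x\<in>{1..<int p}. sqrt (?a x)) \<le> 36 * sqrt s"
  proof -
    let ?w = "\<lambda>x. 1 + (real p)\<^sup>2 * rate p x"
    have w: "?w x > 0" for x by (simp add: add_pos_nonneg)
    have w0: "0 \<le> ?w x" for x using w[of x] by simp
    have eq: "sqrt (?a x) = sqrt (?a x * ?w x) * sqrt (1 / ?w x)" for x
    proof -
      have "sqrt (?a x * ?w x) * sqrt (1 / ?w x) = sqrt ((?a x * ?w x) * (1 / ?w x))"
        by (rule real_sqrt_mult[symmetric])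
      also have "(?a x * ?w x) * (1 / ?w x) = ?a x" using less_imp_neq[OF w[of x]] by simp
      finally show ?thesis by (rule sym)
    qed
    have A: "(\<Sum>x\<in>{1..<int p}. (sqrt (?a x * ?w x))\<^sup>2) \<le> 128 * s"
    proof -
      have "(\<Sum>x\<in>{1..<int p}. (sqrt (?a x * ?w x))\<^sup>2) = (\<Sum>x\<in>{1..<int p}. ?a x * ?w x)"
        by (intro sum.cong refl real_sqrt_pow2 mult_nonneg_nonneg w0) auto
      also have "\<dots> \<le> (\<Sum>x\<in>{1..<int p}. 2 * (?a x * ((real p)\<^sup>2 * rate p x)))"
      proof (rule sum_mono)
        fix x assume "x \<in> {1..<int p}"
        then have "1 \<le> (real p)\<^sup>2 * rate p x" by (intro order.trans[OF _ big]) auto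
        then have "?w x \<le> 2 * ((real p)\<^sup>2 * rate p x)" unfolding mult_2 by (rule add_right_mono)
        then have "?a x * ?w x \<le> ?a x * (2 * ((real p)\<^sup>2 * rate p x))" by (intro mult_left_mono) auto
        then show "?a x * ?w x \<le> 2 * (?a x * ((real p)\<^sup>2 * rate p x))" by simp
      qed
      also have "\<dots> = 2 * T" unfolding T' by (simp add: sum_distrib_left)
      finally show ?thesis using T by simp
    qed
    have B: "(\<Sum>x\<in>{1..<int p}. (sqrt (1 / ?w x))\<^sup>2) \<le> 10"
    proof -
      have "(\<Sum>x\<in>{1..<int p}. (sqrt (1 / ?w x))\<^sup>2) = (\<Sum>x\<in>{1..<int p}. 1 / ?w x)"
        using w0 by (intro sum.cong refl real_sqrt_pow2) auto
      also have "\<dots> \<le> (\<Sum>x\<in>{0..<int p}. 1 / ?w x)"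
        using w0 by (intro sum_mono2) auto
      also have "\<dots> \<le> 10 * spread p 0" using sum_weights_le[OF p, of 0 0] by simp
      also have "\<dots> \<le> 10" using spread_le_sqrt[of p 0] p by simp
      finally show ?thesis .
    qed
    have "(\<Sum>x\<in>{1..<int p}. sqrt (?a x * ?w x) * sqrt (1 / ?w x))\<^sup>2
       \<le> (\<Sum>x\<in>{1..<int p}. (sqrt (?a x * ?w x))\<^sup>2) * (\<Sum>x\<in>{1..<int p}. (sqrt (1 / ?w x))\<^sup>2)"
      by (rule Cauchy_Schwarz_ineq_sum)
    then have "(\<Sum>x\<in>{1..<int p}. sqrt (?a x))\<^sup>2
       \<le> (\<Sum>x\<in>{1..<int p}. (sqrt (?a x * ?w x))\<^sup>2) * (\<Sum>x\<in>{1..<int p}. (sqrt (1 / ?w x))\<^sup>2)"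
      by (simp only: eq[symmetric])
    also have "\<dots> \<le> (128 * s) * 10"
      using s by (intro mult_mono A B sum_nonneg) auto
    \<comment> \<open>1280 <= 36^2 = 1296.\<close>
    also have "\<dots> \<le> (36 * sqrt s)\<^sup>2" using s by (simp add: power_mult_distrib)
    finally show ?thesis by (rule power2_le_imp_le) (use s in simp)
  qed
  have "heat_entropy dir p s = - (?a 0 * ln (?a 0)) + (\<Sum>x\<in>{1..<int p}. - (?a x * ln (?a x)))"
    unfolding heat_entropy_def split by (simp add: sum_negf)
  also have "\<dots> \<le> 8 * s + (\<Sum>x\<in>{1..<int p}. 2 * sqrt (?a x))"
    by (intro add_mono zero sum_mono mult_ln_le_sqrt) auto
  also have "\<dots> \<le> 8 * s + 72 * sqrt s" using rest by (simp add: sum_distrib_left[symmetric])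
  also have "\<dots> \<le> 200 * sqrt s"
  proof -
    have "sqrt s * sqrt s \<le> sqrt s * 1" using s by (intro mult_left_mono) auto
    then have "s \<le> sqrt s" using s by simp
    moreover have "0 \<le> sqrt s" using s by simp
    ultimately show ?thesis by argo
  qed
  finally show ?thesis .
qed

text \<open>Used with the entropy at the entropic time, which is d ln p / k per coordinate.\<close>

lemma time_ge_of_entropy_ge:
  assumes "p \<ge> 2" "s \<ge> 0" "c > 0" "c \<le> heat_entropy dir p s"
  shows "min 1 ((c / 200)\<^sup>2) \<le> s"
proof (cases "s \<le> 1")
  case True
  have "c / 200 \<le> sqrt s" using heat_entropy_le_sqrt[OF assms(1,2) True, of dir] assms(4) by simp
  then have "(c / 200)\<^sup>2 \<le> (sqrt s)\<^sup>2" using assms by (intro power_mono) auto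
  then show ?thesis using assms by simp
qed simp

subsection \<open>Concentration in the coordinate walk\<close>

lemma expectation_Pi_pmf_square_sum:
  fixes g :: "'b \<Rightarrow> real"
  assumes I: "finite I" and Q: "finite (set_pmf Q)" and mean: "measure_pmf.expectation Q g = 0"
  shows "measure_pmf.expectation (Pi_pmf I dflt (\<lambda>_. Q)) (\<lambda>w. (\<Sum>i\<in>I. g (w i))\<^sup>2)
       = card I * measure_pmf.expectation Q (\<lambda>x. (g x)\<^sup>2)"
proof -
  let ?P = "Pi_pmf I dflt (\<lambda>_. Q)"
  have finP: "finite (set_pmf ?P)"
    using I Q by (auto simp: set_Pi_pmf intro!: finite_PiE_dflt)
  have int: "integrable (measure_pmf ?P) f" for f :: "_ \<Rightarrow> real"
    by (rule integrable_measure_pmf_finite[OF finP])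
  have marg: "measure_pmf.expectation ?P (\<lambda>w. f (w i)) = measure_pmf.expectation Q f" if "i \<in> I" for i and f :: "_ \<Rightarrow> real"
  proof -
    have "measure_pmf.expectation Q f = measure_pmf.expectation (map_pmf (\<lambda>w. w i) ?P) f"
      using I that by (simp add: Pi_pmf_component)
    then show ?thesis by simp
  qed
  have cross: "measure_pmf.expectation ?P (\<lambda>w. g (w i) * g (w j))
      = (if i = j then measure_pmf.expectation Q (\<lambda>x. (g x)\<^sup>2) else 0)" if ij: "i \<in> I" "j \<in> I" for i j
  proof (cases "i = j")
    case True
    then show ?thesis using marg[OF ij(1), of "\<lambda>x. (g x)\<^sup>2"] by (simp add: power2_eq_square)
  next
    case False
    have "prob_space.indep_vars (measure_pmf ?P) (\<lambda>_. borel) (\<lambda>l w. g (w l)) I"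
      by (rule prob_space.indep_vars_compose2[OF prob_space_measure_pmf indep_vars_Pi_pmf[OF I]]) auto
    then have "prob_space.indep_vars (measure_pmf ?P) (\<lambda>_. borel) (\<lambda>l w. g (w l)) {i, j}"
      by (rule prob_space.indep_vars_subset[OF prob_space_measure_pmf]) (use ij in auto)
    from prob_space.indep_vars_lebesgue_integral[OF prob_space_measure_pmf _ this int]
    show ?thesis using False marg[OF ij(1), of g] mean by simp
  qed
  have "measure_pmf.expectation ?P (\<lambda>w. (\<Sum>i\<in>I. g (w i))\<^sup>2)
      = (\<Sum>i\<in>I. \<Sum>j\<in>I. measure_pmf.expectation ?P (\<lambda>w. g (w i) * g (w j)))"
    using int by (simp add: power2_eq_square sum_product)
  also have "\<dots> = (\<Sum>i\<in>I. measure_pmf.expectation Q (\<lambda>x. (g x)\<^sup>2))"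
    using I cross by (intro sum.cong refl) simp
  finally show ?thesis by simp
qed

lemma Pi_pmf_chebyshev:
  fixes g :: "'b \<Rightarrow> real"
  assumes I: "finite I" and Q: "finite (set_pmf Q)" and mean: "measure_pmf.expectation Q g = 0" and r: "r > 0"
  shows "measure_pmf.prob (Pi_pmf I dflt (\<lambda>_. Q)) {w. r \<le> \<bar>\<Sum>i\<in>I. g (w i)\<bar>}
       \<le> card I * measure_pmf.expectation Q (\<lambda>x. (g x)\<^sup>2) / r\<^sup>2"
proof -
  let ?P = "Pi_pmf I dflt (\<lambda>_. Q)"
  have finP: "finite (set_pmf ?P)"
    using I Q by (auto simp: set_Pi_pmf intro!: finite_PiE_dflt)
  have "{w. r \<le> \<bar>\<Sum>i\<in>I. g (w i)\<bar>} = {w \<in> space (measure_pmf ?P). r\<^sup>2 \<le> (\<Sum>i\<in>I. g (w i))\<^sup>2}"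
    using r abs_le_square_iff[of r] by auto
  then have "measure_pmf.prob ?P {w. r \<le> \<bar>\<Sum>i\<in>I. g (w i)\<bar>}
      \<le> measure_pmf.expectation ?P (\<lambda>w. (\<Sum>i\<in>I. g (w i))\<^sup>2) / r\<^sup>2"
    using r integrable_measure_pmf_finite[OF finP]
    by (simp only:) (intro integral_Markov_inequality_measure[where A = "{}"], auto)
  then show ?thesis by (simp add: expectation_Pi_pmf_square_sum[OF I Q mean])
qed

lemma expectation_circle_walk_sum:
  fixes g :: "int \<Rightarrow> real"
  assumes "p \<ge> 2"
  shows "measure_pmf.expectation (circle_walk dir p s) g = (\<Sum>x\<in>{0..<int p}. heat dir p s x * g x)"
  using set_circle_walk[OF assms, of dir s]
  by (subst integral_measure_pmf[of "{0..<int p}"]) (auto simp: heat_def)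

lemma finite_set_circle_walk: "p \<ge> 2 \<Longrightarrow> finite (set_pmf (circle_walk dir p s))"
  using set_circle_walk[of p dir s] finite_subset by blast

lemma coord_walk_chebyshev:
  fixes g :: "int \<Rightarrow> real"
  assumes p: "p \<ge> 2" and k: "k > 0" and s: "s \<ge> 0" and r: "r > 0"
    and mean: "(\<Sum>x\<in>{0..<int p}. heat dir p s x * g x) = 0"
  shows "measure_pmf.prob (coord_walk dir p k (s * real k)) {w. r \<le> \<bar>\<Sum>i<k. g (w i)\<bar>}
       \<le> real k * (\<Sum>x\<in>{0..<int p}. heat dir p s x * (g x)\<^sup>2) / r\<^sup>2"
proof -
  have eq: "coord_walk dir p k (s * real k) = Pi_pmf {..<k} undefined (\<lambda>_. circle_walk dir p s)"
    using coord_walk_eq_Pi_pmf[OF p k, of "s * real k" dir] s k by simp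
  have "measure_pmf.expectation (circle_walk dir p s) g = 0"
    using mean by (simp add: expectation_circle_walk_sum[OF p])
  from Pi_pmf_chebyshev[OF finite_lessThan finite_set_circle_walk[OF p] this r, of k undefined]
  show ?thesis by (simp add: eq expectation_circle_walk_sum[OF p])
qed

text \<open>On the support the log probability is a sum of independent terms with mean minus the
  entropy, so Chebyshev applies. Off the support the logarithm would have no such meaning.\<close>

lemma surprise_concentration:
  assumes p: "p \<ge> 2" and k: "k > 0" and s: "s \<ge> 0" and r: "r > 0"
  shows "measure_pmf.prob (coord_walk dir p k (s * real k))
      {w \<in> set_pmf (coord_walk dir p k (s * real k)).
         r \<le> \<bar>ln (pmf (coord_walk dir p k (s * real k)) w) + real k * heat_entropy dir p s\<bar>}
    \<le> real k * (\<Sum>x\<in>{0..<int p}. heat dir p s x * (ln (heat dir p s x) + heat_entropy dir p s)\<^sup>2) / r\<^sup>2"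
proof -
  let ?P = "coord_walk dir p k (s * real k)" and ?H = "heat_entropy dir p s"
  have eq: "?P = Pi_pmf {..<k} undefined (\<lambda>_. circle_walk dir p s)"
    using coord_walk_eq_Pi_pmf[OF p k, of "s * real k" dir] s k by simp
  have mean: "(\<Sum>x\<in>{0..<int p}. heat dir p s x * (ln (heat dir p s x) + ?H)) = 0"
    by (simp add: distrib_left sum.distrib sum_heat_mult_const[OF p]) (simp add: heat_entropy_def)
  have "ln (pmf ?P w) + real k * ?H = (\<Sum>i<k. ln (heat dir p s (w i)) + ?H)" if "w \<in> set_pmf ?P" for w
  proof -
    have w: "w \<in> PiE_dflt {..<k} undefined (\<lambda>_. set_pmf (circle_walk dir p s))"
      using that by (simp add: eq set_Pi_pmf comp_def)
    have heat: "heat dir p s (w i) = pmf (circle_walk dir p s) (w i)" "heat dir p s (w i) > 0" if "i < k" for i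
    proof -
      have wi: "w i \<in> set_pmf (circle_walk dir p s)" using w that by (auto simp: PiE_dflt_def)
      then have "w i mod int p = w i" using set_circle_walk[OF p, of dir s] by auto
      then show "heat dir p s (w i) = pmf (circle_walk dir p s) (w i)" "heat dir p s (w i) > 0"
        using wi by (simp_all add: heat_def pmf_positive)
    qed
    have "pmf ?P w = (\<Prod>i<k. pmf (circle_walk dir p s) (w i))"
      unfolding eq using w by (intro pmf_Pi') (auto simp: PiE_dflt_def)
    also have "\<dots> = (\<Prod>i<k. heat dir p s (w i))" using heat by (intro prod.cong) auto
    also have "ln \<dots> = (\<Sum>i<k. ln (heat dir p s (w i)))" by (intro ln_prod) (use heat(2) in fastforce)+
    finally show ?thesis by (simp add: sum.distrib)
  qed
  then have "measure_pmf.prob ?P {w \<in> set_pmf ?P. r \<le> \<bar>ln (pmf ?P w) + real k * ?H\<bar>}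
     \<le> measure_pmf.prob ?P {w. r \<le> \<bar>\<Sum>i<k. ln (heat dir p s (w i)) + ?H\<bar>}"
    by (intro measure_pmf.finite_measure_mono) auto
  also have "\<dots> \<le> real k * (\<Sum>x\<in>{0..<int p}. heat dir p s x * (ln (heat dir p s x) + ?H)\<^sup>2) / r\<^sup>2"
    by (rule coord_walk_chebyshev[OF p k s r mean])
  finally show ?thesis .
qed

lemma set_coord_walk: "p \<ge> 2 \<Longrightarrow> k > 0 \<Longrightarrow> set_pmf (coord_walk dir p k t) \<subseteq> carrier (Zpow p k)"
  unfolding coord_walk_def using set_unit_vectors[of p k]
  by (intro set_walk) (auto simp: unit_vectors_def)

text \<open>Half of the gap \<Gamma> is spent on fluctuations; the other half remains as the factor
  \<open>exp (- \<Gamma> / 2)\<close> in the two bounds below.\<close>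

lemma prob_typical_ge:
  assumes p: "p \<ge> 2" and k: "k > 0" and s: "s \<ge> 0" and \<Gamma>: "\<Gamma> > 0"
    and V: "(\<Sum>x\<in>{0..<int p}. heat dir p s x * (ln (heat dir p s x) + heat_entropy dir p s)\<^sup>2)
       \<le> C * min 1 (deficit dir p s)"
  defines "P \<equiv> coord_walk dir p k (s * real k)"
  shows "1 - measure_pmf.prob P {w \<in> set_pmf P. \<bar>ln (pmf P w) + real k * heat_entropy dir p s\<bar> < \<Gamma> / 2}
     \<le> 4 * C * (real k * min 1 (deficit dir p s) / \<Gamma>\<^sup>2)"
proof -
  let ?h = "\<lambda>w. \<bar>ln (pmf P w) + real k * heat_entropy dir p s\<bar>"
  have "measure_pmf.prob P {w \<in> set_pmf P. \<Gamma> / 2 \<le> ?h w}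
     \<le> real k * (\<Sum>x\<in>{0..<int p}. heat dir p s x * (ln (heat dir p s x) + heat_entropy dir p s)\<^sup>2) / (\<Gamma> / 2)\<^sup>2"
    unfolding P_def using \<Gamma> by (intro surprise_concentration p k s) auto
  also have "\<dots> \<le> real k * (C * min 1 (deficit dir p s)) / (\<Gamma> / 2)\<^sup>2"
    using V by (intro divide_right_mono mult_left_mono) auto
  also have "\<dots> = 4 * C * (real k * min 1 (deficit dir p s) / \<Gamma>\<^sup>2)" by (simp add: power_divide)
  finally have 1: "measure_pmf.prob P {w \<in> set_pmf P. \<Gamma> / 2 \<le> ?h w} \<le> 4 * C * (real k * min 1 (deficit dir p s) / \<Gamma>\<^sup>2)" .
  have "1 = measure_pmf.prob P (UNIV \<inter> set_pmf P)" unfolding measure_Int_set_pmf by simp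
  also have "\<dots> \<le> measure_pmf.prob P ({w \<in> set_pmf P. ?h w < \<Gamma> / 2} \<union> {w \<in> set_pmf P. \<Gamma> / 2 \<le> ?h w})"
    by (intro measure_pmf.finite_measure_mono) auto
  also have "\<dots> \<le> measure_pmf.prob P {w \<in> set_pmf P. ?h w < \<Gamma> / 2} + measure_pmf.prob P {w \<in> set_pmf P. \<Gamma> / 2 \<le> ?h w}"
    by (intro measure_Un_le) auto
  finally show ?thesis using 1 by linarith
qed

lemma zeta_mult: "k > 0 \<Longrightarrow> real k * zeta p d k = (real k - real d) * ln (real p)"
  by (simp add: zeta_def)

text \<open>Here the entropy of the coordinate walk is \<open>d ln p + \<Gamma>\<close>, so typical
  points have probability at most p^(- d) exp (- \<Gamma> / 2), the lightness required by the second
  moment bound.\<close>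

lemma upper_bound:
  assumes p: "prime p" and k: "k > 0" and s: "s \<ge> 0" and \<delta>: "\<delta> > 0"
    and V: "(\<Sum>x\<in>{0..<int p}. heat dir p s x * (ln (heat dir p s x) + heat_entropy dir p s)\<^sup>2)
       \<le> C * min 1 (deficit dir p s)"
    and \<Gamma>: "\<Gamma> = real k * (zeta p d k - deficit dir p s)" "\<Gamma> > 0"
  shows "measure_pmf.prob (random_generators (Zpow p d) k)
      {Z. tv_to_uniform dir (Zpow p d) Z (s * real k) > 4 * C * (real k * min 1 (deficit dir p s) / \<Gamma>\<^sup>2) + \<delta>}
    \<le> exp (- \<Gamma> / 2) / \<delta>\<^sup>2"
proof -
  have p2: "p \<ge> 2" using p prime_ge_2_nat by blast
  define P where "P = coord_walk dir p k (s * real k)"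
  define A where "A = {w \<in> set_pmf P. \<bar>ln (pmf P w) + real k * heat_entropy dir p s\<bar> < \<Gamma> / 2}"
  have H: "real k * heat_entropy dir p s = real d * ln (real p) + \<Gamma>"
    unfolding \<Gamma>(1) right_diff_distrib zeta_mult[OF k] by (simp add: deficit_def algebra_simps)
  have mu: "real p ^ d * pmf P w \<le> exp (- \<Gamma> / 2)" if "w \<in> A" for w
  proof -
    have w: "pmf P w > 0" using that by (auto simp: A_def pmf_positive)
    have "\<bar>ln (pmf P w) + real k * heat_entropy dir p s\<bar> < \<Gamma> / 2" using that by (simp add: A_def)
    then have "ln (pmf P w) + (real d * ln (real p) + \<Gamma>) < \<Gamma> / 2" unfolding H by (simp only: abs_less_iff)
    then have "ln (pmf P w) \<le> - \<Gamma> / 2 - real d * ln (real p)" by argo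
    then have "pmf P w \<le> exp (- \<Gamma> / 2 - real d * ln (real p))" using w by (metis exp_le_cancel_iff exp_ln)
    also have "\<dots> = exp (- \<Gamma> / 2) / real p ^ d" using p2 by (simp add: exp_diff exp_of_nat_mult)
    finally show ?thesis using p2 by (simp add: field_simps)
  qed
  have A: "A \<subseteq> carrier (Zpow p k)" using set_coord_walk[OF p2 k] by (auto simp: A_def P_def)
  have "1 - measure_pmf.prob P A \<le> 4 * C * (real k * min 1 (deficit dir p s) / \<Gamma>\<^sup>2)"
    unfolding A_def P_def by (rule prob_typical_ge[OF p2 k s \<Gamma>(2) V])
  then have "measure_pmf.prob (random_generators (Zpow p d) k)
      {Z. tv_to_uniform dir (Zpow p d) Z (s * real k) > 4 * C * (real k * min 1 (deficit dir p s) / \<Gamma>\<^sup>2) + \<delta>}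
     \<le> measure_pmf.prob (random_generators (Zpow p d) k)
      {Z. tv_to_uniform dir (Zpow p d) Z (s * real k) > 1 - measure_pmf.prob P A + \<delta>}"
    by (intro measure_pmf.finite_measure_mono) auto
  also have "\<dots> \<le> exp (- \<Gamma> / 2) / \<delta>\<^sup>2"
    using s k mu A unfolding P_def by (intro prob_tv_to_uniform_gt p k \<delta>) auto
  finally show ?thesis .
qed

text \<open>Here the entropy is \<open>d ln p - \<Gamma>\<close>, so the typical set has at most p^d
  exp (- \<Gamma> / 2) points and its image covers a negligible part of the group.\<close>

lemma lower_bound:
  assumes p: "prime p" and k: "k > 0" and s: "s \<ge> 0"
    and Z: "length Z = k" "set Z \<subseteq> carrier (Zpow p d)"
    and V: "(\<Sum>x\<in>{0..<int p}. heat dir p s x * (ln (heat dir p s x) + heat_entropy dir p s)\<^sup>2)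
       \<le> C * min 1 (deficit dir p s)"
    and \<Gamma>: "\<Gamma> = real k * (deficit dir p s - zeta p d k)" "\<Gamma> > 0"
  shows "1 - (4 * C * (real k * min 1 (deficit dir p s) / \<Gamma>\<^sup>2) + exp (- \<Gamma> / 2))
    \<le> tv_to_uniform dir (Zpow p d) Z (s * real k)"
proof -
  have p2: "p \<ge> 2" using p prime_ge_2_nat by blast
  define P where "P = coord_walk dir p k (s * real k)"
  define A where "A = {w \<in> set_pmf P. \<bar>ln (pmf P w) + real k * heat_entropy dir p s\<bar> < \<Gamma> / 2}"
  have H: "real k * heat_entropy dir p s = real d * ln (real p) - \<Gamma>"
    unfolding \<Gamma>(1) right_diff_distrib zeta_mult[OF k] by (simp add: deficit_def algebra_simps)
  have mu: "exp (\<Gamma> / 2) / real p ^ d \<le> pmf P w" if "w \<in> A" for w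
  proof -
    have w: "pmf P w > 0" using that by (auto simp: A_def pmf_positive)
    have "\<bar>ln (pmf P w) + real k * heat_entropy dir p s\<bar> < \<Gamma> / 2" using that by (simp add: A_def)
    then have "- (ln (pmf P w) + (real d * ln (real p) - \<Gamma>)) < \<Gamma> / 2" unfolding H by (simp only: abs_less_iff)
    then have "\<Gamma> / 2 - real d * ln (real p) \<le> ln (pmf P w)" by argo
    then have "exp (\<Gamma> / 2 - real d * ln (real p)) \<le> pmf P w" using w by (metis exp_le_cancel_iff exp_ln)
    then show ?thesis using p2 by (simp add: exp_diff exp_of_nat_mult)
  qed
  have "A \<subseteq> carrier (Zpow p k)" using set_coord_walk[OF p2 k] by (auto simp: A_def P_def)
  then have A: "finite A" by (rule finite_subset) (use p2 in simp)
  have "real (card A) * (exp (\<Gamma> / 2) / real p ^ d) \<le> sum (pmf P) A"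
    using mu by (intro sum_bounded_below) auto
  also have "\<dots> = measure_pmf.prob P A" using A by (simp add: measure_measure_pmf_finite)
  also have "\<dots> \<le> 1" by simp
  finally have "real (card A) / real p ^ d \<le> exp (- \<Gamma> / 2)"
    by (simp add: exp_minus field_simps)
  moreover have "1 - measure_pmf.prob P A \<le> 4 * C * (real k * min 1 (deficit dir p s) / \<Gamma>\<^sup>2)"
    unfolding A_def P_def by (rule prob_typical_ge[OF p2 k s \<Gamma>(2) V])
  ultimately show ?thesis
    using prob_le_tv_to_uniform[OF p2 k Z A, of dir "s * real k"] unfolding P_def by linarith
qed

subsection \<open>Limits along the sequence\<close>

lemma tendsto_in_prob_deterministic:
  assumes "\<forall>\<^sub>F N in sequentially. \<forall>\<omega>\<in>set_pmf (P N). \<bar>X N \<omega> - c\<bar> \<le> b N" and b: "b \<longlonglongrightarrow> 0"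
  shows "tendsto_in_prob P X c"
  unfolding tendsto_in_prob_def
proof (intro allI impI)
  fix \<delta> :: real assume \<delta>: "\<delta> > 0"
  have "\<forall>\<^sub>F N in sequentially. measure_pmf.prob (P N) {\<omega>. \<bar>X N \<omega> - c\<bar> > \<delta>} = 0"
    using assms(1) order_tendstoD(2)[OF b \<delta>]
  proof eventually_elim
    case (elim N)
    then have "set_pmf (P N) \<inter> {\<omega>. \<bar>X N \<omega> - c\<bar> > \<delta>} = {}" by force
    then show ?case by (simp add: measure_pmf_zero_iff)
  qed
  then show "(\<lambda>N. measure_pmf.prob (P N) {\<omega>. \<bar>X N \<omega> - c\<bar> > \<delta>}) \<longlonglongrightarrow> 0"
    by (rule tendsto_eventually)
qed

text \<open>The assumed bound is used at \<delta> / 2; the other half absorbs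
  \<open>a\<close>.\<close>

lemma tendsto_in_prob_0I:
  assumes X: "\<And>N \<omega>. 0 \<le> X N \<omega>"
    and bd: "\<And>\<delta>. \<delta> > 0 \<Longrightarrow> \<forall>\<^sub>F N in sequentially. measure_pmf.prob (P N) {\<omega>. X N \<omega> > a N + \<delta>} \<le> e N / \<delta>\<^sup>2"
    and a: "a \<longlonglongrightarrow> 0" and e: "e \<longlonglongrightarrow> 0"
  shows "tendsto_in_prob P X 0"
  unfolding tendsto_in_prob_def
proof (intro allI impI)
  fix \<delta> :: real assume \<delta>: "\<delta> > 0"
  show "(\<lambda>N. measure_pmf.prob (P N) {\<omega>. \<bar>X N \<omega> - 0\<bar> > \<delta>}) \<longlonglongrightarrow> 0"
  proof (rule tendsto_sandwich[where f = "\<lambda>_. 0" and h = "\<lambda>N. e N / (\<delta> / 2)\<^sup>2"])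
    have \<delta>2: "\<delta> / 2 > 0" using \<delta> by simp
    show "\<forall>\<^sub>F N in sequentially. measure_pmf.prob (P N) {\<omega>. \<bar>X N \<omega> - 0\<bar> > \<delta>} \<le> e N / (\<delta> / 2)\<^sup>2"
      using bd[OF \<delta>2] order_tendstoD(2)[OF a \<delta>2]
    proof eventually_elim
      case (elim N)
      have "measure_pmf.prob (P N) {\<omega>. \<bar>X N \<omega> - 0\<bar> > \<delta>} \<le> measure_pmf.prob (P N) {\<omega>. X N \<omega> > a N + \<delta> / 2}"
        using elim(2) X by (intro measure_pmf.finite_measure_mono) auto
      then show ?case using elim(1) by linarith
    qed
    have "(\<lambda>N. e N / (\<delta> / 2)\<^sup>2) \<longlonglongrightarrow> 0 / (\<delta> / 2)\<^sup>2" using \<delta> by (intro tendsto_divide e) auto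
    then show "(\<lambda>N. e N / (\<delta> / 2)\<^sup>2) \<longlonglongrightarrow> 0" by simp
  qed auto
qed

lemma set_random_generators:
  assumes "p > 0" "Z \<in> set_pmf (random_generators (Zpow p d) k)"
  shows "length Z = k" "set Z \<subseteq> carrier (Zpow p d)"
proof -
  have "carrier (Zpow p d) \<noteq> {}" using assms by (simp add: carrier_Zpow PiE_eq_empty_iff)
  then show "length Z = k" "set Z \<subseteq> carrier (Zpow p d)"
    using assms by (auto simp: random_generators_def set_replicate_pmf set_pmf_of_set in_lists_conv_set)
qed

lemma tv_to_uniform_bounds: "0 \<le> tv_to_uniform dir G Z t" "tv_to_uniform dir G Z t \<le> 1"
  by (simp_all add: tv_to_uniform_def tv_dist_nonneg tv_dist_le_1)

subsection \<open>Nearly as few generators as possible\<close>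

text \<open>The sine increases up to pi / 2, and larger frequencies are reflected.\<close>

lemma rate_1_le:
  assumes p: "p \<ge> 2" and j: "j \<in> {1..<int p}"
  shows "rate p 1 \<le> rate p j"
proof -
  have *: "rate p 1 \<le> rate p i" if "1 \<le> i" "2 * i \<le> int p" for i
  proof -
    have le: "pi * 1 / real p \<le> pi * of_int i / real p"
      using that by (intro divide_right_mono mult_left_mono) auto
    have "2 * real_of_int i \<le> real p" using that by linarith
    then have "pi * (2 * of_int i) \<le> pi * real p" by (intro mult_left_mono) auto
    then have "pi * of_int i / real p \<le> pi / 2" using p by (simp add: field_simps)
    then have "sin (pi * 1 / real p) \<le> sin (pi * of_int i / real p)"
      using le p by (intro sin_monotone_2pi_le) (auto intro: order.trans[of _ 0])
    moreover have "0 \<le> sin (pi * 1 / real p)" using p by (intro sin_ge_zero) (auto simp: field_simps)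
    ultimately have "(sin (pi * 1 / real p))\<^sup>2 \<le> (sin (pi * of_int i / real p))\<^sup>2" by (intro power_mono) auto
    then show ?thesis by (simp add: rate_eq_sin)
  qed
  show ?thesis
  proof (cases "2 * j \<le> int p")
    case True
    then show ?thesis using * j by simp
  next
    case False
    then show ?thesis using *[of "int p - j"] rate_reflect[of p j] j p by simp
  qed
qed

lemma rate_1_pos:
  assumes "p \<ge> 2"
  shows "rate p 1 > 0"
proof -
  have "pi / real p < pi" using assms by (simp add: divide_less_eq)
  then have "0 < sin (pi / real p)" using assms by (intro sin_gt_zero) auto
  then show ?thesis by (simp add: rate_eq_sin)
qed

text \<open>Only the time before \<open>1 / rate p 1\<close> is spent on making the sum over all frequencies comparable with
  its leading term.\<close>

lemma nontrivial_sum_le_exp: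
  assumes p: "p \<ge> 2" and s: "s * rate p 1 \<ge> 1"
  shows "nontrivial_sum p s \<le> 96 * exp (- s * rate p 1)"
proof -
  define l where "l = rate p 1"
  have l: "l > 0" using rate_1_pos[OF p] by (simp add: l_def)
  \<comment> \<open>The relaxation time. After \<open>u\<close> every frequency decays at least as
    fast as the first; at \<open>u\<close> the sum is at most 4 * 8, and exp 1 <= 3 gives
    96.\<close>
  define u where "u = 1 / l"
  have u0: "u > 0" using l by (simp add: u_def)
  have us: "u \<le> s" unfolding u_def pos_divide_le_eq[OF l] using s by (simp only: l_def)
  note u = u0 us
  have "nontrivial_sum p s \<le> (\<Sum>j\<in>{1..<int p}. exp (- (s - u) * l) * exp (- u * rate p j))"
    unfolding nontrivial_sum_def
  proof (rule sum_mono)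
    fix j assume "j \<in> {1..<int p}"
    then have "(s - u) * l \<le> (s - u) * rate p j" using rate_1_le[OF p] u by (intro mult_left_mono) (auto simp: l_def)
    then show "exp (- s * rate p j) \<le> exp (- (s - u) * l) * exp (- u * rate p j)"
      by (simp add: exp_add[symmetric] left_diff_distrib)
  qed
  also have "\<dots> = exp (- (s - u) * l) * nontrivial_sum p u"
    by (simp add: nontrivial_sum_def sum_distrib_left)
  also have "\<dots> \<le> exp (- (s - u) * l) * 32"
  proof (intro mult_left_mono)
    have "nontrivial_sum p u \<le> pi * real p / sqrt (u + 1)" using p u by (intro nontrivial_sum_le) auto
    also have "\<dots> \<le> pi * real p / sqrt u" using p u by (intro divide_left_mono) auto
    also have "\<dots> = pi * (real p * sqrt l)" by (simp add: u_def real_sqrt_divide)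
    also have "\<dots> \<le> 4 * 8"
    proof (intro mult_mono)
      have "(real p)\<^sup>2 * l \<le> (real p)\<^sup>2 * ((2 * pi * of_int 1 / real p)\<^sup>2 / 2)"
        unfolding l_def by (intro mult_left_mono rate_le) auto
      also have "\<dots> = 2 * pi\<^sup>2" using p by (simp add: power_divide power_mult_distrib)
      also have "\<dots> \<le> 2 * 4\<^sup>2" using pi_less_4 by (intro mult_left_mono power_mono) auto
      finally have "(real p * sqrt l)\<^sup>2 \<le> 8\<^sup>2" using l by (simp add: power_mult_distrib)
      then show "real p * sqrt l \<le> 8" by (rule power2_le_imp_le) simp
    qed (use pi_less_4 l in auto)
    finally show "nontrivial_sum p u \<le> 32" by simp
  qed auto
  also have "exp (- (s - u) * l) = exp 1 * exp (- s * l)"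
    using l by (simp add: u_def exp_add[symmetric] left_diff_distrib)
  also have "exp 1 * exp (- s * l) * 32 \<le> 3 * exp (- s * l) * 32"
    using exp_le by (intro mult_right_mono) auto
  finally show ?thesis by (simp add: l_def)
qed

lemma uniform_Zpow_eq_Pi_pmf:
  assumes "p > 0"
  shows "pmf_of_set (carrier (Zpow p k)) = Pi_pmf {..<k} undefined (\<lambda>_. pmf_of_set {0..<int p})"
proof -
  have "PiE_dflt {..<k} undefined (\<lambda>_. {0..<int p}) = carrier (Zpow p k)"
    unfolding carrier_Zpow[OF assms] PiE_dflt_def PiE_def Pi_def extensional_def by blast
  then show ?thesis using assms by (subst Pi_pmf_of_set) simp_all
qed

text \<open>One plus the chi-square distance is multiplicative over independent coordinates, and
  each factor is at most 1 + S^2 <= exp (S^2).\<close>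

lemma tv_coord_walk_le:
  assumes p: "p \<ge> 2" and k: "k > 0" and s: "s \<ge> 0"
  shows "tv_dist (coord_walk dir p k (s * real k)) (pmf_of_set (carrier (Zpow p k)))
      \<le> sqrt (exp (real k * (nontrivial_sum p s)\<^sup>2) - 1)"
proof -
  let ?P = "coord_walk dir p k (s * real k)" and ?C = "carrier (Zpow p k)" and ?S = "nontrivial_sum p s"
  have p0: "p > 0" and pr: "real p > 0" using p by simp_all
  have eq: "?P = Pi_pmf {..<k} undefined (\<lambda>_. circle_walk dir p s)"
    using coord_walk_eq_Pi_pmf[OF p k, of "s * real k" dir] s k by simp
  have one: "real p * (\<Sum>x\<in>{0..<int p}. (heat dir p s x)\<^sup>2) \<le> 1 + ?S\<^sup>2"
  proof -
    have "(\<Sum>x\<in>{0..<int p}. (heat dir p s x - 1 / real p)\<^sup>2) \<le> (\<Sum>x\<in>{0..<int p}. (?S / real p)\<^sup>2)"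
    proof (rule sum_mono)
      fix x
      show "(heat dir p s x - 1 / real p)\<^sup>2 \<le> (?S / real p)\<^sup>2"
        using power_mono[OF heat_deviation[OF p s, of dir x] abs_ge_zero, of 2] by simp
    qed
    also have "\<dots> = ?S\<^sup>2 / real p" using pr by (simp add: power_divide power2_eq_square)
    finally have "(\<Sum>x\<in>{0..<int p}. (heat dir p s x - 1 / real p)\<^sup>2) \<le> ?S\<^sup>2 / real p" .
    moreover have "(\<Sum>x\<in>{0..<int p}. (heat dir p s x - 1 / real p)\<^sup>2)
        = (\<Sum>x\<in>{0..<int p}. (heat dir p s x)\<^sup>2) - 1 / real p"
    proof -
      have "(\<Sum>x\<in>{0..<int p}. (heat dir p s x - 1 / real p)\<^sup>2)
          = (\<Sum>x\<in>{0..<int p}. (heat dir p s x)\<^sup>2 - heat dir p s x * (2 / real p) + (1 / real p)\<^sup>2)"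
        by (intro sum.cong refl) (simp add: power2_diff)
      also have "\<dots> = (\<Sum>x\<in>{0..<int p}. (heat dir p s x)\<^sup>2) - 2 / real p + real p * (1 / real p)\<^sup>2"
        unfolding sum.distrib sum_subtractf sum_heat_mult_const[OF p] by simp
      also have "real p * (1 / real p)\<^sup>2 = 1 / real p" using pr by (simp add: power2_eq_square)
      finally show ?thesis by simp
    qed
    ultimately have "(\<Sum>x\<in>{0..<int p}. (heat dir p s x)\<^sup>2) \<le> (1 + ?S\<^sup>2) / real p"
      by (simp add: add_divide_distrib)
    then show ?thesis using pr by (simp add: field_simps)
  qed
  have "(\<Sum>w\<in>?C. (pmf ?P w)\<^sup>2) = (\<Sum>w\<in>?C. \<Prod>i<k. (heat dir p s (w i))\<^sup>2)"
  proof (intro sum.cong refl)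
    fix w assume "w \<in> ?C"
    then have w: "w i \<in> {0..<int p}" if "i < k" for i using that p0 by (auto simp: carrier_Zpow PiE_iff)
    have "pmf ?P w = (\<Prod>i<k. pmf (circle_walk dir p s) (w i))"
      unfolding eq using \<open>w \<in> ?C\<close> p0 by (intro pmf_Pi') (auto simp: carrier_Zpow PiE_iff extensional_def)
    also have "\<dots> = (\<Prod>i<k. heat dir p s (w i))" using w by (intro prod.cong) (auto simp: heat_def)
    finally show "(pmf ?P w)\<^sup>2 = (\<Prod>i<k. (heat dir p s (w i))\<^sup>2)" by (simp add: prod_power_distrib)
  qed
  also have "\<dots> = (\<Prod>i<k. \<Sum>x\<in>{0..<int p}. (heat dir p s x)\<^sup>2)"
    using p0 by (subst prod_sum_PiE) (auto simp: carrier_Zpow)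
  finally have "real p ^ k * (\<Sum>w\<in>?C. (pmf ?P w)\<^sup>2) = (real p * (\<Sum>x\<in>{0..<int p}. (heat dir p s x)\<^sup>2)) ^ k"
    by (simp add: power_mult_distrib)
  also have "\<dots> \<le> (1 + ?S\<^sup>2) ^ k" using one by (intro power_mono) (auto intro!: mult_nonneg_nonneg sum_nonneg)
  also have "\<dots> \<le> (exp (?S\<^sup>2)) ^ k" by (intro power_mono) auto
  also have "\<dots> = exp (real k * ?S\<^sup>2)" by (simp add: exp_of_nat_mult)
  finally have chi: "real p ^ k * (\<Sum>w\<in>?C. (pmf ?P w)\<^sup>2) \<le> exp (real k * ?S\<^sup>2)" .
  have C: "finite ?C" "?C \<noteq> {}" using p0 by (auto simp: carrier_Zpow PiE_eq_empty_iff finite_PiE)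
  have "tv_dist ?P (pmf_of_set ?C) \<le> 1 - 1 + sqrt (card ?C * (\<Sum>w\<in>?C. (pmf ?P w)\<^sup>2) - 1\<^sup>2)"
    using C set_coord_walk[OF p k, of dir "s * real k"]
    by (intro tv_dist_le_subprob) (auto simp: sum_pmf_eq_1)
  also have "\<dots> \<le> sqrt (exp (real k * ?S\<^sup>2) - 1)"
    using chi by (simp add: card_carrier_Zpow[OF p0])
  finally show ?thesis .
qed

text \<open>The sum of \<open>h\<close> over the coordinates has mean \<open>k * \<rho>\<close>
  under the walk, 0 under the uniform law, and variance at most \<open>k\<close> under both;
  Chebyshev at the midpoint separates them. The separating set is counted inside p^k points, and
  comparing its image with a group of p^d points costs the factor p^(k - d).\<close>

lemma tv_ge_of_character_sum:
  assumes p: "p \<ge> 2" and k: "k > 0" and s: "s \<ge> 0" and dk: "d \<le> k"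
    and Z: "length Z = k" "set Z \<subseteq> carrier (Zpow p d)"
  shows "1 - (1 + real p ^ (k - d)) * (4 / (real k * exp (- 2 * s * rate p 1)))
     \<le> tv_to_uniform dir (Zpow p d) Z (s * real k)"
proof -
  let ?C = "carrier (Zpow p k)" and ?P = "coord_walk dir p k (s * real k)"
  define \<theta> where "\<theta> = 2 * pi / real p"
  define \<phi> where "\<phi> = s * Im (step_char dir p 1)"
  \<comment> \<open>Subtracting the accumulated drift \<phi> makes the mean under the walk equal to
    the positive number \<rho>, for the directed walk too.\<close>
  define h where "h x = cos (\<theta> * of_int x - \<phi>)" for x :: int
  define \<rho> where "\<rho> = exp (- s * rate p 1)"
  have \<rho>: "\<rho> > 0" by (simp add: \<rho>_def)
  have p0: "p > 0" and pr: "real p > 0" and kr: "real k > 0" using p k by simp_all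
  have C: "finite ?C" "?C \<noteq> {}" using p0 by (auto simp: carrier_Zpow PiE_eq_empty_iff finite_PiE)
  have h_char: "h x = Re (cyc_char p 1 x * cis (- \<phi>))" for x
    by (simp add: h_def cyc_char_def cis_mult \<theta>_def)
  have h1: "(h x)\<^sup>2 \<le> 1" for x by (simp add: h_def abs_square_le_1)
  define A where "A = {w \<in> ?C. real k * \<rho> / 2 \<le> (\<Sum>i<k. h (w i))}"
  define e where "e = 4 / (real k * \<rho>\<^sup>2)"
  have e: "real k * 1 / (real k * \<rho> / 2)\<^sup>2 = e" using kr \<rho> by (simp add: e_def power2_eq_square field_simps)
  have r: "real k * \<rho> / 2 > 0" using kr \<rho> by simp
  have finA: "finite A" using C by (simp add: A_def)
  have "1 - measure_pmf.prob ?P A \<le> e"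
  proof -
    have Eh: "(\<Sum>x\<in>{0..<int p}. heat dir p s x * h x) = \<rho>"
    proof -
      have "(\<Sum>x\<in>{0..<int p}. heat dir p s x * h x)
          = Re ((\<Sum>x\<in>{0..<int p}. of_real (heat dir p s x) * cyc_char p 1 x) * cis (- \<phi>))"
        by (simp add: sum_distrib_right Re_sum mult.assoc h_char)
      also have "(\<Sum>x\<in>{0..<int p}. of_real (heat dir p s x) * cyc_char p 1 x) * cis (- \<phi>)
          = of_real \<rho> * (cis \<phi> * cis (- \<phi>))"
        unfolding sum_heat_cyc_char[OF p s]
        by (simp add: exp_eq_polar step_char_Re rate_def \<phi>_def \<rho>_def algebra_simps)
      also have "cis \<phi> * cis (- \<phi>) = 1" by (simp add: cis_mult)
      finally show ?thesis by simp
    qed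
    have mean: "(\<Sum>x\<in>{0..<int p}. heat dir p s x * (h x - \<rho>)) = 0"
      by (simp add: right_diff_distrib sum_subtractf Eh sum_heat_mult_const[OF p])
    have var: "(\<Sum>x\<in>{0..<int p}. heat dir p s x * (h x - \<rho>)\<^sup>2) \<le> 1"
    proof -
      have "(\<Sum>x\<in>{0..<int p}. heat dir p s x * (h x - \<rho>)\<^sup>2)
         = (\<Sum>x\<in>{0..<int p}. heat dir p s x * (h x)\<^sup>2 - (2 * \<rho>) * (heat dir p s x * h x) + heat dir p s x * \<rho>\<^sup>2)"
        by (intro sum.cong refl) (simp add: power2_diff algebra_simps)
      also have "\<dots> = (\<Sum>x\<in>{0..<int p}. heat dir p s x * (h x)\<^sup>2) - (2 * \<rho>) * \<rho> + \<rho>\<^sup>2"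
        unfolding sum.distrib sum_subtractf sum_distrib_left[symmetric] Eh sum_heat_mult_const[OF p] ..
      also have "\<dots> \<le> (\<Sum>x\<in>{0..<int p}. heat dir p s x * (h x)\<^sup>2)"
        by (simp add: power2_eq_square)
      also have "\<dots> \<le> (\<Sum>x\<in>{0..<int p}. heat dir p s x * 1)" using h1 by (intro sum_mono mult_left_mono) auto
      also have "\<dots> = 1" by (rule sum_heat_mult_const[OF p])
      finally show ?thesis .
    qed
    have "1 = measure_pmf.prob ?P (UNIV \<inter> set_pmf ?P)" unfolding measure_Int_set_pmf by simp
    also have "\<dots> \<le> measure_pmf.prob ?P (A \<union> {w. real k * \<rho> / 2 \<le> \<bar>\<Sum>i<k. h (w i) - \<rho>\<bar>})"
    proof (intro measure_pmf.finite_measure_mono subsetI)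
      fix w assume "w \<in> UNIV \<inter> set_pmf ?P"
      then have "w \<in> ?C" using set_coord_walk[OF p k] by auto
      moreover have "(\<Sum>i<k. h (w i) - \<rho>) = (\<Sum>i<k. h (w i)) - real k * \<rho>" by (simp add: sum_subtractf)
      moreover have "a / 2 \<le> S \<or> a / 2 \<le> \<bar>S - a\<bar>" for a S :: real
        using abs_ge_minus_self[of "S - a"] by argo
      ultimately show "w \<in> A \<union> {w. real k * \<rho> / 2 \<le> \<bar>\<Sum>i<k. h (w i) - \<rho>\<bar>}"
        unfolding A_def by simp
    qed auto
    also have "\<dots> \<le> measure_pmf.prob ?P A + measure_pmf.prob ?P {w. real k * \<rho> / 2 \<le> \<bar>\<Sum>i<k. h (w i) - \<rho>\<bar>}"
      by (intro measure_Un_le) auto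
    also have "measure_pmf.prob ?P {w. real k * \<rho> / 2 \<le> \<bar>\<Sum>i<k. h (w i) - \<rho>\<bar>}
        \<le> real k * (\<Sum>x\<in>{0..<int p}. heat dir p s x * (h x - \<rho>)\<^sup>2) / (real k * \<rho> / 2)\<^sup>2"
      by (rule coord_walk_chebyshev[OF p k s r mean])
    also have "\<dots> \<le> real k * 1 / (real k * \<rho> / 2)\<^sup>2"
      using var by (intro divide_right_mono mult_left_mono) auto
    finally show ?thesis unfolding e by simp
  qed
  moreover have "real (card A) / real p ^ k \<le> e"
  proof -
    let ?U = "pmf_of_set {0..<int p}"
    have ne: "{0..<int p} \<noteq> {}" using p0 by simp
    have EU: "measure_pmf.expectation ?U f = (\<Sum>x\<in>{0..<int p}. f x) / real p" for f :: "int \<Rightarrow> real"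
      using p0 by (subst integral_pmf_of_set) auto
    have "(\<Sum>x\<in>{0..<int p}. h x) = Re ((\<Sum>x\<in>{0..<int p}. cyc_char p x 1) * cis (- \<phi>))"
      by (simp add: sum_distrib_right Re_sum h_char cyc_char_commute[of p 1])
    also have "\<dots> = 0" using p by (simp add: sum_cyc_char)
    finally have mean: "measure_pmf.expectation ?U h = 0" by (simp add: EU)
    have "(\<Sum>x\<in>{0..<int p}. (h x)\<^sup>2) \<le> (\<Sum>x\<in>{0..<int p}. 1)" using h1 by (intro sum_mono)
    then have var: "measure_pmf.expectation ?U (\<lambda>x. (h x)\<^sup>2) \<le> 1" using pr by (simp add: EU)
    have "real (card A) / real p ^ k = measure_pmf.prob (pmf_of_set ?C) A"
      using C by (simp add: measure_pmf_of_set A_def card_carrier_Zpow[OF p0] Int_absorb1 subset_iff)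
    also have "\<dots> \<le> measure_pmf.prob (pmf_of_set ?C) {w. real k * \<rho> / 2 \<le> \<bar>\<Sum>i<k. h (w i)\<bar>}"
      by (intro measure_pmf.finite_measure_mono) (auto simp: A_def intro: order.trans[OF _ abs_ge_self])
    also have "\<dots> \<le> card {..<k} * measure_pmf.expectation ?U (\<lambda>x. (h x)\<^sup>2) / (real k * \<rho> / 2)\<^sup>2"
      unfolding uniform_Zpow_eq_Pi_pmf[OF p0] using ne mean r by (intro Pi_pmf_chebyshev) auto
    also have "\<dots> \<le> real k * 1 / (real k * \<rho> / 2)\<^sup>2"
      using var by (intro divide_right_mono mult_mono) auto
    finally show ?thesis unfolding e .
  qed
  then have "real (card A) / real p ^ d \<le> real p ^ (k - d) * e"
  proof -
    assume "real (card A) / real p ^ k \<le> e"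
    then have "real p ^ (k - d) * (real (card A) / real p ^ k) \<le> real p ^ (k - d) * e"
      by (intro mult_left_mono) auto
    moreover have "real p ^ k = real p ^ (k - d) * real p ^ d" using dk by (simp add: power_add[symmetric])
    ultimately show ?thesis using pr by simp
  qed
  moreover have "1 - (1 + c) * e \<le> t" if "1 - a \<le> e" "b \<le> c * e" "a - b \<le> t" for a b c e t :: real
    using that by (simp add: distrib_right)
  ultimately have "1 - (1 + real p ^ (k - d)) * e \<le> tv_to_uniform dir (Zpow p d) Z (s * real k)"
    using prob_le_tv_to_uniform[OF p k Z finA, of dir "s * real k"] by blast
  moreover have "e = 4 / (real k * exp (- 2 * s * rate p 1))"
    by (simp add: e_def \<rho>_def exp_double[symmetric])
  ultimately show ?thesis by (rule subst[rotated])
qed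

text \<open>Induction on the sum of the representatives: a nonzero coordinate is lowered by one unit
  vector at a time, so inverses do not occur.\<close>

lemma carrier_Zpow_generated:
  assumes p: "p \<ge> 2" and S: "set (unit_vectors d) \<subseteq> S" "S \<subseteq> carrier (Zpow p d)"
  shows "generate (Zpow p d) S = carrier (Zpow p d)"
proof
  let ?G = "Zpow p d"
  interpret G: group ?G by simp
  have p0: "p > 0" using p by simp
  show "generate ?G S \<subseteq> carrier ?G" by (rule G.generate_incl[OF S(2)])
  have "w \<in> generate ?G S" if "w \<in> carrier ?G" for w
    using that
  proof (induction "\<Sum>i<d. nat (w i)" arbitrary: w rule: less_induct)
    case less
    have w: "0 \<le> w j" "w j < int p" if "j < d" for j
      using PiE_mem[of w "{..<d}" "\<lambda>_. {0..<int p}" j] less.prems that unfolding carrier_Zpow[OF p0] by simp_all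
    have ext: "w j = undefined" if "\<not> j < d" for j
      using less.prems that PiE_arb[of w "{..<d}"] unfolding carrier_Zpow[OF p0] by simp
    show ?case
    proof (cases "\<exists>i<d. w i \<noteq> 0")
      case False
      have "w = \<one>\<^bsub>?G\<^esub>"
      proof
        fix j show "w j = \<one>\<^bsub>?G\<^esub> j" using False ext by (cases "j < d") (simp_all add: one_Zpow)
      qed
      then show ?thesis by (rule ssubst) (rule generate.one)
    next
      case True
      then obtain i where i: "i < d" "w i \<noteq> 0" by blast
      then have wi: "0 < w i" "w i < int p" using w[of i] by simp_all
      define v where "v = w(i := w i - 1)"
      have v: "v \<in> carrier ?G" unfolding carrier_Zpow[OF p0]
      proof (rule PiE_I)
        fix j assume "j \<in> {..<d}"
        then show "v j \<in> {0..<int p}" using w[of j] wi by (simp add: v_def)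
      next
        fix j assume "j \<notin> {..<d}"
        then show "v j = undefined" using ext[of j] i by (auto simp: v_def)
      qed
      have "(\<Sum>j<d. nat (v j)) < (\<Sum>j<d. nat (w j))"
      proof (rule sum_strict_mono_ex1)
        show "\<forall>j\<in>{..<d}. nat (v j) \<le> nat (w j)" by (intro ballI nat_mono) (simp add: v_def)
        show "\<exists>j\<in>{..<d}. nat (v j) < nat (w j)" using i wi by (intro bexI[of _ i]) (simp_all add: v_def)
      qed simp
      from less.hyps[OF this v] have IH: "v \<in> generate ?G S" .
      have "unit_vectors d ! i \<in> set (unit_vectors d)" using i by (intro nth_mem) simp
      then have e: "unit_vectors d ! i \<in> generate ?G S" using S(1) by (blast intro: generate.incl)
      have "w = v \<otimes>\<^bsub>?G\<^esub> (unit_vectors d ! i)"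
      proof
        fix j
        show "w j = (v \<otimes>\<^bsub>?G\<^esub> (unit_vectors d ! i)) j"
        proof (cases "j < d")
          case True
          have "(v \<otimes>\<^bsub>?G\<^esub> (unit_vectors d ! i)) j = (v j + (if j = i then 1 else 0)) mod int p"
            using True by (simp add: mult_Zpow nth_unit_vectors[OF i(1)])
          also have "v j + (if j = i then 1 else 0) = w j" by (simp add: v_def)
          also have "w j mod int p = w j" using w[OF True] by (rule mod_pos_pos_trivial)
          finally show ?thesis by (rule sym)
        next
          case False
          then show ?thesis by (simp add: mult_Zpow ext)
        qed
      qed
      then show ?thesis by (rule ssubst) (rule generate.eng[OF IH e])
    qed
  qed
  then show "carrier ?G \<subseteq> generate ?G S" by blast
qed

text \<open>Ensures that the conditioning event has positive probability, without which
  \<open>cond_pmf\<close> says nothing. The witness is the list of unit vectors padded with the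
  identity.\<close>

lemma generating_possible:
  assumes p: "p \<ge> 2" and dk: "d \<le> k"
  shows "set_pmf (random_generators (Zpow p d) k) \<inter> generating (Zpow p d) \<noteq> {}"
proof -
  let ?G = "Zpow p d"
  have p0: "p > 0" using p by simp
  have ne: "carrier ?G \<noteq> {}" using p0 by (simp add: carrier_Zpow PiE_eq_empty_iff)
  interpret G: group ?G by simp
  define Z where "Z = unit_vectors d @ replicate (k - d) \<one>\<^bsub>?G\<^esub>"
  have Z: "length Z = k" "set (unit_vectors d) \<subseteq> set Z" "set Z \<subseteq> carrier ?G"
    using dk set_unit_vectors[OF p, of d] by (auto simp: Z_def)
  then have "Z \<in> generating ?G" using carrier_Zpow_generated[OF p Z(2,3)] by (simp add: generating_def)
  moreover have "Z \<in> set_pmf (random_generators ?G k)"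
    using Z ne p0 by (auto simp: random_generators_def set_replicate_pmf set_pmf_of_set)
  ultimately show ?thesis by blast
qed

subsection \<open>Cutoff at the entropic time\<close>

text \<open>Divergence of \<Gamma> removes the collision term, and \<open>ratio\<close> says that
  the gap exceeds the fluctuations. Both the cutoff and its window reduce to these two
  conditions.\<close>

lemma entropy_gap_upper:
  fixes p d k :: "nat \<Rightarrow> nat" and s :: "nat \<Rightarrow> real" and dir :: orientation
  defines "r \<equiv> \<lambda>N. deficit dir (p N) (s N)"
  defines "\<Gamma> \<equiv> \<lambda>N. real (k N) * (zeta (p N) (d N) (k N) - r N)"
  assumes p: "\<forall>N. prime (p N)" and k: "\<forall>\<^sub>F N in sequentially. k N > 0"
    and s: "\<forall>\<^sub>F N in sequentially. s N \<ge> 0"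
    and \<Gamma>: "filterlim \<Gamma> at_top sequentially"
    and ratio: "(\<lambda>N. real (k N) * min 1 (r N) / (\<Gamma> N)\<^sup>2) \<longlonglongrightarrow> 0"
  shows "tendsto_in_prob (\<lambda>N. random_generators (Zpow (p N) (d N)) (k N))
      (\<lambda>N Z. tv_to_uniform dir (Zpow (p N) (d N)) Z (s N * real (k N))) 0"
proof -
  obtain C where C: "C > 0" "\<And>dir p s. p \<ge> 2 \<Longrightarrow> s \<ge> 0 \<Longrightarrow>
     (\<Sum>x\<in>{0..<int p}. heat dir p s x * (ln (heat dir p s x) + heat_entropy dir p s)\<^sup>2)
       \<le> C * min 1 (deficit dir p s)"
    using varentropy_le by blast
  have p2: "p N \<ge> 2" for N using p prime_ge_2_nat by blast
  show ?thesis
  proof (rule tendsto_in_prob_0I[where a = "\<lambda>N. 4 * C * (real (k N) * min 1 (r N) / (\<Gamma> N)\<^sup>2)"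
        and e = "\<lambda>N. exp (- \<Gamma> N / 2)"])
    fix \<delta> :: real assume \<delta>: "\<delta> > 0"
    show "\<forall>\<^sub>F N in sequentially. measure_pmf.prob (random_generators (Zpow (p N) (d N)) (k N))
        {\<omega>. tv_to_uniform dir (Zpow (p N) (d N)) \<omega> (s N * real (k N)) > 4 * C * (real (k N) * min 1 (r N) / (\<Gamma> N)\<^sup>2) + \<delta>}
        \<le> exp (- \<Gamma> N / 2) / \<delta>\<^sup>2"
      using k s filterlim_at_top_dense[THEN iffD1, OF \<Gamma>, rule_format, of 0]
    proof eventually_elim
      case (elim N)
      show ?case unfolding r_def
      proof (rule upper_bound[where p = "p N" and k = "k N" and d = "d N" and s = "s N" and dir = dir])
        show "prime (p N)" using p by blast
        show "\<Gamma> N = real (k N) * (zeta (p N) (d N) (k N) - deficit dir (p N) (s N))" by (simp add: \<Gamma>_def r_def)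
      qed (use elim \<delta> C(2)[OF p2] in auto)
    qed
  next
    show "(\<lambda>N. 4 * C * (real (k N) * min 1 (r N) / (\<Gamma> N)\<^sup>2)) \<longlonglongrightarrow> 0"
      using tendsto_mult_left[OF ratio, of "4 * C"] by simp
    have "((\<lambda>x :: real. exp (- x / 2)) \<longlongrightarrow> 0) at_top" by real_asymp
    then show "(\<lambda>N. exp (- \<Gamma> N / 2)) \<longlonglongrightarrow> 0" by (rule filterlim_compose[OF _ \<Gamma>])
  qed (simp add: tv_to_uniform_bounds)
qed

text \<open>The error sequence \<open>b\<close> is chosen before the generators, so it serves
  convergence in probability and the deterministic claim alike.\<close>

lemma entropy_gap_lower:
  fixes p d k :: "nat \<Rightarrow> nat" and s :: "nat \<Rightarrow> real" and dir :: orientation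
  defines "r \<equiv> \<lambda>N. deficit dir (p N) (s N)"
  defines "\<Gamma> \<equiv> \<lambda>N. real (k N) * (r N - zeta (p N) (d N) (k N))"
  assumes p: "\<forall>N. prime (p N)" and k: "\<forall>\<^sub>F N in sequentially. k N > 0"
    and s: "\<forall>\<^sub>F N in sequentially. s N \<ge> 0"
    and \<Gamma>: "filterlim \<Gamma> at_top sequentially"
    and ratio: "(\<lambda>N. real (k N) * min 1 (r N) / (\<Gamma> N)\<^sup>2) \<longlonglongrightarrow> 0"
  shows "\<exists>b. b \<longlonglongrightarrow> 0 \<and> (\<forall>\<^sub>F N in sequentially. \<forall>Z. length Z = k N \<longrightarrow> set Z \<subseteq> carrier (Zpow (p N) (d N)) \<longrightarrow>
      \<bar>tv_to_uniform dir (Zpow (p N) (d N)) Z (s N * real (k N)) - 1\<bar> \<le> b N)"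
proof -
  obtain C where C: "C > 0" "\<And>dir p s. p \<ge> 2 \<Longrightarrow> s \<ge> 0 \<Longrightarrow>
     (\<Sum>x\<in>{0..<int p}. heat dir p s x * (ln (heat dir p s x) + heat_entropy dir p s)\<^sup>2)
       \<le> C * min 1 (deficit dir p s)"
    using varentropy_le by blast
  have p2: "p N \<ge> 2" for N using p prime_ge_2_nat by blast
  define b where "b N = 4 * C * (real (k N) * min 1 (r N) / (\<Gamma> N)\<^sup>2) + exp (- \<Gamma> N / 2)" for N
  have "((\<lambda>x :: real. exp (- x / 2)) \<longlongrightarrow> 0) at_top" by real_asymp
  from filterlim_compose[OF this \<Gamma>] tendsto_mult_left[OF ratio, of "4 * C"]
  have "(\<lambda>N. 4 * C * (real (k N) * min 1 (r N) / (\<Gamma> N)\<^sup>2) + exp (- \<Gamma> N / 2)) \<longlonglongrightarrow> 4 * C * 0 + 0"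
    by (intro tendsto_add)
  then have "b \<longlonglongrightarrow> 0" by (simp add: b_def[abs_def])
  moreover have "\<forall>\<^sub>F N in sequentially. \<forall>Z. length Z = k N \<longrightarrow> set Z \<subseteq> carrier (Zpow (p N) (d N)) \<longrightarrow>
      \<bar>tv_to_uniform dir (Zpow (p N) (d N)) Z (s N * real (k N)) - 1\<bar> \<le> b N"
    using k s filterlim_at_top_dense[THEN iffD1, OF \<Gamma>, rule_format, of 0]
  proof eventually_elim
    case (elim N)
    show ?case
    proof (intro allI impI)
      fix Z :: "(nat \<Rightarrow> int) list"
      assume Z: "length Z = k N" "set Z \<subseteq> carrier (Zpow (p N) (d N))"
      have "1 - b N \<le> tv_to_uniform dir (Zpow (p N) (d N)) Z (s N * real (k N))"
        unfolding b_def r_def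
      proof (rule lower_bound[where p = "p N" and k = "k N" and d = "d N" and s = "s N" and dir = dir])
        show "prime (p N)" using p by blast
        show "\<Gamma> N = real (k N) * (deficit dir (p N) (s N) - zeta (p N) (d N) (k N))" by (simp add: \<Gamma>_def r_def)
      qed (use elim Z C(2)[OF p2] in auto)
      then show "\<bar>tv_to_uniform dir (Zpow (p N) (d N)) Z (s N * real (k N)) - 1\<bar> \<le> b N"
        using tv_to_uniform_bounds(2)[of dir "Zpow (p N) (d N)" Z "s N * real (k N)"] by (simp add: abs_if)
    qed
  qed
  ultimately show ?thesis by blast
qed

lemma tendsto_in_prob_cong:
  assumes "tendsto_in_prob P Y c" "\<forall>\<^sub>F N in sequentially. X N = Y N"
  shows "tendsto_in_prob P X c"
proof -
  have "((\<lambda>N. measure_pmf.prob (P N) {\<omega>. \<bar>X N \<omega> - c\<bar> > \<delta>}) \<longlonglongrightarrow> 0)" if "\<delta> > 0" for \<delta>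
  proof (rule Lim_transform_eventually)
    show "(\<lambda>N. measure_pmf.prob (P N) {\<omega>. \<bar>Y N \<omega> - c\<bar> > \<delta>}) \<longlonglongrightarrow> 0"
      using assms(1) that by (simp add: tendsto_in_prob_def)
    show "\<forall>\<^sub>F N in sequentially. measure_pmf.prob (P N) {\<omega>. \<bar>Y N \<omega> - c\<bar> > \<delta>} = measure_pmf.prob (P N) {\<omega>. \<bar>X N \<omega> - c\<bar> > \<delta>}"
      using assms(2) by eventually_elim simp
  qed
  then show ?thesis by (simp add: tendsto_in_prob_def)
qed

text \<open>The gap is of order \<open>v = k * min 1 r\<close> for multiplicative perturbations of the time, and
  any such gap exceeds the fluctuations of order \<open>sqrt v\<close>.\<close>

lemma gap_of_linear_bound:
  fixes v \<Gamma> :: "nat \<Rightarrow> real"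
  assumes v: "filterlim v at_top sequentially" and \<kappa>: "\<kappa> > 0"
    and le: "\<forall>\<^sub>F N in sequentially. \<kappa> * v N \<le> \<Gamma> N"
    and w: "\<forall>\<^sub>F N in sequentially. 0 \<le> w N \<and> w N \<le> v N"
  shows "filterlim \<Gamma> at_top sequentially" "(\<lambda>N. w N / (\<Gamma> N)\<^sup>2) \<longlonglongrightarrow> 0"
proof -
  have "filterlim (\<lambda>N. \<kappa> * v N) at_top sequentially"
    using filterlim_tendsto_pos_mult_at_top[OF tendsto_const \<kappa> v] by simp
  then show "filterlim \<Gamma> at_top sequentially" by (rule filterlim_at_top_mono[OF _ le])
  show "(\<lambda>N. w N / (\<Gamma> N)\<^sup>2) \<longlonglongrightarrow> 0"
  proof (rule tendsto_sandwich[where f = "\<lambda>_. 0" and h = "\<lambda>N. inverse (\<kappa>\<^sup>2 * v N)"])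
    show "\<forall>\<^sub>F N in sequentially. 0 \<le> w N / (\<Gamma> N)\<^sup>2" using w by eventually_elim auto
    show "\<forall>\<^sub>F N in sequentially. w N / (\<Gamma> N)\<^sup>2 \<le> inverse (\<kappa>\<^sup>2 * v N)"
      using w le filterlim_at_top_dense[THEN iffD1, OF v, rule_format, of 0]
    proof eventually_elim
      case (elim N)
      have "(\<kappa> * v N)\<^sup>2 \<le> (\<Gamma> N)\<^sup>2" using elim \<kappa> by (intro power_mono) auto
      moreover have "(\<kappa> * v N)\<^sup>2 > 0" using elim \<kappa> by simp
      ultimately have "w N / (\<Gamma> N)\<^sup>2 \<le> v N / (\<kappa> * v N)\<^sup>2" using elim by (intro frac_le) auto
      also have "\<dots> = inverse (\<kappa>\<^sup>2 * v N)" using elim \<kappa> by (simp add: field_simps power2_eq_square)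
      finally show ?case .
    qed
    have "filterlim (\<lambda>N. \<kappa>\<^sup>2 * v N) at_top sequentially"
      using filterlim_tendsto_pos_mult_at_top[OF tendsto_const _ v, of "\<kappa>\<^sup>2"] \<kappa> by simp
    then show "(\<lambda>N. inverse (\<kappa>\<^sup>2 * v N)) \<longlonglongrightarrow> 0" by (rule tendsto_inverse_0_at_top)
  qed auto
qed

section \<open>Entropic times along the sequence\<close>

lemma entropic_time_eq:
  assumes "p \<ge> 2" "k > 0" "entropic_time_defined p d k \<alpha>"
  shows "\<exists>s\<ge>0. deficit dir p s = zeta_shift p d k \<alpha> \<and> entropic_time dir p d k \<alpha> = s * real k"
  using the_inv_rel_entropy[OF assms(1,2), of "zeta_shift p d k \<alpha>" dir] assms(3)
  unfolding entropic_time_defined_def entropic_time_def by blast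

lemma entropic_time_sequence:
  fixes p d k :: "nat \<Rightarrow> nat" and \<alpha> :: "nat \<Rightarrow> real" and dir :: orientation
  assumes "\<And>N. p N \<ge> 2"
  shows "\<exists>s. \<forall>N. k N > 0 \<longrightarrow> entropic_time_defined (p N) (d N) (k N) (\<alpha> N) \<longrightarrow>
      s N \<ge> 0 \<and> deficit dir (p N) (s N) = zeta_shift (p N) (d N) (k N) (\<alpha> N) \<and>
      entropic_time dir (p N) (d N) (k N) (\<alpha> N) = s N * real (k N)"
proof -
  let ?Q = "\<lambda>N s. k N > 0 \<longrightarrow> entropic_time_defined (p N) (d N) (k N) (\<alpha> N) \<longrightarrow>
      s \<ge> 0 \<and> deficit dir (p N) s = zeta_shift (p N) (d N) (k N) (\<alpha> N) \<and>
      entropic_time dir (p N) (d N) (k N) (\<alpha> N) = s * real (k N)"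
  have "\<exists>s. ?Q N s" for N
  proof (cases "k N > 0 \<and> entropic_time_defined (p N) (d N) (k N) (\<alpha> N)")
    case True
    from entropic_time_eq[OF assms[of N] conjunct1[OF True] conjunct2[OF True], of dir]
    obtain s where "?Q N s" by auto
    then show ?thesis by (rule exI)
  next
    case False
    then show ?thesis by auto
  qed
  then have "\<forall>N. \<exists>s. ?Q N s" by (rule allI)
  from choice[OF this] show ?thesis .
qed

lemma zeta_shift_0: "zeta_shift p d k 0 = zeta p d k"
  by (simp add: zeta_shift_def)

text \<open>Since z / max z 1 = min 1 z, the normalisation in \<open>zeta_shift\<close> measures the
  gap in units of the fluctuations.\<close>

lemma zeta_shift_gap:
  assumes "k > 0" "zeta p d k > 0"
  shows "real k * (zeta p d k - zeta_shift p d k \<alpha>) = 2 * \<alpha> * sqrt (real k * min 1 (zeta p d k))"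
proof -
  define z where "z = zeta p d k"
  have z: "z > 0" and kr: "real k > 0" using assms by (auto simp: z_def)
  have m: "min 1 z = z / max z 1" using z by (auto simp: min_def max_def)
  define y where "y = z * real k"
  have y: "y > 0" using z kr by (simp add: y_def)
  have "real k * (z - z * (1 - 2 * \<alpha> / sqrt (z * real k * max z 1))) = 2 * \<alpha> * (y / (sqrt y * sqrt (max z 1)))"
    by (simp add: y_def algebra_simps real_sqrt_mult)
  also have "y / (sqrt y * sqrt (max z 1)) = (y / sqrt y) / sqrt (max z 1)" by simp
  also have "y / sqrt y = sqrt y" using y by (simp only: real_div_sqrt)
  also have "sqrt y / sqrt (max z 1) = sqrt (real k * min 1 z)"
    unfolding m y_def by (simp add: real_sqrt_divide[symmetric] mult.commute)
  finally show ?thesis by (simp add: zeta_shift_def z_def)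
qed

lemma zeta_basic:
  assumes "p \<ge> 2" "d > 0" "d < k"
  shows "zeta p d k > 0" "zeta p d k \<le> ln (real p)" "ln (real p) - zeta p d k = real d * ln (real p) / real k"
proof -
  have l: "ln (real p) > 0" using assms by simp
  show "zeta p d k > 0" using assms l by (simp add: zeta_def)
  show eq: "ln (real p) - zeta p d k = real d * ln (real p) / real k"
    using assms by (simp add: zeta_def field_simps)
  have "real d * ln (real p) / real k \<ge> 0" using l by simp
  then show "zeta p d k \<le> ln (real p)" using eq by simp
qed

text \<open>Here k zeta = (k - d) ln p. Either \<open>ln p\<close> is large by itself, or
  \<open>p\<close> is bounded and then \<open>k - d\<close> has to be large; the minimum with 1 is
  covered by the growth of \<open>k\<close>.\<close>

lemma filterlim_k_zeta:
  fixes p d k :: "nat \<Rightarrow> nat"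
  assumes p: "\<And>N. p N \<ge> 2" and k: "filterlim k at_top sequentially"
    and dk: "\<forall>\<^sub>F N in sequentially. d N < k N"
    and lim: "filterlim (\<lambda>N. (real (k N) - real (d N)) * real (p N)) at_top sequentially"
  shows "filterlim (\<lambda>N. real (k N) * min 1 (zeta (p N) (d N) (k N))) at_top sequentially"
  unfolding filterlim_at_top
proof
  fix B :: real
  define B' where "B' = max B 1"
  have B': "B' \<ge> 1" "B \<le> B'" by (simp_all add: B'_def)
  have kr: "\<forall>\<^sub>F N in sequentially. B' \<le> real (k N)"
    using filterlim_compose[OF filterlim_real_sequentially k] by (simp add: filterlim_at_top)
  \<comment> \<open>Dividing by p <= exp B' leaves k - d >= B' / ln 2, and ln p >= ln 2 gives back
    B'.\<close>
  have "\<forall>\<^sub>F N in sequentially. exp B' * (B' / ln 2) \<le> (real (k N) - real (d N)) * real (p N)"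
    using lim by (simp add: filterlim_at_top)
  then show "\<forall>\<^sub>F N in sequentially. B \<le> real (k N) * min 1 (zeta (p N) (d N) (k N))"
    using kr dk
  proof eventually_elim
    case (elim N)
    have k0: "k N > 0" using elim by simp
    have m1: "real (k N) - real (d N) \<ge> 1" using elim(3) by (simp add: nat_less_real_le)
    have l2: "ln 2 \<le> ln (real (p N))" "ln 2 > (0::real)" using p[of N] by (auto intro!: ln_mono)
    have "B' \<le> (real (k N) - real (d N)) * ln (real (p N))"
    proof (cases "B' \<le> ln (real (p N))")
      case True
      have "B' = 1 * B'" by simp
      also have "\<dots> \<le> (real (k N) - real (d N)) * ln (real (p N))" using m1 True B' by (intro mult_mono) auto
      finally show ?thesis .
    next
      case False
      have "real (p N) \<le> exp B'" using False p[of N] by (metis exp_le_cancel_iff exp_ln linear of_nat_0_less_iff order_less_le_trans zero_less_numeral)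
      then have "(real (k N) - real (d N)) * real (p N) \<le> (real (k N) - real (d N)) * exp B'"
        using m1 by (intro mult_left_mono) auto
      then have "exp B' * (B' / ln 2) \<le> exp B' * (real (k N) - real (d N))" using elim(1) by (simp add: mult.commute)
      then have "B' / ln 2 \<le> real (k N) - real (d N)"
        by (simp only: mult_le_cancel_left_pos[OF exp_gt_zero])
      then have "B' \<le> (real (k N) - real (d N)) * ln 2" using l2 by (simp add: divide_le_eq)
      also have "\<dots> \<le> (real (k N) - real (d N)) * ln (real (p N))" using m1 l2 by (intro mult_left_mono) auto
      finally show ?thesis .
    qed
    then have "B' \<le> real (k N) * zeta (p N) (d N) (k N)" by (simp add: zeta_mult[OF k0])
    then show ?case using elim(2) B' by (simp add: min_def)
  qed
qed

text \<open>The hypothesis \<open>k \<lesssim> d log p\<close> keeps the entropic time per coordinate away from \<open>0\<close>.\<close>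

lemma entropy_cutoff:
  fixes p d k :: "nat \<Rightarrow> nat" and dir :: orientation
  assumes prime_p: "\<forall>N. prime (p N)"
    and d0: "\<forall>\<^sub>F N in sequentially. d N > 0"
    and k: "filterlim k at_top sequentially"
    and k_bound: "(\<lambda>N. real (k N)) \<in> O(\<lambda>N. real (d N) * ln (real (p N)))"
    and dk: "\<forall>\<^sub>F N in sequentially. d N < k N"
    and lim: "filterlim (\<lambda>N. (real (k N) - real (d N)) * real (p N)) at_top sequentially"
  shows "cutoff_whp (\<lambda>N. random_generators (Zpow (p N) (d N)) (k N))
      (\<lambda>N. tv_to_uniform dir (Zpow (p N) (d N))) (\<lambda>N. entropic_time dir (p N) (d N) (k N) 0)"
  unfolding cutoff_whp_def
proof
  fix \<epsilon> :: real assume \<epsilon>: "\<epsilon> \<in> {0<..<1}"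
  have p: "p N \<ge> 2" for N using prime_p prime_ge_2_nat by blast
  let ?z = "\<lambda>N. zeta (p N) (d N) (k N)"
  obtain s where s': "\<And>N. k N > 0 \<Longrightarrow> entropic_time_defined (p N) (d N) (k N) 0 \<Longrightarrow>
      s N \<ge> 0 \<and> deficit dir (p N) (s N) = zeta_shift (p N) (d N) (k N) 0 \<and>
      entropic_time dir (p N) (d N) (k N) 0 = s N * real (k N)"
    using entropic_time_sequence[of p k d "\<lambda>_. 0" dir] p by blast
  have s: "s N \<ge> 0 \<and> deficit dir (p N) (s N) = ?z N \<and> entropic_time dir (p N) (d N) (k N) 0 = s N * real (k N)"
    if "d N > 0" "d N < k N" for N
    using s'[of N] zeta_basic[OF p that] that by (simp add: entropic_time_defined_def zeta_shift_0)
  obtain C where C: "C > 0" "\<forall>\<^sub>F N in sequentially. norm (real (k N)) \<le> C * norm (real (d N) * ln (real (p N)))"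
    using landau_o.bigE[OF k_bound] by metis
  \<comment> \<open>Entropy at least 1 / C per coordinate forces this much time, by
    \<open>time_ge_of_entropy_ge\<close>.\<close>
  define c0 where "c0 = min 1 ((1 / C / 200)\<^sup>2)"
  have c0: "c0 > 0" using C by (simp add: c0_def)
  have s_ge: "\<forall>\<^sub>F N in sequentially. s N \<ge> c0"
    using C(2) d0 dk
  proof eventually_elim
    case (elim N)
    have l: "ln (real (p N)) > 0" and kr: "real (k N) > 0" using p[of N] elim by auto
    have "1 / C \<le> real (d N) * ln (real (p N)) / real (k N)"
      using elim(1) l kr C(1) by (simp add: field_simps)
    also have "\<dots> = heat_entropy dir (p N) (s N)"
    proof -
      have "ln (real (p N)) - heat_entropy dir (p N) (s N) = ?z N"
        using s[OF elim(2,3)] by (simp add: deficit_def)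
      then show ?thesis using zeta_basic(3)[OF p[of N] elim(2,3)] by argo
    qed
    finally show ?case unfolding c0_def
      using s[OF elim(2,3)] C(1) by (intro time_ge_of_entropy_ge[OF p[of N], of "s N" "1 / C" dir]) auto
  qed
  have v: "filterlim (\<lambda>N. real (k N) * min 1 (?z N)) at_top sequentially"
    by (rule filterlim_k_zeta[OF p k dk lim])
  have k0: "\<forall>\<^sub>F N in sequentially. k N > 0" using dk by eventually_elim simp
  have upper: "tendsto_in_prob (\<lambda>N. random_generators (Zpow (p N) (d N)) (k N))
      (\<lambda>N Z. tv_to_uniform dir (Zpow (p N) (d N)) Z ((1 + \<epsilon>) * s N * real (k N))) 0"
  proof -
    obtain \<kappa> where \<kappa>: "\<kappa> > 0" "\<And>dir p s. p \<ge> 2 \<Longrightarrow> s \<ge> c0 \<Longrightarrow>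
        \<kappa> * min 1 (deficit dir p s) \<le> deficit dir p s - deficit dir p ((1 + \<epsilon>) * s)"
      using deficit_drop[of \<epsilon> c0] c0 \<epsilon> by auto
    define \<Gamma> where "\<Gamma> N = real (k N) * (?z N - deficit dir (p N) ((1 + \<epsilon>) * s N))" for N
    have 1: "\<forall>\<^sub>F N in sequentially. \<kappa> * (real (k N) * min 1 (?z N)) \<le> \<Gamma> N"
      using s_ge d0 dk
    proof eventually_elim
      case (elim N)
      have "real (k N) * (\<kappa> * min 1 (?z N)) \<le> \<Gamma> N"
        unfolding \<Gamma>_def using \<kappa>(2)[OF p[of N] elim(1), of dir] s[OF elim(2,3)] by (intro mult_left_mono) auto
      then show ?case by (simp add: mult.left_commute)
    qed
    have 2: "\<forall>\<^sub>F N in sequentially. 0 \<le> real (k N) * min 1 (deficit dir (p N) ((1 + \<epsilon>) * s N)) \<and>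
        real (k N) * min 1 (deficit dir (p N) ((1 + \<epsilon>) * s N)) \<le> real (k N) * min 1 (?z N)"
      using s_ge d0 dk
    proof eventually_elim
      case (elim N)
      have sp: "s N > 0" using elim(1) c0 by linarith
      then have "s N < (1 + \<epsilon>) * s N" using \<epsilon> by (simp add: distrib_right)
      then have "deficit dir (p N) ((1 + \<epsilon>) * s N) \<le> ?z N"
        using deficit_strict_antimono[OF p[of N], of "s N" "(1 + \<epsilon>) * s N" dir] s[OF elim(2,3)] by auto
      then show ?case using deficit_nonneg[OF p[of N], of dir "(1 + \<epsilon>) * s N"]
        by (intro conjI mult_nonneg_nonneg mult_left_mono) (auto simp: min_def)
    qed
    note G = gap_of_linear_bound[OF v \<kappa>(1) 1 2]
    have "\<forall>\<^sub>F N in sequentially. (1 + \<epsilon>) * s N \<ge> 0" using s_ge by eventually_elim (use c0 \<epsilon> in auto)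
    then show ?thesis
      by (intro entropy_gap_upper prime_p k0) (use G in \<open>simp_all add: \<Gamma>_def[abs_def]\<close>)
  qed
  have lower: "\<exists>b. b \<longlonglongrightarrow> 0 \<and> (\<forall>\<^sub>F N in sequentially. \<forall>Z. length Z = k N \<longrightarrow> set Z \<subseteq> carrier (Zpow (p N) (d N)) \<longrightarrow>
      \<bar>tv_to_uniform dir (Zpow (p N) (d N)) Z ((1 - \<epsilon>) * s N * real (k N)) - 1\<bar> \<le> b N)"
  proof -
    \<comment> \<open>The drop is measured from the earlier time
      \<open>(1 - \<epsilon>) * s N\<close>, and \<open>1 + \<eta>\<close> leads from there to
      \<open>s N\<close>.\<close>
    define \<eta> where "\<eta> = 1 / (1 - \<epsilon>) - 1"
    have \<eta>: "\<eta> > 0" "(1 + \<eta>) * ((1 - \<epsilon>) * x) = x" for x using \<epsilon> by (auto simp: \<eta>_def field_simps)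
    have c1: "(1 - \<epsilon>) * c0 > 0" using c0 \<epsilon> by simp
    obtain \<kappa> where \<kappa>: "\<kappa> > 0" "\<And>dir p s. p \<ge> 2 \<Longrightarrow> s \<ge> (1 - \<epsilon>) * c0 \<Longrightarrow>
        \<kappa> * min 1 (deficit dir p s) \<le> deficit dir p s - deficit dir p ((1 + \<eta>) * s)"
      using deficit_drop[OF \<eta>(1) c1] by auto
    let ?r = "\<lambda>N. deficit dir (p N) ((1 - \<epsilon>) * s N)"
    define \<Gamma> where "\<Gamma> N = real (k N) * (?r N - ?z N)" for N
    have v': "filterlim (\<lambda>N. real (k N) * min 1 (?r N)) at_top sequentially"
    proof (rule filterlim_at_top_mono[OF v])
      show "\<forall>\<^sub>F N in sequentially. real (k N) * min 1 (?z N) \<le> real (k N) * min 1 (?r N)"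
        using s_ge d0 dk
      proof eventually_elim
        case (elim N)
        have sp: "s N > 0" using elim(1) c0 by linarith
        then have "(1 - \<epsilon>) * s N < s N" "0 \<le> (1 - \<epsilon>) * s N" using \<epsilon> by (auto simp: left_diff_distrib)
        then have "?z N \<le> ?r N"
          using deficit_strict_antimono[OF p[of N], of "(1 - \<epsilon>) * s N" "s N" dir] s[OF elim(2,3)] by auto
        then show ?case by (intro mult_left_mono) auto
      qed
    qed
    have 1: "\<forall>\<^sub>F N in sequentially. \<kappa> * (real (k N) * min 1 (?r N)) \<le> \<Gamma> N"
      using s_ge d0 dk
    proof eventually_elim
      case (elim N)
      have "(1 - \<epsilon>) * c0 \<le> (1 - \<epsilon>) * s N" using elim \<epsilon> by (intro mult_left_mono) auto
      then have "\<kappa> * min 1 (?r N) \<le> ?r N - ?z N"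
        using \<kappa>(2)[OF p[of N], of "(1 - \<epsilon>) * s N" dir] s[OF elim(2,3)] by (simp add: \<eta>(2))
      then have "real (k N) * (\<kappa> * min 1 (?r N)) \<le> \<Gamma> N"
        unfolding \<Gamma>_def by (intro mult_left_mono) auto
      then show ?case by (simp add: mult.left_commute)
    qed
    have 2: "\<forall>\<^sub>F N in sequentially. 0 \<le> real (k N) * min 1 (?r N) \<and> real (k N) * min 1 (?r N) \<le> real (k N) * min 1 (?r N)"
      using deficit_nonneg[OF p] by (intro always_eventually allI conjI mult_nonneg_nonneg) auto
    note G = gap_of_linear_bound[OF v' \<kappa>(1) 1 2]
    have "\<forall>\<^sub>F N in sequentially. (1 - \<epsilon>) * s N \<ge> 0" using s_ge by eventually_elim (use c0 \<epsilon> in auto)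
    then show ?thesis
      by (intro entropy_gap_lower prime_p k0) (use G in \<open>simp_all add: \<Gamma>_def[abs_def]\<close>)
  qed
  have time: "\<forall>\<^sub>F N in sequentially. \<forall>a. a * entropic_time dir (p N) (d N) (k N) 0 = a * s N * real (k N)"
    using d0 dk by eventually_elim (simp add: s mult.assoc)
  show "tendsto_in_prob (\<lambda>N. random_generators (Zpow (p N) (d N)) (k N))
        (\<lambda>N \<omega>. tv_to_uniform dir (Zpow (p N) (d N)) \<omega> ((1 + \<epsilon>) * entropic_time dir (p N) (d N) (k N) 0)) 0 \<and>
     tendsto_in_prob (\<lambda>N. random_generators (Zpow (p N) (d N)) (k N))
        (\<lambda>N \<omega>. tv_to_uniform dir (Zpow (p N) (d N)) \<omega> ((1 - \<epsilon>) * entropic_time dir (p N) (d N) (k N) 0)) 1"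
  proof
    show "tendsto_in_prob (\<lambda>N. random_generators (Zpow (p N) (d N)) (k N))
        (\<lambda>N \<omega>. tv_to_uniform dir (Zpow (p N) (d N)) \<omega> ((1 + \<epsilon>) * entropic_time dir (p N) (d N) (k N) 0)) 0"
      by (rule tendsto_in_prob_cong[OF upper], rule eventually_mono[OF time]) (simp only:)
    obtain b where b: "b \<longlonglongrightarrow> 0" "\<forall>\<^sub>F N in sequentially. \<forall>Z. length Z = k N \<longrightarrow> set Z \<subseteq> carrier (Zpow (p N) (d N)) \<longrightarrow>
      \<bar>tv_to_uniform dir (Zpow (p N) (d N)) Z ((1 - \<epsilon>) * s N * real (k N)) - 1\<bar> \<le> b N"
      using lower by blast
    show "tendsto_in_prob (\<lambda>N. random_generators (Zpow (p N) (d N)) (k N))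
        (\<lambda>N \<omega>. tv_to_uniform dir (Zpow (p N) (d N)) \<omega> ((1 - \<epsilon>) * entropic_time dir (p N) (d N) (k N) 0)) 1"
    proof (rule tendsto_in_prob_deterministic[OF _ b(1)])
      show "\<forall>\<^sub>F N in sequentially. \<forall>\<omega>\<in>set_pmf (random_generators (Zpow (p N) (d N)) (k N)).
         \<bar>tv_to_uniform dir (Zpow (p N) (d N)) \<omega> ((1 - \<epsilon>) * entropic_time dir (p N) (d N) (k N) 0) - 1\<bar> \<le> b N"
        using b(2) time
      proof eventually_elim
        case (elim N)
        have p0: "p N > 0" using p[of N] by simp
        have t: "(1 - \<epsilon>) * entropic_time dir (p N) (d N) (k N) 0 = (1 - \<epsilon>) * s N * real (k N)"
          using elim(2) by (rule spec)
        show ?case unfolding t using elim(1) set_random_generators[OF p0] by blast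
      qed
    qed
  qed
qed

text \<open>The quotient splits into v / \<Gamma>^2 = 1 / (4 \<beta>^2) and 1 / \<Gamma>. The
  summand \<Gamma> in the bound on \<open>w\<close> allows for the larger deficit at the earlier
  time.\<close>

lemma zeta_shift_gap_limits:
  fixes p d k :: "nat \<Rightarrow> nat" and \<beta> :: "nat \<Rightarrow> real"
  defines "v \<equiv> \<lambda>N. real (k N) * min 1 (zeta (p N) (d N) (k N))"
  defines "\<Gamma> \<equiv> \<lambda>N. 2 * \<beta> N * sqrt (v N)"
  assumes v: "filterlim v at_top sequentially" and \<beta>: "filterlim \<beta> at_top sequentially"
    and w: "\<forall>\<^sub>F N in sequentially. 0 \<le> w N \<and> w N \<le> v N + \<Gamma> N"
  shows "filterlim \<Gamma> at_top sequentially" "(\<lambda>N. w N / (\<Gamma> N)\<^sup>2) \<longlonglongrightarrow> 0"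
proof -
  have "filterlim (\<lambda>N. \<beta> N * sqrt (v N)) at_top sequentially"
    by (rule filterlim_at_top_mult_at_top[OF \<beta> filterlim_compose[OF sqrt_at_top v]])
  from filterlim_tendsto_pos_mult_at_top[OF tendsto_const[of 2] _ this]
  show \<Gamma>: "filterlim \<Gamma> at_top sequentially" by (simp add: \<Gamma>_def mult.assoc)
  have "filterlim (\<lambda>N. \<beta> N * \<beta> N) at_top sequentially" by (rule filterlim_at_top_mult_at_top[OF \<beta> \<beta>])
  from filterlim_tendsto_pos_mult_at_top[OF tendsto_const[of 4] _ this]
  have "(\<lambda>N. inverse (4 * (\<beta> N * \<beta> N))) \<longlonglongrightarrow> 0" by (intro tendsto_inverse_0_at_top) simp
  from tendsto_add[OF this tendsto_inverse_0_at_top[OF \<Gamma>]]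
  have lim: "(\<lambda>N. inverse (4 * (\<beta> N * \<beta> N)) + inverse (\<Gamma> N)) \<longlonglongrightarrow> 0" by simp
  show "(\<lambda>N. w N / (\<Gamma> N)\<^sup>2) \<longlonglongrightarrow> 0"
  proof (rule tendsto_sandwich[where f = "\<lambda>_. 0", OF _ _ _ lim])
    show "\<forall>\<^sub>F N in sequentially. 0 \<le> w N / (\<Gamma> N)\<^sup>2" using w by eventually_elim auto
    show "\<forall>\<^sub>F N in sequentially. w N / (\<Gamma> N)\<^sup>2 \<le> inverse (4 * (\<beta> N * \<beta> N)) + inverse (\<Gamma> N)"
      using w filterlim_at_top_dense[THEN iffD1, OF v, rule_format, of 0]
        filterlim_at_top_dense[THEN iffD1, OF \<beta>, rule_format, of 0]
        filterlim_at_top_dense[THEN iffD1, OF \<Gamma>, rule_format, of 0]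
    proof eventually_elim
      case (elim N)
      have "w N / (\<Gamma> N)\<^sup>2 \<le> (v N + \<Gamma> N) / (\<Gamma> N)\<^sup>2" using elim by (intro divide_right_mono) auto
      also have "\<dots> = v N / (\<Gamma> N)\<^sup>2 + \<Gamma> N / (\<Gamma> N)\<^sup>2" by (rule add_divide_distrib)
      also have "v N / (\<Gamma> N)\<^sup>2 = inverse (4 * (\<beta> N * \<beta> N))"
        using elim by (simp add: \<Gamma>_def power_mult_distrib power2_eq_square[of "\<beta> N"] field_simps)
      also have "\<Gamma> N / (\<Gamma> N)\<^sup>2 = inverse (\<Gamma> N)" using elim by (simp add: power2_eq_square field_simps)
      finally show ?case .
    qed
  qed auto
qed

text \<open>By definition of the entropic time the gap is known exactly, so the argument stays at
  the level of entropies and never estimates the time.\<close>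

lemma entropy_window_lower:
  fixes p d k :: "nat \<Rightarrow> nat" and dir :: orientation and \<beta> :: "nat \<Rightarrow> real"
  assumes prime_p: "\<forall>N. prime (p N)"
    and d0: "\<forall>\<^sub>F N in sequentially. d N > 0"
    and k: "filterlim k at_top sequentially"
    and dk: "\<forall>\<^sub>F N in sequentially. d N < k N"
    and lim: "filterlim (\<lambda>N. (real (k N) - real (d N)) * real (p N)) at_top sequentially"
    and \<beta>: "filterlim \<beta> at_top sequentially"
    and df: "\<forall>\<^sub>F N in sequentially. entropic_time_defined (p N) (d N) (k N) (- \<beta> N)"
  shows "\<exists>b. b \<longlonglongrightarrow> 0 \<and> (\<forall>\<^sub>F N in sequentially. \<forall>Z. length Z = k N \<longrightarrow> set Z \<subseteq> carrier (Zpow (p N) (d N)) \<longrightarrow>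
      \<bar>tv_to_uniform dir (Zpow (p N) (d N)) Z (entropic_time dir (p N) (d N) (k N) (- \<beta> N)) - 1\<bar> \<le> b N)"
proof -
  have p: "p N \<ge> 2" for N using prime_p prime_ge_2_nat by blast
  let ?z = "\<lambda>N. zeta (p N) (d N) (k N)"
  obtain s where s: "\<And>N. k N > 0 \<Longrightarrow> entropic_time_defined (p N) (d N) (k N) (- \<beta> N) \<Longrightarrow>
      s N \<ge> 0 \<and> deficit dir (p N) (s N) = zeta_shift (p N) (d N) (k N) (- \<beta> N) \<and>
      entropic_time dir (p N) (d N) (k N) (- \<beta> N) = s N * real (k N)"
    using entropic_time_sequence[of p k d "\<lambda>N. - \<beta> N" dir] p by blast
  have k0: "\<forall>\<^sub>F N in sequentially. k N > 0" using dk by eventually_elim simp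
  have s0: "\<forall>\<^sub>F N in sequentially. s N \<ge> 0" using k0 df by eventually_elim (simp add: s)
  let ?r = "\<lambda>N. deficit dir (p N) (s N)"
  let ?\<Gamma> = "\<lambda>N. 2 * \<beta> N * sqrt (real (k N) * min 1 (?z N))"
  have v: "filterlim (\<lambda>N. real (k N) * min 1 (?z N)) at_top sequentially"
    by (rule filterlim_k_zeta[OF p k dk lim])
  have gap: "\<forall>\<^sub>F N in sequentially. real (k N) * (?r N - ?z N) = ?\<Gamma> N"
    using d0 dk df
  proof eventually_elim
    case (elim N)
    have k1: "k N > 0" using elim by simp
    from zeta_shift_gap[OF k1 zeta_basic(1)[OF p[of N] elim(1,2)], of "- \<beta> N"] s[OF k1 elim(3)]
    have "real (k N) * (?z N - ?r N) = - ?\<Gamma> N" by simp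
    then show ?case by (simp add: algebra_simps)
  qed
  have w: "\<forall>\<^sub>F N in sequentially. 0 \<le> real (k N) * min 1 (?r N) \<and>
      real (k N) * min 1 (?r N) \<le> real (k N) * min 1 (?z N) + ?\<Gamma> N"
    using gap d0 dk filterlim_at_top_dense[THEN iffD1, OF \<beta>, rule_format, of 0]
  proof eventually_elim
    case (elim N)
    have z: "?z N > 0" by (rule zeta_basic(1)[OF p[of N] elim(2,3)])
    have k1: "real (k N) > 0" using elim by simp
    have "0 \<le> ?\<Gamma> N" using elim(4) z k1 by (intro mult_nonneg_nonneg) auto
    then have "?r N - ?z N \<ge> 0" unfolding elim(1)[symmetric] using k1 by (simp add: zero_le_mult_iff)
    \<comment> \<open>Truncation at 1 is a 1-Lipschitz map.\<close>
    then have "min 1 (?r N) \<le> min 1 (?z N) + (?r N - ?z N)" by (auto simp: min_def)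
    then have "real (k N) * min 1 (?r N) \<le> real (k N) * (min 1 (?z N) + (?r N - ?z N))"
      by (intro mult_left_mono) auto
    then have "real (k N) * min 1 (?r N) \<le> real (k N) * min 1 (?z N) + ?\<Gamma> N"
      unfolding distrib_left elim(1) .
    moreover have "0 \<le> real (k N) * min 1 (?r N)" using deficit_nonneg[OF p[of N], of dir "s N"] by auto
    ultimately show ?case by blast
  qed
  note G = zeta_shift_gap_limits[OF v \<beta> w]
  have "filterlim (\<lambda>N. real (k N) * (?r N - ?z N)) at_top sequentially"
    by (rule filterlim_cong[THEN iffD2, OF refl refl gap G(1)])
  moreover have "(\<lambda>N. real (k N) * min 1 (?r N) / (real (k N) * (?r N - ?z N))\<^sup>2) \<longlonglongrightarrow> 0"
    by (rule Lim_transform_eventually[OF G(2)]) (use gap in eventually_elim, simp)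
  ultimately obtain b where b: "b \<longlonglongrightarrow> 0" "\<forall>\<^sub>F N in sequentially. \<forall>Z. length Z = k N \<longrightarrow> set Z \<subseteq> carrier (Zpow (p N) (d N)) \<longrightarrow>
      \<bar>tv_to_uniform dir (Zpow (p N) (d N)) Z (s N * real (k N)) - 1\<bar> \<le> b N"
    using entropy_gap_lower[OF prime_p k0 s0, of dir d] by blast
  from b(2) k0 df have "\<forall>\<^sub>F N in sequentially. \<forall>Z. length Z = k N \<longrightarrow> set Z \<subseteq> carrier (Zpow (p N) (d N)) \<longrightarrow>
      \<bar>tv_to_uniform dir (Zpow (p N) (d N)) Z (entropic_time dir (p N) (d N) (k N) (- \<beta> N)) - 1\<bar> \<le> b N"
    by eventually_elim (simp add: s)
  with b(1) show ?thesis by blast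
qed

lemma entropy_window_upper:
  fixes p d k :: "nat \<Rightarrow> nat" and dir :: orientation and \<beta> :: "nat \<Rightarrow> real"
  assumes prime_p: "\<forall>N. prime (p N)"
    and d0: "\<forall>\<^sub>F N in sequentially. d N > 0"
    and k: "filterlim k at_top sequentially"
    and dk: "\<forall>\<^sub>F N in sequentially. d N < k N"
    and lim: "filterlim (\<lambda>N. (real (k N) - real (d N)) * real (p N)) at_top sequentially"
    and \<beta>: "filterlim \<beta> at_top sequentially"
    and df: "\<forall>\<^sub>F N in sequentially. entropic_time_defined (p N) (d N) (k N) (\<beta> N)"
  shows "tendsto_in_prob (\<lambda>N. random_generators (Zpow (p N) (d N)) (k N))
      (\<lambda>N Z. tv_to_uniform dir (Zpow (p N) (d N)) Z (entropic_time dir (p N) (d N) (k N) (\<beta> N))) 0"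
proof -
  have p: "p N \<ge> 2" for N using prime_p prime_ge_2_nat by blast
  let ?z = "\<lambda>N. zeta (p N) (d N) (k N)"
  obtain s where s: "\<And>N. k N > 0 \<Longrightarrow> entropic_time_defined (p N) (d N) (k N) (\<beta> N) \<Longrightarrow>
      s N \<ge> 0 \<and> deficit dir (p N) (s N) = zeta_shift (p N) (d N) (k N) (\<beta> N) \<and>
      entropic_time dir (p N) (d N) (k N) (\<beta> N) = s N * real (k N)"
    using entropic_time_sequence[of p k d "\<lambda>N. \<beta> N" dir] p by blast
  have k0: "\<forall>\<^sub>F N in sequentially. k N > 0" using dk by eventually_elim simp
  have s0: "\<forall>\<^sub>F N in sequentially. s N \<ge> 0" using k0 df by eventually_elim (simp add: s)
  let ?r = "\<lambda>N. deficit dir (p N) (s N)"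
  let ?\<Gamma> = "\<lambda>N. 2 * \<beta> N * sqrt (real (k N) * min 1 (?z N))"
  have v: "filterlim (\<lambda>N. real (k N) * min 1 (?z N)) at_top sequentially"
    by (rule filterlim_k_zeta[OF p k dk lim])
  have gap: "\<forall>\<^sub>F N in sequentially. real (k N) * (?z N - ?r N) = ?\<Gamma> N"
    using d0 dk df
  proof eventually_elim
    case (elim N)
    have k1: "k N > 0" using elim by simp
    from zeta_shift_gap[OF k1 zeta_basic(1)[OF p[of N] elim(1,2)], of "\<beta> N"] s[OF k1 elim(3)]
    show ?case by simp
  qed
  have w: "\<forall>\<^sub>F N in sequentially. 0 \<le> real (k N) * min 1 (?r N) \<and>
      real (k N) * min 1 (?r N) \<le> real (k N) * min 1 (?z N) + ?\<Gamma> N"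
    using gap d0 dk filterlim_at_top_dense[THEN iffD1, OF \<beta>, rule_format, of 0]
  proof eventually_elim
    case (elim N)
    have z: "?z N > 0" by (rule zeta_basic(1)[OF p[of N] elim(2,3)])
    have k1: "real (k N) > 0" using elim by simp
    have \<Gamma>0: "0 \<le> ?\<Gamma> N" using elim(4) z k1 by (intro mult_nonneg_nonneg) auto
    then have "?r N \<le> ?z N" unfolding elim(1)[symmetric] using k1 by (simp add: zero_le_mult_iff)
    then have "real (k N) * min 1 (?r N) \<le> real (k N) * min 1 (?z N)"
      by (intro mult_left_mono) auto
    moreover have "0 \<le> real (k N) * min 1 (?r N)" using deficit_nonneg[OF p[of N], of dir "s N"] by auto
    ultimately show ?case using \<Gamma>0 by simp
  qed
  note G = zeta_shift_gap_limits[OF v \<beta> w]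
  have "filterlim (\<lambda>N. real (k N) * (?z N - ?r N)) at_top sequentially"
    by (rule filterlim_cong[THEN iffD2, OF refl refl gap G(1)])
  moreover have "(\<lambda>N. real (k N) * min 1 (?r N) / (real (k N) * (?z N - ?r N))\<^sup>2) \<longlonglongrightarrow> 0"
    by (rule Lim_transform_eventually[OF G(2)]) (use gap in eventually_elim, simp)
  ultimately have "tendsto_in_prob (\<lambda>N. random_generators (Zpow (p N) (d N)) (k N))
      (\<lambda>N Z. tv_to_uniform dir (Zpow (p N) (d N)) Z (s N * real (k N))) 0"
    by (intro entropy_gap_upper prime_p k0 s0)
  then show ?thesis
    by (rule tendsto_in_prob_cong) (use k0 df in eventually_elim, simp add: s)
qed

text \<open>Bounded (k - d) p keeps both k - d and p^(k - d) bounded: the former makes k and d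
  interchangeable in the time scale, the latter bounds the size of the kernel. Both bounds then hold
  for every generating list.\<close>

lemma few_generators_cutoff:
  fixes p d k :: "nat \<Rightarrow> nat" and dir :: orientation
  assumes prime_p: "\<forall>N. prime (p N)"
    and k: "filterlim k at_top sequentially"
    and dk: "\<forall>\<^sub>F N in sequentially. d N \<le> k N"
    and bd: "(\<lambda>N. (real (k N) - real (d N)) * real (p N)) \<in> O(\<lambda>_. 1)"
  shows "cutoff_whp
          (\<lambda>N. cond_pmf (random_generators (Zpow (p N) (d N)) (k N)) (generating (Zpow (p N) (d N))))
          (\<lambda>N. tv_to_uniform dir (Zpow (p N) (d N)))
          (\<lambda>N. 1 / 2 * real (d N) * ln (real (d N)) / (1 - cos (2 * pi / real (p N))))"
  unfolding cutoff_whp_def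
proof
  fix \<epsilon> :: real assume \<epsilon>: "\<epsilon> \<in> {0<..<1}"
  have p: "p N \<ge> 2" for N using prime_p prime_ge_2_nat by blast
  obtain C' where C': "C' > 0" "\<forall>\<^sub>F N in sequentially. norm ((real (k N) - real (d N)) * real (p N)) \<le> C' * norm (1::real)"
    using landau_o.bigE[OF bd] by metis
  obtain n0 :: nat where n0: "C' \<le> real n0" using real_arch_simple by blast
  have n1: "n0 \<ge> 1" using C'(1) n0 by (cases n0) auto
  \<comment> \<open>Either k = d and the power is 1, or k - d >= 1 and p itself is at most
    \<open>n0\<close>.\<close>
  have md: "\<forall>\<^sub>F N in sequentially. d N \<le> k N \<and> k N \<le> d N + n0 \<and> p N ^ (k N - d N) \<le> n0 ^ n0"
    using C'(2) dk
  proof eventually_elim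
    case (elim N)
    have "real ((k N - d N) * p N) \<le> real n0" using elim n0 by (simp add: of_nat_diff)
    then have le: "(k N - d N) * p N \<le> n0" by (simp only: of_nat_le_iff)
    have "(k N - d N) * 1 \<le> (k N - d N) * p N" using p[of N] by (intro mult_le_mono2) simp
    then have m: "k N - d N \<le> n0" using le unfolding mult_1_right by (rule order.trans)
    moreover have "p N ^ (k N - d N) \<le> n0 ^ n0"
    proof (cases "k N - d N = 0")
      case True
      then show ?thesis using n1 by simp
    next
      case False
      then have "1 * p N \<le> (k N - d N) * p N" by (intro mult_le_mono1) simp
      then have "p N \<le> n0" using le unfolding mult_1 by (rule order.trans)
      then have "p N ^ (k N - d N) \<le> n0 ^ (k N - d N)" by (intro power_mono) auto
      also have "\<dots> \<le> n0 ^ n0" using n1 m by (intro power_increasing) auto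
      finally show ?thesis .
    qed
    ultimately show ?case using elim by simp
  qed
  have d_lim: "filterlim (\<lambda>N. real (d N)) at_top sequentially"
  proof -
    have "filterlim (\<lambda>N. real (k N)) at_top sequentially" by (rule filterlim_compose[OF filterlim_real_sequentially k])
    then have "filterlim (\<lambda>N. - real n0 + real (k N)) at_top sequentially"
      by (rule filterlim_tendsto_add_at_top[OF tendsto_const])
    then show ?thesis by (rule filterlim_at_top_mono) (use md in eventually_elim, simp)
  qed
  have d_ge: "\<forall>\<^sub>F N in sequentially. real (d N) \<ge> 2"
    using d_lim unfolding filterlim_at_top by (rule spec)
  define T where "T N = 1 / 2 * real (d N) * ln (real (d N)) / (1 - cos (2 * pi / real (p N)))" for N
  have rate1: "rate (p N) 1 = 1 - cos (2 * pi / real (p N))" for N by (simp add: rate_def)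
  have rp: "rate (p N) 1 > 0" for N by (rule rate_1_pos[OF p])
  \<comment> \<open>Time per coordinate at \<open>a\<close> times the claimed cutoff time.\<close>
  define s where "s a N = a * T N / real (k N)" for a N
  have s_rate: "s a N * rate (p N) 1 = a / 2 * (real (d N) / real (k N)) * ln (real (d N))" for a N
    using rp[of N] by (simp add: s_def T_def rate1[symmetric])
  have sk: "\<forall>\<^sub>F N in sequentially. \<forall>a\<ge>0. a * T N = s a N * real (k N) \<and> 0 \<le> s a N"
    using d_ge md
  proof eventually_elim
    case (elim N)
    have "real (k N) > 0" "ln (real (d N)) \<ge> 0" using elim by auto
    then show ?case using rp[of N] unfolding s_def T_def rate1[symmetric] by auto
  qed
  \<comment> \<open>On the support of the conditioned law every list generates, so the convergence
    in probability follows from deterministic bounds.\<close>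
  have supp: "\<forall>\<^sub>F N in sequentially. \<forall>Z\<in>set_pmf (cond_pmf (random_generators (Zpow (p N) (d N)) (k N)) (generating (Zpow (p N) (d N)))).
      length Z = k N \<and> set Z \<subseteq> carrier (Zpow (p N) (d N)) \<and> Z \<in> generating (Zpow (p N) (d N))"
    using dk
  proof eventually_elim
    case (elim N)
    have p0: "p N > 0" using p[of N] by simp
    show ?case unfolding set_cond_pmf[OF generating_possible[OF p[of N] elim]]
      using set_random_generators[OF p0] by blast
  qed
  show "tendsto_in_prob (\<lambda>N. cond_pmf (random_generators (Zpow (p N) (d N)) (k N)) (generating (Zpow (p N) (d N))))
        (\<lambda>N \<omega>. tv_to_uniform dir (Zpow (p N) (d N)) \<omega> ((1 + \<epsilon>) * (1 / 2 * real (d N) * ln (real (d N)) / (1 - cos (2 * pi / real (p N)))))) 0 \<and>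
     tendsto_in_prob (\<lambda>N. cond_pmf (random_generators (Zpow (p N) (d N)) (k N)) (generating (Zpow (p N) (d N))))
        (\<lambda>N \<omega>. tv_to_uniform dir (Zpow (p N) (d N)) \<omega> ((1 - \<epsilon>) * (1 / 2 * real (d N) * ln (real (d N)) / (1 - cos (2 * pi / real (p N)))))) 1"
    unfolding T_def[symmetric]
  proof
    let ?u = "s (1 + \<epsilon>)"
    have "filterlim (\<lambda>x. 1 / 2 * (x / (x + real n0)) * ln x :: real) at_top at_top" by real_asymp
    from filterlim_compose[OF this d_lim]
    have large: "\<forall>\<^sub>F N in sequentially. 1 \<le> 1 / 2 * (real (d N) / (real (d N) + real n0)) * ln (real (d N))"
      unfolding filterlim_at_top by (rule spec)
    have ratio_ge: "\<forall>\<^sub>F N in sequentially. real (d N) / (real (d N) + real n0) \<le> real (d N) / real (k N)"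
      using d_ge md
    proof eventually_elim
      case (elim N)
      have "real (k N) \<le> real (d N) + real n0" using elim by (metis of_nat_add of_nat_le_iff)
      moreover have "real (k N) > 0" using elim by auto
      ultimately show ?case by (intro divide_left_mono mult_pos_pos) auto
    qed
    \<comment> \<open>Up to 9216 = 96^2 this dominates k S^2. Replacing d / k by d / (d + n0) in the
      exponent is harmless, since n0 ln d / (d + n0) tends to 0.\<close>
    define g where "g x = (x + real n0) * exp (- (1 + \<epsilon>) * (x / (x + real n0)) * ln x)" for x :: real
    have g_lim: "(g \<longlongrightarrow> 0) at_top"
      unfolding g_def using \<epsilon> by real_asymp
    have kS: "\<forall>\<^sub>F N in sequentially. real (k N) * (nontrivial_sum (p N) (?u N))\<^sup>2 \<le> 9216 * g (real (d N))"
      using large ratio_ge d_ge md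
    proof eventually_elim
      case (elim N)
      have l: "ln (real (d N)) \<ge> 0" using elim(3) by simp
      have kd: "real (k N) \<le> real (d N) + real n0" using elim(4) by (metis of_nat_add of_nat_le_iff)
      define q where "q = (real (d N) / (real (d N) + real n0)) * ln (real (d N))"
      have q: "q \<ge> 0" using l by (simp add: q_def)
      have q2: "q \<le> (real (d N) / real (k N)) * ln (real (d N))"
        unfolding q_def using elim(2) l by (intro mult_right_mono)
      have ur: "?u N * rate (p N) 1 \<ge> (1 + \<epsilon>) / 2 * q"
        unfolding s_rate mult.assoc using q2 \<epsilon> by (intro mult_left_mono) auto
      have "1 \<le> 1 / 2 * q" using elim(1) unfolding q_def by (simp only: mult.assoc)
      also have "\<dots> \<le> (1 + \<epsilon>) / 2 * q" using q \<epsilon> by (intro mult_right_mono) auto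
      finally have "1 \<le> ?u N * rate (p N) 1" using ur by (rule order.trans)
      from nontrivial_sum_le_exp[OF p this]
      have "(nontrivial_sum (p N) (?u N))\<^sup>2 \<le> (96 * exp (- ?u N * rate (p N) 1))\<^sup>2"
        by (intro power_mono) (auto simp: nontrivial_sum_def sum_nonneg)
      also have "\<dots> = 9216 * exp (- (2 * (?u N * rate (p N) 1)))"
        by (simp add: power_mult_distrib exp_double[symmetric])
      also have "\<dots> \<le> 9216 * exp (- (1 + \<epsilon>) * q)" using ur by (simp add: field_simps)
      finally have "real (k N) * (nontrivial_sum (p N) (?u N))\<^sup>2 \<le> (real (d N) + real n0) * (9216 * exp (- (1 + \<epsilon>) * q))"
        using kd by (intro mult_mono) auto
      then show ?case unfolding g_def q_def by (simp only: mult_ac)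
    qed
    define b where "b N = sqrt (exp (9216 * g (real (d N))) - 1)" for N
    have "(\<lambda>N. g (real (d N))) \<longlonglongrightarrow> 0" by (rule filterlim_compose[OF g_lim d_lim])
    then have "(\<lambda>N. sqrt (exp (9216 * g (real (d N))) - 1)) \<longlonglongrightarrow> sqrt (exp (9216 * 0) - 1)"
      by (intro tendsto_intros)
    then have b: "b \<longlonglongrightarrow> 0" by (simp add: b_def[abs_def])
    show "tendsto_in_prob (\<lambda>N. cond_pmf (random_generators (Zpow (p N) (d N)) (k N)) (generating (Zpow (p N) (d N))))
        (\<lambda>N \<omega>. tv_to_uniform dir (Zpow (p N) (d N)) \<omega> ((1 + \<epsilon>) * T N)) 0"
    proof (rule tendsto_in_prob_deterministic[OF _ b])
      show "\<forall>\<^sub>F N in sequentially. \<forall>\<omega>\<in>set_pmf (cond_pmf (random_generators (Zpow (p N) (d N)) (k N)) (generating (Zpow (p N) (d N)))).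
          \<bar>tv_to_uniform dir (Zpow (p N) (d N)) \<omega> ((1 + \<epsilon>) * T N) - 0\<bar> \<le> b N"
        using kS supp sk d_ge md
      proof eventually_elim
        case (elim N)
        have k0: "k N > 0" using elim(4,5) by auto
        have u: "(1 + \<epsilon>) * T N = ?u N * real (k N)" "0 \<le> ?u N" using elim(3) \<epsilon> by auto
        show ?case
        proof
          fix Z assume "Z \<in> set_pmf (cond_pmf (random_generators (Zpow (p N) (d N)) (k N)) (generating (Zpow (p N) (d N))))"
          then have Z: "length Z = k N" "set Z \<subseteq> carrier (Zpow (p N) (d N))" "Z \<in> generating (Zpow (p N) (d N))"
            using elim(2) by auto
          have "tv_to_uniform dir (Zpow (p N) (d N)) Z (?u N * real (k N))
             \<le> tv_dist (coord_walk dir (p N) (k N) (?u N * real (k N))) (pmf_of_set (carrier (Zpow (p N) (k N))))"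
            by (rule tv_to_uniform_le_coord_walk[OF p k0 Z])
          also have "\<dots> \<le> sqrt (exp (real (k N) * (nontrivial_sum (p N) (?u N))\<^sup>2) - 1)"
            by (rule tv_coord_walk_le[OF p k0 u(2)])
          also have "\<dots> \<le> b N" unfolding b_def using elim(1) by simp
          finally show "\<bar>tv_to_uniform dir (Zpow (p N) (d N)) Z ((1 + \<epsilon>) * T N) - 0\<bar> \<le> b N"
            unfolding u(1) using tv_to_uniform_bounds(1)[of dir "Zpow (p N) (d N)" Z "?u N * real (k N)"] by simp
        qed
      qed
    qed
  next
    let ?u = "s (1 - \<epsilon>)"
    define M where "M = 1 + real (n0 ^ n0)"
    define b where "b N = M * (4 / exp (\<epsilon> * ln (real (d N))))" for N
    have "((\<lambda>x::real. 4 / exp (\<epsilon> * ln x)) \<longlongrightarrow> 0) at_top" using \<epsilon> by real_asymp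
    from tendsto_mult_left[OF filterlim_compose[OF this d_lim], of M]
    have b: "b \<longlonglongrightarrow> 0" by (simp add: b_def[abs_def])
    show "tendsto_in_prob (\<lambda>N. cond_pmf (random_generators (Zpow (p N) (d N)) (k N)) (generating (Zpow (p N) (d N))))
        (\<lambda>N \<omega>. tv_to_uniform dir (Zpow (p N) (d N)) \<omega> ((1 - \<epsilon>) * T N)) 1"
    proof (rule tendsto_in_prob_deterministic[OF _ b])
      show "\<forall>\<^sub>F N in sequentially. \<forall>\<omega>\<in>set_pmf (cond_pmf (random_generators (Zpow (p N) (d N)) (k N)) (generating (Zpow (p N) (d N)))).
          \<bar>tv_to_uniform dir (Zpow (p N) (d N)) \<omega> ((1 - \<epsilon>) * T N) - 1\<bar> \<le> b N"
        using supp sk d_ge md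
      proof eventually_elim
        case (elim N)
        have k0: "k N > 0" and dk': "d N \<le> k N" using elim(3,4) by auto
        have l: "ln (real (d N)) \<ge> 0" and dr: "real (d N) > 0" using elim(3) by auto
        have u: "(1 - \<epsilon>) * T N = ?u N * real (k N)" "0 \<le> ?u N" using elim(2) \<epsilon> by auto
        \<comment> \<open>For the lower bound k >= d helps: it shortens the time per coordinate, so
          that k exp (- 2 s rate) is at least d^\<epsilon>.\<close>
        have "real (d N) / real (k N) \<le> 1" using dk' k0 by simp
        then have "(real (d N) / real (k N)) * ln (real (d N)) \<le> 1 * ln (real (d N))" using l by (intro mult_right_mono)
        then have "2 * (?u N * rate (p N) 1) \<le> (1 - \<epsilon>) * ln (real (d N))"
          unfolding s_rate using mult_left_mono[of "(real (d N) / real (k N)) * ln (real (d N))" "ln (real (d N))" "1 - \<epsilon>"] \<epsilon>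
          by simp
        then have "exp (- ((1 - \<epsilon>) * ln (real (d N)))) \<le> exp (- 2 * ?u N * rate (p N) 1)" by simp
        then have "real (d N) * exp (- ((1 - \<epsilon>) * ln (real (d N)))) \<le> real (k N) * exp (- 2 * ?u N * rate (p N) 1)"
          using dk' by (intro mult_mono) auto
        moreover have "real (d N) * exp (- ((1 - \<epsilon>) * ln (real (d N)))) = exp (\<epsilon> * ln (real (d N)))"
        proof -
          have "real (d N) * exp (- ((1 - \<epsilon>) * ln (real (d N)))) = exp (ln (real (d N))) * exp (- ((1 - \<epsilon>) * ln (real (d N))))"
            using dr by simp
          also have "\<dots> = exp (\<epsilon> * ln (real (d N)))" unfolding exp_add[symmetric] by (simp add: algebra_simps)
          finally show ?thesis .
        qed
        ultimately have "exp (\<epsilon> * ln (real (d N))) \<le> real (k N) * exp (- 2 * ?u N * rate (p N) 1)" by simp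
        then have "4 / (real (k N) * exp (- 2 * ?u N * rate (p N) 1)) \<le> 4 / exp (\<epsilon> * ln (real (d N)))"
          using k0 by (intro divide_left_mono) auto
        moreover have "1 + real (p N) ^ (k N - d N) \<le> M"
        proof -
          have "real (p N ^ (k N - d N)) \<le> real (n0 ^ n0)" using elim(4) unfolding of_nat_le_iff by blast
          then show ?thesis unfolding M_def of_nat_power by (rule add_left_mono)
        qed
        ultimately have le: "(1 + real (p N) ^ (k N - d N)) * (4 / (real (k N) * exp (- 2 * ?u N * rate (p N) 1))) \<le> b N"
          unfolding b_def by (intro mult_mono) (auto simp: M_def)
        show ?case
        proof
          fix Z assume "Z \<in> set_pmf (cond_pmf (random_generators (Zpow (p N) (d N)) (k N)) (generating (Zpow (p N) (d N))))"
          then have Z: "length Z = k N" "set Z \<subseteq> carrier (Zpow (p N) (d N))" using elim(1) by auto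
          have "1 - b N \<le> tv_to_uniform dir (Zpow (p N) (d N)) Z (?u N * real (k N))"
            using tv_ge_of_character_sum[OF p k0 u(2) dk' Z, of dir] le by linarith
          then show "\<bar>tv_to_uniform dir (Zpow (p N) (d N)) Z ((1 - \<epsilon>) * T N) - 1\<bar> \<le> b N"
            unfolding u(1) using tv_to_uniform_bounds(2)[of dir "Zpow (p N) (d N)" Z "?u N * real (k N)"]
            by (simp add: abs_if)
        qed
      qed
    qed
  qed
qed

theorem theorem3p4:
  fixes p d k :: "nat \<Rightarrow> nat" and dir :: orientation
  assumes prime_p: "\<forall>N. prime (p N)"
    and size: "filterlim (\<lambda>N. p N ^ d N) at_top sequentially"
    and k_large: "filterlim k at_top sequentially"
    and k_bound: "(\<lambda>N. real (k N)) \<in> O(\<lambda>N. real (d N) * ln (real (p N)))"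
  shows
    "((\<forall>\<^sub>F N in sequentially. d N < k N) \<and>
      filterlim (\<lambda>N. (real (k N) - real (d N)) * real (p N)) at_top sequentially \<longrightarrow>
        cutoff_whp
          (\<lambda>N. random_generators (Zpow (p N) (d N)) (k N))
          (\<lambda>N. tv_to_uniform dir (Zpow (p N) (d N)))
          (\<lambda>N. entropic_time dir (p N) (d N) (k N) 0) \<and>
        (\<forall>(\<beta> :: nat \<Rightarrow> real) (c :: real).
          (\<forall>N. 0 < \<beta> N) \<and> filterlim \<beta> at_top sequentially \<and>
          (\<forall>\<^sub>F N in sequentially.
             entropic_time_defined (p N) (d N) (k N) (\<beta> N) \<and>
             entropic_time_defined (p N) (d N) (k N) (- \<beta> N)) \<and>
          c \<in> {-1, 1} \<longrightarrow>
            tendsto_in_prob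
              (\<lambda>N. random_generators (Zpow (p N) (d N)) (k N))
              (\<lambda>N Z. tv_to_uniform dir (Zpow (p N) (d N)) Z
                        (entropic_time dir (p N) (d N) (k N) (c * \<beta> N)))
              (of_bool (c = -1)) \<and>
            (c = -1 \<longrightarrow>
              (\<forall>Z :: nat \<Rightarrow> (nat \<Rightarrow> int) list.
                (\<forall>N. length (Z N) = k N \<and> set (Z N) \<subseteq> carrier (Zpow (p N) (d N))) \<longrightarrow>
                (\<lambda>N. tv_to_uniform dir (Zpow (p N) (d N)) (Z N)
                        (entropic_time dir (p N) (d N) (k N) (c * \<beta> N))) \<longlonglongrightarrow> 1))))
     \<and>
     ((\<forall>\<^sub>F N in sequentially. d N \<le> k N) \<and>
      (\<lambda>N. (real (k N) - real (d N)) * real (p N)) \<in> O(\<lambda>_. 1) \<longrightarrow>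
        cutoff_whp
          (\<lambda>N. cond_pmf (random_generators (Zpow (p N) (d N)) (k N))
                         (generating (Zpow (p N) (d N))))
          (\<lambda>N. tv_to_uniform dir (Zpow (p N) (d N)))
          (\<lambda>N. 1 / 2 * real (d N) * ln (real (d N)) / (1 - cos (2 * pi / real (p N)))))"
proof (intro conjI impI)
  have d_pos: "\<forall>\<^sub>F N in sequentially. d N > 0"
  proof -
    have "\<forall>\<^sub>F N in sequentially. 2 \<le> p N ^ d N"
      using size unfolding filterlim_at_top by (rule spec)
    then show ?thesis
    proof eventually_elim
      case (elim N)
      then show ?case by (cases "d N") auto
    qed
  qed
  {
    assume "(\<forall>\<^sub>F N in sequentially. d N < k N) \<and>
      filterlim (\<lambda>N. (real (k N) - real (d N)) * real (p N)) at_top sequentially"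
    then have dk: "\<forall>\<^sub>F N in sequentially. d N < k N"
      and lim: "filterlim (\<lambda>N. (real (k N) - real (d N)) * real (p N)) at_top sequentially"
      by (rule conjunct1, rule conjunct2)
    show "cutoff_whp
          (\<lambda>N. random_generators (Zpow (p N) (d N)) (k N))
          (\<lambda>N. tv_to_uniform dir (Zpow (p N) (d N)))
          (\<lambda>N. entropic_time dir (p N) (d N) (k N) 0)"
      by (rule entropy_cutoff[OF prime_p d_pos k_large k_bound dk lim])
    show "\<forall>(\<beta> :: nat \<Rightarrow> real) (c :: real).
          (\<forall>N. 0 < \<beta> N) \<and> filterlim \<beta> at_top sequentially \<and>
          (\<forall>\<^sub>F N in sequentially.
             entropic_time_defined (p N) (d N) (k N) (\<beta> N) \<and>
             entropic_time_defined (p N) (d N) (k N) (- \<beta> N)) \<and>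
          c \<in> {-1, 1} \<longrightarrow>
            tendsto_in_prob
              (\<lambda>N. random_generators (Zpow (p N) (d N)) (k N))
              (\<lambda>N Z. tv_to_uniform dir (Zpow (p N) (d N)) Z
                        (entropic_time dir (p N) (d N) (k N) (c * \<beta> N)))
              (of_bool (c = -1)) \<and>
            (c = -1 \<longrightarrow>
              (\<forall>Z :: nat \<Rightarrow> (nat \<Rightarrow> int) list.
                (\<forall>N. length (Z N) = k N \<and> set (Z N) \<subseteq> carrier (Zpow (p N) (d N))) \<longrightarrow>
                (\<lambda>N. tv_to_uniform dir (Zpow (p N) (d N)) (Z N)
                        (entropic_time dir (p N) (d N) (k N) (c * \<beta> N))) \<longlonglongrightarrow> 1))"
      (is "\<forall>\<beta> c. ?hyp \<beta> c \<longrightarrow> ?prob \<beta> c \<and> (c = -1 \<longrightarrow> ?det \<beta> c)")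
    proof (intro allI impI)
      fix \<beta> :: "nat \<Rightarrow> real" and c :: real
      assume hyp: "?hyp \<beta> c"
      then have \<beta>: "filterlim \<beta> at_top sequentially" and c: "c = -1 \<or> c = 1" by auto
      have df: "\<forall>\<^sub>F N in sequentially. entropic_time_defined (p N) (d N) (k N) (\<beta> N)"
        "\<forall>\<^sub>F N in sequentially. entropic_time_defined (p N) (d N) (k N) (- \<beta> N)"
        using hyp by (auto elim: eventually_mono)
      obtain b where b: "b \<longlonglongrightarrow> 0"
        "\<forall>\<^sub>F N in sequentially. \<forall>Z. length Z = k N \<longrightarrow> set Z \<subseteq> carrier (Zpow (p N) (d N)) \<longrightarrow>
          \<bar>tv_to_uniform dir (Zpow (p N) (d N)) Z (entropic_time dir (p N) (d N) (k N) (- \<beta> N)) - 1\<bar> \<le> b N"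
        using entropy_window_lower[OF prime_p d_pos k_large dk lim \<beta> df(2), of dir] by blast
      from c show "?prob \<beta> c \<and> (c = -1 \<longrightarrow> ?det \<beta> c)"
      proof
        assume c1: "c = 1"
        show ?thesis unfolding c1
          using entropy_window_upper[OF prime_p d_pos k_large dk lim \<beta> df(1), of dir] by simp
      next
        assume c1: "c = -1"
        have "tendsto_in_prob (\<lambda>N. random_generators (Zpow (p N) (d N)) (k N))
            (\<lambda>N Z. tv_to_uniform dir (Zpow (p N) (d N)) Z (entropic_time dir (p N) (d N) (k N) (- \<beta> N))) 1"
        proof (rule tendsto_in_prob_deterministic[OF _ b(1)])
          show "\<forall>\<^sub>F N in sequentially. \<forall>\<omega>\<in>set_pmf (random_generators (Zpow (p N) (d N)) (k N)).
             \<bar>tv_to_uniform dir (Zpow (p N) (d N)) \<omega> (entropic_time dir (p N) (d N) (k N) (- \<beta> N)) - 1\<bar> \<le> b N"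
            using b(2)
          proof eventually_elim
            case (elim N)
            have "p N > 0" using prime_p prime_gt_0_nat by blast
            from elim set_random_generators[OF this] show ?case by blast
          qed
        qed
        moreover have "(\<lambda>N. tv_to_uniform dir (Zpow (p N) (d N)) (Z N) (entropic_time dir (p N) (d N) (k N) (- \<beta> N))) \<longlonglongrightarrow> 1"
          if Z: "\<forall>N. length (Z N) = k N \<and> set (Z N) \<subseteq> carrier (Zpow (p N) (d N))" for Z
        proof -
          have "\<forall>\<^sub>F N in sequentially.
             \<bar>tv_to_uniform dir (Zpow (p N) (d N)) (Z N) (entropic_time dir (p N) (d N) (k N) (- \<beta> N)) - 1\<bar> \<le> b N"
            by (rule eventually_mono[OF b(2)]) (use Z in blast)
          then have "\<forall>\<^sub>F N in sequentially.
             norm (tv_to_uniform dir (Zpow (p N) (d N)) (Z N) (entropic_time dir (p N) (d N) (k N) (- \<beta> N)) - 1) \<le> b N"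
            by simp
          then have "(\<lambda>N. tv_to_uniform dir (Zpow (p N) (d N)) (Z N) (entropic_time dir (p N) (d N) (k N) (- \<beta> N)) - 1) \<longlonglongrightarrow> 0"
            by (rule Lim_null_comparison[OF _ b(1)])
          then show ?thesis by (rule LIM_zero_cancel)
        qed
        ultimately show ?thesis unfolding c1 by simp
      qed
    qed
  }
  assume "(\<forall>\<^sub>F N in sequentially. d N \<le> k N) \<and>
      (\<lambda>N. (real (k N) - real (d N)) * real (p N)) \<in> O(\<lambda>_. 1)"
  then show "cutoff_whp
          (\<lambda>N. cond_pmf (random_generators (Zpow (p N) (d N)) (k N))
                         (generating (Zpow (p N) (d N))))
          (\<lambda>N. tv_to_uniform dir (Zpow (p N) (d N)))
          (\<lambda>N. 1 / 2 * real (d N) * ln (real (d N)) / (1 - cos (2 * pi / real (p N))))"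
    using few_generators_cutoff[OF prime_p k_large] by blast
qed

end
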